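(* Let $F=F(x_1,\dots,x_n)$ be a free group of finite rank $n\in\mathbb{N}$ and $f:F\to F$ an endomorphism. Let $\Gamma=\langle F,t\mid x_i^t=f(x_i),\ i=1,\dots,n\rangle$ be the HNN-extension, let $\widehat\Gamma$ be its profinite completion, and let $P$ be the closure of the image of $F$ in $\widehat\Gamma$. Then $P$ is normal in $\widehat\Gamma$, $\widehat\Gamma=P\rtimes\widehat{\mathbb{Z}}$, and $P$ is a projective profinite group. Moreover, $P$ is free profinite of rank $n$ if and only if $f$ is an automorphism.
   Context: Notation: $x^t=t^{-1}xt$. $\widehat{\mathbb{Z}}$ is the profinite completion of $\mathbb{Z}$. A profinite group is projective if its cohomological dimension is at most $1$. *)

theory Defs
  imports "HOL-Analysis.Analysis" "HOL-Algebra.Product_Groups" "HOL-Algebra.Elementary_Groups" "HOL-Algebra.FiniteProduct" "HOL-Library.Extended_Nat"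
begin

section \<open>Free groups and presentations\<close>

text \<open>The letter \<open>(x, True)\<close> stands for the generator \<open>x\<close>, the letter \<open>(x, False)\<close> for its inverse.
  Elements of the free group are the reduced words.\<close>

type_synonym 'x word = "('x \<times> bool) list"

definition reduced_word :: "'x word \<Rightarrow> bool" where
  "reduced_word w \<longleftrightarrow> successively (\<lambda>a b. \<not> (fst a = fst b \<and> snd a \<noteq> snd b)) w"

fun cancel_cons :: "'x \<times> bool \<Rightarrow> 'x word \<Rightarrow> 'x word" where
  "cancel_cons a [] = [a]"
| "cancel_cons a (b # w) = (if fst a = fst b \<and> snd a \<noteq> snd b then w else a # b # w)"

definition free_group :: "'x set \<Rightarrow> 'x word monoid" where
  "free_group X = \<lparr>carrier = {w. reduced_word w \<and> fst ` set w \<subseteq> X},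
     monoid.mult = (\<lambda>u v. foldr cancel_cons u v),
     one = []\<rparr>"

definition free_gen :: "'x \<Rightarrow> 'x word" where
  "free_gen x = [(x, True)]"

definition normal_closure :: "('a, 'b) monoid_scheme \<Rightarrow> 'a set \<Rightarrow> 'a set" where
  "normal_closure G R = \<Inter>{N. N \<lhd> G \<and> R \<subseteq> N}"

definition presented_group :: "'x set \<Rightarrow> 'x word set \<Rightarrow> 'x word set monoid" where
  "presented_group X R = free_group X Mod normal_closure (free_group X) R"


section \<open>The HNN-extension of a free group by an endomorphism\<close>

text \<open>The generator \<open>x\<^sub>i\<close> of \<open>F\<close> becomes \<open>Some i\<close>; the stable letter \<open>t\<close> is \<open>None\<close>.\<close>

definition hnn_gens :: "nat \<Rightarrow> nat option set" where
  "hnn_gens n = insert None (Some ` {1..n})"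

definition hnn_word :: "nat word \<Rightarrow> nat option word" where
  "hnn_word = map (\<lambda>(i, s). (Some i, s))"

definition hnn_relators :: "nat \<Rightarrow> (nat word \<Rightarrow> nat word) \<Rightarrow> nat option word set" where
  "hnn_relators n f =
     (let E = free_group (hnn_gens n); t = free_gen None in
        (\<lambda>i. inv\<^bsub>E\<^esub> t \<otimes>\<^bsub>E\<^esub> free_gen (Some i) \<otimes>\<^bsub>E\<^esub> t
               \<otimes>\<^bsub>E\<^esub> inv\<^bsub>E\<^esub> hnn_word (f (free_gen i))) ` {1..n})"

definition hnn_group :: "nat \<Rightarrow> (nat word \<Rightarrow> nat word) \<Rightarrow> nat option word set monoid" where
  "hnn_group n f = presented_group (hnn_gens n) (hnn_relators n f)"

definition hnn_base_map :: "nat \<Rightarrow> (nat word \<Rightarrow> nat word) \<Rightarrow> nat word \<Rightarrow> nat option word set" where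
  "hnn_base_map n f w =
     normal_closure (free_group (hnn_gens n)) (hnn_relators n f) #>\<^bsub>free_group (hnn_gens n)\<^esub> hnn_word w"


section \<open>Profinite groups and profinite completions\<close>

definition topological_group :: "('a, 'b) monoid_scheme \<Rightarrow> 'a topology \<Rightarrow> bool" where
  "topological_group G T \<longleftrightarrow>
     group G \<and> topspace T = carrier G \<and>
     continuous_map (prod_topology T T) T (\<lambda>(x, y). x \<otimes>\<^bsub>G\<^esub> y) \<and>
     continuous_map T T (\<lambda>x. inv\<^bsub>G\<^esub> x)"

definition profinite_group :: "('a, 'b) monoid_scheme \<Rightarrow> 'a topology \<Rightarrow> bool" where
  "profinite_group G T \<longleftrightarrow>
     topological_group G T \<and> compact_space T \<and> Hausdorff_space T \<and>
     (\<forall>C x y. connectedin T C \<and> x \<in> C \<and> y \<in> C \<longrightarrow> x = y)"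

definition topologically_isomorphic ::
    "('a, 'b) monoid_scheme \<Rightarrow> 'a topology \<Rightarrow> ('c, 'd) monoid_scheme \<Rightarrow> 'c topology \<Rightarrow> bool" where
  "topologically_isomorphic G T H S \<longleftrightarrow> (\<exists>\<phi> \<in> iso G H. homeomorphic_map T S \<phi>)"

definition finite_index_normal :: "('a, 'b) monoid_scheme \<Rightarrow> 'a set set" where
  "finite_index_normal G = {N. N \<lhd> G \<and> finite (rcosets\<^bsub>G\<^esub> N)}"

text \<open>The inverse limit of the finite quotients \<open>G/N\<close>.  For \<open>N \<subseteq> M\<close> the transition map \<open>G/N \<rightarrow> G/M\<close>
  sends a coset of \<open>N\<close> to the unique coset of \<open>M\<close> containing it, whence the condition \<open>x N \<subseteq> x M\<close>.\<close>

definition profinite_completion :: "('a, 'b) monoid_scheme \<Rightarrow> ('a set \<Rightarrow> 'a set) monoid" where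
  "profinite_completion G =
     (product_group (finite_index_normal G) (\<lambda>N. G Mod N))
       \<lparr>carrier := {x \<in> \<Pi>\<^sub>E N \<in> finite_index_normal G. carrier (G Mod N).
          \<forall>N \<in> finite_index_normal G. \<forall>M \<in> finite_index_normal G. N \<subseteq> M \<longrightarrow> x N \<subseteq> x M}\<rparr>"

definition profinite_completion_topology ::
    "('a, 'b) monoid_scheme \<Rightarrow> ('a set \<Rightarrow> 'a set) topology" where
  "profinite_completion_topology G =
     subtopology
       (product_topology (\<lambda>N. discrete_topology (carrier (G Mod N))) (finite_index_normal G))
       (carrier (profinite_completion G))"

definition profinite_completion_map :: "('a, 'b) monoid_scheme \<Rightarrow> 'a \<Rightarrow> ('a set \<Rightarrow> 'a set)" where
  "profinite_completion_map G g = (\<lambda>N \<in> finite_index_normal G. N #>\<^bsub>G\<^esub> g)"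

definition hnn_base_closure ::
    "nat \<Rightarrow> (nat word \<Rightarrow> nat word) \<Rightarrow> (nat option word set set \<Rightarrow> nat option word set set) set" where
  "hnn_base_closure n f =
     profinite_completion_topology (hnn_group n f) closure_of
       ((\<lambda>w. profinite_completion_map (hnn_group n f) (hnn_base_map n f w)) ` carrier (free_group {1..n}))"

text \<open>Internal semidirect product \<open>G = N \<rtimes> C\<close> of profinite groups, the complement \<open>C\<close> being
  prescribed only up to topological isomorphism.\<close>

definition profinite_semidirect ::
    "('a, 'b) monoid_scheme \<Rightarrow> 'a topology \<Rightarrow> 'a set \<Rightarrow> ('c, 'd) monoid_scheme \<Rightarrow> 'c topology \<Rightarrow> bool" where
  "profinite_semidirect G T N H S \<longleftrightarrow>
     profinite_group G T \<and> N \<lhd> G \<and> closedin T N \<and>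
     (\<exists>C. subgroup C G \<and> closedin T C \<and> N \<inter> C = {\<one>\<^bsub>G\<^esub>} \<and> N <#>\<^bsub>G\<^esub> C = carrier G \<and>
          topologically_isomorphic (G\<lparr>carrier := C\<rparr>) (subtopology T C) H S)"


section \<open>Free profinite groups\<close>

text \<open>The universal property, for target groups \<open>H\<close> whose elements are taken from the type \<open>'h\<close>.
  A universe at least as large as the continuum is needed for the universal property with respect
  to \<open>'h\<close> to characterise free profinite groups of finite rank; over such a universe the
  property implies the one over any other, as a finite subset of a profinite group generates
  a closed subgroup of at most continuum cardinality.\<close>

definition free_profinite_on ::
    "'h itself \<Rightarrow> ('a, 'b) monoid_scheme \<Rightarrow> 'a topology \<Rightarrow> 'a set \<Rightarrow> bool" where
  "free_profinite_on U G T X \<longleftrightarrow>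
     profinite_group G T \<and> X \<subseteq> carrier G \<and>
     (\<forall>(H :: 'h monoid) S \<phi>. profinite_group H S \<and> \<phi> \<in> X \<rightarrow> carrier H \<longrightarrow>
        (\<exists>!\<psi>. \<psi> \<in> extensional (carrier G) \<and> \<psi> \<in> hom G H \<and> continuous_map T S \<psi> \<and>
             (\<forall>x \<in> X. \<psi> x = \<phi> x)))"

definition free_profinite_of_rank ::
    "'h itself \<Rightarrow> nat \<Rightarrow> ('a, 'b) monoid_scheme \<Rightarrow> 'a topology \<Rightarrow> bool" where
  "free_profinite_of_rank U n G T \<longleftrightarrow> (\<exists>X. finite X \<and> card X = n \<and> free_profinite_on U G T X)"


section \<open>Continuous cohomology and cohomological dimension\<close>

text \<open>Coefficient modules \<open>A\<close> are written multiplicatively.\<close>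

definition discrete_torsion_module ::
    "('a, 'b) monoid_scheme \<Rightarrow> 'a topology \<Rightarrow> 'm monoid \<Rightarrow> ('a \<Rightarrow> 'm \<Rightarrow> 'm) \<Rightarrow> bool" where
  "discrete_torsion_module G T A act \<longleftrightarrow>
     comm_group A \<and>
     (\<forall>g \<in> carrier G. act g \<in> hom A A) \<and>
     (\<forall>a \<in> carrier A. act \<one>\<^bsub>G\<^esub> a = a) \<and>
     (\<forall>g \<in> carrier G. \<forall>h \<in> carrier G. \<forall>a \<in> carrier A. act (g \<otimes>\<^bsub>G\<^esub> h) a = act g (act h a)) \<and>
     continuous_map (prod_topology T (discrete_topology (carrier A))) (discrete_topology (carrier A))
       (\<lambda>(g, a). act g a) \<and>
     (\<forall>a \<in> carrier A. \<exists>m::nat. m > 0 \<and> a [^]\<^bsub>A\<^esub> m = \<one>\<^bsub>A\<^esub>)"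

text \<open>Inhomogeneous continuous cochains; a tuple in \<open>G\<^sup>q\<close> is a function in \<open>\<Pi>\<^sub>E i \<in> {..<q}. G\<close>.\<close>

definition cochains ::
    "('a, 'b) monoid_scheme \<Rightarrow> 'a topology \<Rightarrow> 'm monoid \<Rightarrow> nat \<Rightarrow> ((nat \<Rightarrow> 'a) \<Rightarrow> 'm) monoid" where
  "cochains G T A q =
     \<lparr>carrier = {\<phi> \<in> extensional (\<Pi>\<^sub>E i \<in> {..<q}. carrier G).
         continuous_map (product_topology (\<lambda>_. T) {..<q}) (discrete_topology (carrier A)) \<phi>},
      monoid.mult = (\<lambda>\<phi> \<psi>. \<lambda>g \<in> (\<Pi>\<^sub>E i \<in> {..<q}. carrier G). \<phi> g \<otimes>\<^bsub>A\<^esub> \<psi> g),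
      one = (\<lambda>g \<in> (\<Pi>\<^sub>E i \<in> {..<q}. carrier G). \<one>\<^bsub>A\<^esub>)\<rparr>"

text \<open>Written additively and with tuples indexed from 0, this is
  \<open>(\<delta>\<phi>)(g\<^sub>0,\<dots>,g\<^sub>q) = g\<^sub>0 \<phi>(g\<^sub>1,\<dots>,g\<^sub>q) + (\<Sum>i<q. (-1)\<^sup>i\<^sup>+\<^sup>1 \<phi>(\<dots>,g\<^sub>i g\<^sub>i\<^sub>+\<^sub>1,\<dots>)) + (-1)\<^sup>q\<^sup>+\<^sup>1 \<phi>(g\<^sub>0,\<dots>,g\<^sub>q\<^sub>-\<^sub>1)\<close>.\<close>

definition cobdry ::
    "('a, 'b) monoid_scheme \<Rightarrow> 'm monoid \<Rightarrow> ('a \<Rightarrow> 'm \<Rightarrow> 'm) \<Rightarrow> nat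
       \<Rightarrow> ((nat \<Rightarrow> 'a) \<Rightarrow> 'm) \<Rightarrow> (nat \<Rightarrow> 'a) \<Rightarrow> 'm" where
  "cobdry G A act q \<phi> =
     (\<lambda>g \<in> (\<Pi>\<^sub>E i \<in> {..<Suc q}. carrier G).
        act (g 0) (\<phi> (\<lambda>j \<in> {..<q}. g (Suc j)))
        \<otimes>\<^bsub>A\<^esub> (\<Otimes>\<^bsub>A\<^esub> i \<in> {..<q}.
              \<phi> (\<lambda>j \<in> {..<q}. if j < i then g j else if j = i then g j \<otimes>\<^bsub>G\<^esub> g (Suc j) else g (Suc j))
                [^]\<^bsub>A\<^esub> ((- 1) ^ Suc i :: int))
        \<otimes>\<^bsub>A\<^esub> \<phi> (\<lambda>j \<in> {..<q}. g j) [^]\<^bsub>A\<^esub> ((- 1) ^ Suc q :: int))"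

definition cocycles ::
    "('a, 'b) monoid_scheme \<Rightarrow> 'a topology \<Rightarrow> 'm monoid \<Rightarrow> ('a \<Rightarrow> 'm \<Rightarrow> 'm) \<Rightarrow> nat
       \<Rightarrow> ((nat \<Rightarrow> 'a) \<Rightarrow> 'm) set" where
  "cocycles G T A act q = kernel (cochains G T A q) (cochains G T A (Suc q)) (cobdry G A act q)"

definition coboundaries ::
    "('a, 'b) monoid_scheme \<Rightarrow> 'a topology \<Rightarrow> 'm monoid \<Rightarrow> ('a \<Rightarrow> 'm \<Rightarrow> 'm) \<Rightarrow> nat
       \<Rightarrow> ((nat \<Rightarrow> 'a) \<Rightarrow> 'm) set" where
  "coboundaries G T A act q =
     (case q of 0 \<Rightarrow> {\<one>\<^bsub>cochains G T A 0\<^esub>}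
      | Suc r \<Rightarrow> cobdry G A act r ` carrier (cochains G T A r))"

definition cohomology_group ::
    "('a, 'b) monoid_scheme \<Rightarrow> 'a topology \<Rightarrow> 'm monoid \<Rightarrow> ('a \<Rightarrow> 'm \<Rightarrow> 'm) \<Rightarrow> nat
       \<Rightarrow> ((nat \<Rightarrow> 'a) \<Rightarrow> 'm) set monoid" where
  "cohomology_group G T A act q =
     (cochains G T A q)\<lparr>carrier := cocycles G T A act q\<rparr> Mod coboundaries G T A act q"

definition primary_component :: "nat \<Rightarrow> ('a, 'b) monoid_scheme \<Rightarrow> 'a set" where
  "primary_component p G = {x \<in> carrier G. \<exists>k::nat. x [^]\<^bsub>G\<^esub> (p ^ k) = \<one>\<^bsub>G\<^esub>}"

text \<open>\<open>cd\<^sub>p\<close> and \<open>cd\<close> with respect to coefficient modules whose elements are taken from the type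
  \<open>'m\<close>; the infimum of the empty set is \<open>\<infinity>\<close>.  A statement for all coefficient modules
  is obtained by leaving \<open>'m\<close> arbitrary.\<close>

definition cohomological_p_dimension ::
    "'m itself \<Rightarrow> nat \<Rightarrow> ('a, 'b) monoid_scheme \<Rightarrow> 'a topology \<Rightarrow> enat" where
  "cohomological_p_dimension U p G T =
     Inf {enat d |d. \<forall>(A :: 'm monoid) act. discrete_torsion_module G T A act \<longrightarrow>
       (\<forall>q > d. primary_component p (cohomology_group G T A act q)
                  = {\<one>\<^bsub>cohomology_group G T A act q\<^esub>})}"

definition cohomological_dimension ::
    "'m itself \<Rightarrow> ('a, 'b) monoid_scheme \<Rightarrow> 'a topology \<Rightarrow> enat" where
  "cohomological_dimension U G T = (SUP p \<in> {p. prime p}. cohomological_p_dimension U p G T)"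

definition projective_profinite ::
    "'m itself \<Rightarrow> ('a, 'b) monoid_scheme \<Rightarrow> 'a topology \<Rightarrow> bool" where
  "projective_profinite U G T \<longleftrightarrow> profinite_group G T \<and> cohomological_dimension U G T \<le> 1"

end

theory Submission
  imports Defs "HOL-Algebra.Bij" "HOL-Algebra.Generated_Groups" "HOL-Algebra.Multiplicative_Group"
begin

text \<open>In a finite quotient of \<open>\<Gamma>\<close> conjugation by \<open>t\<close> is an automorphism, so the restriction \<open>\<beta>\<close> of the
  quotient map to \<open>F\<close> is periodic: \<open>\<beta> \<circ> f\<^sup>m = \<beta>\<close> for some \<open>m > 0\<close>.  Conversely every periodic
  homomorphism from \<open>F\<close> to a finite group \<open>W\<close> is induced by an action of \<open>\<Gamma>\<close> on \<open>W \<times> \<int>/m\<close>.  Hence the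
  continuous homomorphisms from \<open>P\<close> to finite groups are the periodic ones on \<open>F\<close>.

  The retraction \<open>\<Gamma> \<rightarrow> \<int>\<close>, \<open>x\<^sub>i \<mapsto> 0\<close>, \<open>t \<mapsto> 1\<close>, and its section extend to the completions, and \<open>P\<close> is the
  kernel of the extended retraction.

  For projectivity, let \<open>W \<rightarrow> Q\<close> be a surjection of finite groups and \<open>\<beta> : F \<rightarrow> Q\<close> periodic.  Any lift
  \<open>g : F \<rightarrow> W\<close> of \<open>\<beta>\<close> yields the lifts \<open>g \<circ> f\<^sup>m\<^sup>j\<close>; there are only finitely many homomorphisms \<open>F \<rightarrow> W\<close>, so
  one of these lifts is periodic.  Thus finite embedding problems for \<open>P\<close> are solvable.  A cocycle
  of degree \<open>q \<ge> 2\<close> factors through a finite quotient \<open>Q\<close> and a finite module; regarded as a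
  \<open>2\<close>-cocycle with values in the \<open>(q - 2)\<close>-cochains on \<open>Q\<close> it defines an extension of \<open>Q\<close>, and a lift of
  \<open>P \<rightarrow> Q\<close> to it is a cochain bounding the cocycle.

  If \<open>f\<close> is an automorphism, every homomorphism from \<open>F\<close> to a finite group is periodic, so \<open>P\<close> is the
  profinite completion of \<open>F\<close>.  If \<open>P\<close> is free of rank \<open>n\<close>, counting shows that every homomorphism
  \<open>\<theta>\<close> from \<open>F\<close> to a finite group extends to \<open>P\<close>, so that \<open>\<theta> \<circ> f\<^sup>m = \<theta>\<close>; then \<open>f\<close> is injective as \<open>F\<close> is
  residually finite, and surjective as the finitely generated subgroup \<open>f(F)\<close> is closed in the
  profinite topology (M. Hall).\<close>

section \<open>Free groups\<close>

text \<open>If f is not injective, F does not embed in \<Gamma>; if f is not onto, t F t^-1 need not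
  lie in F. So normality of P cannot be read off in \<Gamma>. In a finite quotient t has finite
  order and conjugation by t^-1 is a power of conjugation by t, which is why statements about P are
  proved one level N at a time. The action on W \<times> \<int>/m is induced from the subgroup of
  elements whose t-exponent is divisible by m, with t^m acting trivially on W. The coefficient type
  is fixed in the definition of dimension, whereas dimension shifting would move to modules over
  another type. Degree q is therefore treated directly: q - 2 variables are stored in the first
  component of a finite extension of Q. Only a surjection onto Q is needed for lifting, so it does
  no harm that the extension is first a mere semigroup and then has to be cut down to a group. The
  count behind freeness compares |W|^n with itself: restriction to a basis of P is bijective by the
  universal property, restriction to the generators of F is injective by density, hence bijective
  too.\<close>

lemma reduced_word_Cons:
  "reduced_word (a # w) \<longleftrightarrow> reduced_word w \<and> (w = [] \<or> \<not> (fst a = fst (hd w) \<and> snd a \<noteq> snd (hd w)))"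
  by (cases w) (auto simp: reduced_word_def)

lemma reduced_word_Nil [simp]: "reduced_word []"
  by (simp add: reduced_word_def)

lemma reduced_cancel_cons: "reduced_word w \<Longrightarrow> reduced_word (cancel_cons a w)"
  by (cases w) (auto simp: reduced_word_Cons)

text \<open>If the inner letter cancels the head of w, putting that head back must not cancel once
  more; this is where w being reduced enters. Inverses and, through
  \<open>foldr_cancel_cons\<close>, associativity rest on it.\<close>

lemma cancel_cons_cancel: "reduced_word w \<Longrightarrow> cancel_cons (x, s) (cancel_cons (x, \<not> s) w) = w"
proof (cases w)
  case (Cons b v)
  assume "reduced_word w"
  then show ?thesis
    using Cons by (cases v; cases b) (auto simp: reduced_word_Cons)
qed simp

lemma reduced_foldr_cancel: "reduced_word w \<Longrightarrow> reduced_word (foldr cancel_cons u w)"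
  by (induction u) (auto intro: reduced_cancel_cons)

lemma foldr_cancel_reduced: "reduced_word u \<Longrightarrow> foldr cancel_cons u [] = u"
proof (induction u)
  case (Cons a u)
  then show ?case by (cases u) (auto simp: reduced_word_Cons)
qed simp

text \<open>Words act on reduced words by adding letters, and two cancelling letters act as mutually
  inverse maps, so the action respects a cancellation inside the acting word. Associativity then
  follows by induction.\<close>

lemma foldr_cancel_cons:
  assumes "reduced_word v" "reduced_word w"
  shows "foldr cancel_cons (cancel_cons a v) w = cancel_cons a (foldr cancel_cons v w)"
proof (cases v)
  case (Cons b u)
  have "cancel_cons (fst a, snd a) (cancel_cons (fst a, \<not> snd a) (foldr cancel_cons u w)) = foldr cancel_cons u w"
    by (rule cancel_cons_cancel) (rule reduced_foldr_cancel[OF assms(2)])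
  then show ?thesis using Cons
    by (cases a; cases b) auto
qed simp

lemma foldr_cancel_assoc:
  "\<lbrakk>reduced_word v; reduced_word w\<rbrakk> \<Longrightarrow>
    foldr cancel_cons (foldr cancel_cons u v) w = foldr cancel_cons u (foldr cancel_cons v w)"
  by (induction u) (auto simp: foldr_cancel_cons reduced_foldr_cancel)

lemma letters_cancel_cons: "fst ` set (cancel_cons a w) \<subseteq> insert (fst a) (fst ` set w)"
  by (cases w) auto

lemma letters_foldr_cancel: "fst ` set (foldr cancel_cons u w) \<subseteq> fst ` set u \<union> fst ` set w"
proof (induction u)
  case (Cons a u)
  have "fst ` set (foldr cancel_cons (a # u) w) \<subseteq> insert (fst a) (fst ` set (foldr cancel_cons u w))"
    using letters_cancel_cons[of a "foldr cancel_cons u w"] by (simp only: foldr_Cons comp_apply)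
  also have "\<dots> \<subseteq> insert (fst a) (fst ` set u \<union> fst ` set w)"
    using Cons.IH by (rule insert_mono)
  finally show ?case by (simp only: list.set image_insert Un_insert_left)
qed simp

definition inverse_word :: "'x word \<Rightarrow> 'x word" where
  "inverse_word u = rev (map (\<lambda>(x, s). (x, \<not> s)) u)"

lemma foldr_inverse_word:
  "reduced_word z \<Longrightarrow> foldr cancel_cons (inverse_word u) (foldr cancel_cons u z) = z"
proof (induction u arbitrary: z)
  case (Cons a u)
  obtain x s where a: "a = (x, s)" by (cases a)
  have "cancel_cons (x, \<not> s) (cancel_cons (x, s) (foldr cancel_cons u z)) = foldr cancel_cons u z"
    using cancel_cons_cancel[of "foldr cancel_cons u z" x "\<not> s"] reduced_foldr_cancel[OF Cons.prems]
    by simp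
  then show ?case using Cons by (simp add: inverse_word_def a)
qed (simp add: inverse_word_def)

lemma carrier_free_group: "w \<in> carrier (free_group X) \<longleftrightarrow> reduced_word w \<and> fst ` set w \<subseteq> X"
  by (simp add: free_group_def)

lemma mult_free_group [simp]: "u \<otimes>\<^bsub>free_group X\<^esub> v = foldr cancel_cons u v"
  by (simp add: free_group_def)

lemma one_free_group [simp]: "\<one>\<^bsub>free_group X\<^esub> = []"
  by (simp add: free_group_def)

lemma group_free_group: "group (free_group X)"
proof (rule groupI)
  fix u v assume "u \<in> carrier (free_group X)" "v \<in> carrier (free_group X)"
  then show "u \<otimes>\<^bsub>free_group X\<^esub> v \<in> carrier (free_group X)"
    using letters_foldr_cancel[of u v] unfolding carrier_free_group mult_free_group
    by (blast intro: reduced_foldr_cancel)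
next
  fix u assume u: "u \<in> carrier (free_group X)"
  let ?v = "foldr cancel_cons (inverse_word u) []"
  have "fst ` set (inverse_word u) = fst ` set u"
    by (force simp: inverse_word_def)
  then have "fst ` set ?v \<subseteq> X"
    using u letters_foldr_cancel[of "inverse_word u" "[]"] unfolding carrier_free_group by force
  then have "?v \<in> carrier (free_group X)"
    by (simp add: carrier_free_group reduced_foldr_cancel)
  moreover have "foldr cancel_cons ?v u = []"
    using u foldr_inverse_word[of "[]" u]
    by (simp add: carrier_free_group foldr_cancel_assoc foldr_cancel_reduced)
  ultimately show "\<exists>v \<in> carrier (free_group X). v \<otimes>\<^bsub>free_group X\<^esub> u = \<one>\<^bsub>free_group X\<^esub>"
    by auto
qed (auto simp: carrier_free_group foldr_cancel_assoc)

lemma free_gen_closed: "x \<in> X \<Longrightarrow> free_gen x \<in> carrier (free_group X)"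
  by (simp add: carrier_free_group free_gen_def reduced_word_def)

lemma inv_free_gen: "x \<in> X \<Longrightarrow> inv\<^bsub>free_group X\<^esub> free_gen x = [(x, False)]"
proof -
  assume "x \<in> X"
  interpret group "free_group X" by (rule group_free_group)
  have "[(x, False)] \<in> carrier (free_group X)"
    using \<open>x \<in> X\<close> by (simp add: carrier_free_group reduced_word_def)
  then show ?thesis
    by (intro inv_equality) (simp_all add: free_gen_closed \<open>x \<in> X\<close>, simp add: free_gen_def)
qed

section \<open>Evaluation of words and the universal property of free groups\<close>

definition word_eval :: "('b, 'c) monoid_scheme \<Rightarrow> ('x \<Rightarrow> 'b) \<Rightarrow> 'x word \<Rightarrow> 'b" where
  "word_eval H \<phi> w = foldr (\<lambda>(x, s) y. (if s then \<phi> x else inv\<^bsub>H\<^esub> \<phi> x) \<otimes>\<^bsub>H\<^esub> y) w \<one>\<^bsub>H\<^esub>"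

context
  fixes H (structure) and X :: "'x set" and \<phi> :: "'x \<Rightarrow> 'b"
  assumes H: "group H" and \<phi>: "\<phi> \<in> X \<rightarrow> carrier H"
begin

interpretation group H by (rule H)

lemma word_eval_closed: "fst ` set w \<subseteq> X \<Longrightarrow> word_eval H \<phi> w \<in> carrier H"
  using \<phi> by (induction w) (auto simp: word_eval_def Pi_iff)

lemma word_eval_cancel_cons:
  assumes "fst a \<in> X" "fst ` set w \<subseteq> X"
  shows "word_eval H \<phi> (cancel_cons a w) = (if snd a then \<phi> (fst a) else inv \<phi> (fst a)) \<otimes> word_eval H \<phi> w"
proof (cases w)
  case Nil
  then show ?thesis using assms by (simp add: word_eval_def case_prod_beta)
next
  case (Cons b v)
  have v: "word_eval H \<phi> v \<in> carrier H" and "\<phi> (fst a) \<in> carrier H"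
    using assms Cons \<phi> by (auto intro!: word_eval_closed)
  then have c: "\<phi> (fst a) \<otimes> (inv \<phi> (fst a) \<otimes> word_eval H \<phi> v) = word_eval H \<phi> v"
     "inv \<phi> (fst a) \<otimes> (\<phi> (fst a) \<otimes> word_eval H \<phi> v) = word_eval H \<phi> v"
    by (simp_all add: m_assoc[symmetric])
  show ?thesis
  proof (cases "fst a = fst b \<and> snd a \<noteq> snd b")
    case True
    have "word_eval H \<phi> w = (if snd b then \<phi> (fst b) else inv \<phi> (fst b)) \<otimes> word_eval H \<phi> v"
      by (simp add: Cons word_eval_def case_prod_beta)
    then show ?thesis using True c Cons by (cases "snd a") auto
  next
    case False
    then show ?thesis by (simp only: Cons cancel_cons.simps if_False) (simp add: word_eval_def case_prod_beta)
  qed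
qed

lemma word_eval_hom: "word_eval H \<phi> \<in> hom (free_group X) H"
proof (rule homI)
  fix w assume "w \<in> carrier (free_group X)"
  then show "word_eval H \<phi> w \<in> carrier H"
    by (simp add: carrier_free_group word_eval_closed)
next
  fix u v assume "u \<in> carrier (free_group X)" and v: "v \<in> carrier (free_group X)"
  then have "fst ` set u \<subseteq> X" by (simp add: carrier_free_group)
  then show "word_eval H \<phi> (u \<otimes>\<^bsub>free_group X\<^esub> v) = word_eval H \<phi> u \<otimes> word_eval H \<phi> v"
  proof (induction u)
    case Nil
    then show ?case using v by (simp add: word_eval_def[of _ _ "[]"] word_eval_closed carrier_free_group)
  next
    case (Cons a u)
    then have u: "fst ` set u \<subseteq> X" "fst a \<in> X" by auto
    have "fst ` set (foldr cancel_cons u v) \<subseteq> X"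
      using letters_foldr_cancel[of u v] u v unfolding carrier_free_group by blast
    then have "word_eval H \<phi> (foldr cancel_cons (a # u) v)
        = (if snd a then \<phi> (fst a) else inv \<phi> (fst a)) \<otimes> (word_eval H \<phi> u \<otimes> word_eval H \<phi> v)"
      using Cons u by (simp add: word_eval_cancel_cons)
    moreover have "word_eval H \<phi> (a # u) = (if snd a then \<phi> (fst a) else inv \<phi> (fst a)) \<otimes> word_eval H \<phi> u"
      by (simp add: word_eval_def case_prod_beta)
    moreover have "\<phi> (fst a) \<in> carrier H" "word_eval H \<phi> u \<in> carrier H" "word_eval H \<phi> v \<in> carrier H"
      using u v \<phi> by (auto intro!: word_eval_closed simp: carrier_free_group)
    ultimately show ?case by (simp add: m_assoc)
  qed
qed

lemma word_eval_free_gen: "x \<in> X \<Longrightarrow> word_eval H \<phi> (free_gen x) = \<phi> x"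
  by (simp add: word_eval_def free_gen_def funcset_mem[OF \<phi>])

end

lemma free_group_Cons:
  assumes "a # w \<in> carrier (free_group X)"
  shows "[a] \<in> carrier (free_group X)" "w \<in> carrier (free_group X)"
    "a # w = [a] \<otimes>\<^bsub>free_group X\<^esub> w"
    "[a] = (if snd a then free_gen (fst a) else inv\<^bsub>free_group X\<^esub> free_gen (fst a))"
proof -
  have "fst a \<in> X" using assms by (auto simp: carrier_free_group)
  then show "[a] = (if snd a then free_gen (fst a) else inv\<^bsub>free_group X\<^esub> free_gen (fst a))"
    by (cases a) (auto simp: inv_free_gen, simp add: free_gen_def)
  show "[a] \<in> carrier (free_group X)" "w \<in> carrier (free_group X)"
    using assms by (auto simp: carrier_free_group reduced_word_Cons)
  show "a # w = [a] \<otimes>\<^bsub>free_group X\<^esub> w"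
    using assms foldr_cancel_reduced[of "a # w"] by (cases w) (auto simp: carrier_free_group reduced_word_Cons)
qed

lemma free_group_subgroup_eq:
  assumes "subgroup K (free_group X)" "free_gen ` X \<subseteq> K" "w \<in> carrier (free_group X)"
  shows "w \<in> K"
  using assms(3)
proof (induction w)
  case Nil
  then show ?case using subgroup.one_closed[OF assms(1)] by simp
next
  case (Cons a w)
  note fc = free_group_Cons[OF Cons.prems]
  have "fst a \<in> X" using Cons.prems by (auto simp: carrier_free_group)
  then have "[a] \<in> K"
    unfolding fc(4) using assms(2) subgroup.m_inv_closed[OF assms(1)] by auto
  then show ?case
    by (subst fc(3)) (intro subgroup.m_closed[OF assms(1)] Cons.IH fc(2))
qed

text \<open>The equaliser of two homomorphisms is a subgroup, and a subgroup containing the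
  generators is everything.\<close>

lemma free_group_hom_eq:
  assumes "group H" "h \<in> hom (free_group X) H" "k \<in> hom (free_group X) H"
    "\<And>x. x \<in> X \<Longrightarrow> h (free_gen x) = k (free_gen x)" "w \<in> carrier (free_group X)"
  shows "h w = k w"
proof -
  interpret F: group "free_group X" by (rule group_free_group)
  interpret H: group H by fact
  interpret h: group_hom "free_group X" H h using assms(2) by unfold_locales
  interpret k: group_hom "free_group X" H k using assms(3) by unfold_locales
  have "subgroup {w \<in> carrier (free_group X). h w = k w} (free_group X)"
    using h.hom_one k.hom_one by (intro F.subgroupI) (auto simp del: mult_free_group one_free_group)
  from free_group_subgroup_eq[OF this _ assms(5)] show ?thesis
    using assms(4) by (auto intro: free_gen_closed)
qed

section \<open>Separating finitely generated subgroups in finite quotients\<close>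

lemma extend_partial_injection:
  assumes "finite S" "D \<subseteq> S" "inj_on p D" "p ` D \<subseteq> S"
  shows "\<exists>q. bij_betw q S S \<and> (\<forall>x \<in> D. q x = p x)"
proof -
  \<comment> \<open>Domain and image of p have the same size, hence so have their complements in S;
    any bijection between these completes p to a permutation.\<close>
  have "card (S - D) = card (S - p ` D)"
    using assms by (simp add: card_Diff_subset finite_subset card_image)
  then obtain r where r: "bij_betw r (S - D) (S - p ` D)"
    using finite_same_card_bij[of "S - D" "S - p ` D"] assms(1) by auto
  let ?q = "\<lambda>x. if x \<in> D then p x else r x"
  have "bij_betw ?q D (p ` D)"
    using assms(3) by (subst bij_betw_cong[of D _ p]) (auto simp: bij_betw_def)
  moreover have "bij_betw ?q (S - D) (S - p ` D)"
    using r by (subst bij_betw_cong[of "S - D" _ r]) auto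
  ultimately have "bij_betw ?q (D \<union> (S - D)) (p ` D \<union> (S - p ` D))"
    by (rule bij_betw_combine) auto
  moreover have "D \<union> (S - D) = S" "p ` D \<union> (S - p ` D) = S"
    using assms by auto
  ultimately show ?thesis by (intro exI[of _ ?q]) auto
qed

lemma finite_Bij: "finite S \<Longrightarrow> finite (carrier (BijGroup S))"
  by (rule finite_subset[OF _ finite_PiE[of S "\<lambda>_. S"]])
     (auto simp: BijGroup_def Bij_def PiE_def dest: bij_betw_imp_funcset)

text \<open>Freeness is tested on groups over a prescribed type, while the finite groups constructed
  here live on other types. An infinite type has room for a copy of each of them.\<close>

lemma finite_group_copy:
  assumes "group W" "finite (carrier W)" "infinite (UNIV :: 'c set)"
  shows "\<exists>(V :: 'c monoid) h. group V \<and> finite (carrier V) \<and> h \<in> iso W V"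
proof -
  interpret W: group W by fact
  obtain T :: "'c set" where "finite T" "card T = card (carrier W)"
    using infinite_arbitrarily_large[OF assms(3)] by metis
  then obtain e where "bij_betw e (carrier W) T"
    using finite_same_card_bij[OF assms(2)] by metis
  then have e: "inj_on e (carrier W)" by (rule bij_betw_imp_inj_on)
  define d where "d = inv_into (carrier W) e"
  have d: "d (e x) = x" if "x \<in> carrier W" for x
    using that e by (simp add: d_def)
  define V :: "'c monoid" where "V = \<lparr>carrier = e ` carrier W,
      monoid.mult = (\<lambda>x y. e (d x \<otimes>\<^bsub>W\<^esub> d y)), one = e \<one>\<^bsub>W\<^esub>\<rparr>"
  have "group V"
    by (rule groupI) (auto simp: V_def d W.m_assoc intro!: bexI[of _ "inv\<^bsub>W\<^esub> _"])
  moreover have "e \<in> iso W V"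
    using e by (auto simp: iso_def hom_def V_def d bij_betw_def)
  moreover have "finite (carrier V)"
    using assms by (simp add: V_def)
  ultimately show ?thesis by blast
qed

text \<open>The left cosets \<open>sU\<close>, for \<open>s\<close> a final segment of one of the words in \<open>B\<close> or of \<open>g\<close>, form a
  finite set on which every generator acts as a partial injection; any extension to permutations
  gives an action in which \<open>U = generate F B\<close> fixes the coset \<open>U\<close> and \<open>g\<close> does not (M. Hall).\<close>

theorem free_group_separate:
  fixes X :: "'x set" and B
  defines "F \<equiv> free_group X"
  assumes B: "finite B" "B \<subseteq> carrier F" and g: "g \<in> carrier F" "g \<notin> generate F B"
    and inf: "infinite (UNIV :: 'c set)"
  shows "\<exists>(W :: 'c monoid) \<theta>. group W \<and> finite (carrier W) \<and> \<theta> \<in> hom F W \<and> \<theta> g \<notin> \<theta> ` generate F B"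
proof -
  interpret F: group F unfolding F_def by (rule group_free_group)
  define U where "U = generate F B"
  have U: "subgroup U F" unfolding U_def using B(2) by (rule F.generate_is_subgroup)
  define C where "C = (\<lambda>w. w <#\<^bsub>F\<^esub> U)"
  have C_iff: "C u = C v \<longleftrightarrow> inv\<^bsub>F\<^esub> v \<otimes>\<^bsub>F\<^esub> u \<in> U" if "u \<in> carrier F" "v \<in> carrier F" for u v
  proof
    assume "C u = C v"
    moreover have "u \<in> C u"
      using that subgroup.one_closed[OF U] F.r_one[OF that(1)] by (force simp: C_def l_coset_def simp del: mult_free_group)
    ultimately obtain z where "z \<in> U" "u = v \<otimes>\<^bsub>F\<^esub> z" by (auto simp: C_def l_coset_def)
    then show "inv\<^bsub>F\<^esub> v \<otimes>\<^bsub>F\<^esub> u \<in> U"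
      using that subgroup.mem_carrier[OF U]
      by (simp add: F.m_assoc[symmetric] del: mult_free_group)
  next
    assume *: "inv\<^bsub>F\<^esub> v \<otimes>\<^bsub>F\<^esub> u \<in> U"
    have "u = v \<otimes>\<^bsub>F\<^esub> (inv\<^bsub>F\<^esub> v \<otimes>\<^bsub>F\<^esub> u)"
      using that by (simp add: F.m_assoc[symmetric])
    then have "u \<in> v <#\<^bsub>F\<^esub> U" using * by (auto simp: l_coset_def)
    then show "C u = C v"
      unfolding C_def using F.l_repr_independence[OF _ _ U] that by metis
  qed
  have C_mult: "C (z \<otimes>\<^bsub>F\<^esub> u) = C (z \<otimes>\<^bsub>F\<^esub> v) \<longleftrightarrow> C u = C v"
    if "u \<in> carrier F" "v \<in> carrier F" "z \<in> carrier F" for u v z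
  proof -
    have "inv\<^bsub>F\<^esub> z \<otimes>\<^bsub>F\<^esub> (z \<otimes>\<^bsub>F\<^esub> u) = u"
      using that by (simp add: F.m_assoc[symmetric] del: mult_free_group)
    then have "inv\<^bsub>F\<^esub> (z \<otimes>\<^bsub>F\<^esub> v) \<otimes>\<^bsub>F\<^esub> (z \<otimes>\<^bsub>F\<^esub> u) = inv\<^bsub>F\<^esub> v \<otimes>\<^bsub>F\<^esub> u"
      using that by (simp add: F.inv_mult_group F.m_assoc del: mult_free_group)
    then show ?thesis using that by (simp add: C_iff del: mult_free_group)
  qed
  \<comment> \<open>Final segments are taken because a word acts with its last letter first:
    prepending a letter to a segment is the left multiplication that a generator performs on
    cosets.\<close>
  define L where "L = {v. \<exists>u. u @ v \<in> insert g B}"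
  define S where "S = C ` L"
  have Lc: "v \<in> L" if av: "a # v \<in> L" for a v
  proof -
    obtain u where "u @ a # v \<in> insert g B" using av unfolding L_def by blast
    then have "(u @ [a]) @ v \<in> insert g B" by simp
    then show ?thesis unfolding L_def by blast
  qed
  have LC: "v \<in> carrier F" if v: "v \<in> L" for v
  proof -
    obtain u where "u @ v \<in> carrier F"
      using v B(2) g(1) unfolding L_def by blast
    then show ?thesis
      by (auto simp: F_def carrier_free_group reduced_word_def successively_append_iff)
  qed
  have "L \<subseteq> (\<Union>w \<in> insert g B. (\<lambda>k. drop k w) ` {..length w})"
  proof
    fix v assume "v \<in> L"
    then obtain u where "u @ v \<in> insert g B" unfolding L_def by blast
    then show "v \<in> (\<Union>w \<in> insert g B. (\<lambda>k. drop k w) ` {..length w})"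
      by (intro UN_I[of "u @ v"] image_eqI[of _ _ "length u"]) auto
  qed
  then have "finite L"
    by (rule finite_subset) (use B(1) in auto)
  then have "finite S" unfolding S_def by (rule finite_imageI)
  have gF: "free_gen x \<in> carrier F" if "x \<in> X" for x
    using that by (simp add: F_def free_gen_closed)
  \<comment> \<open>The domain of the partial injection belonging to x: cosets in S whose translate
    by x is again in S.\<close>
  define D where "D = (\<lambda>x. {C u | u. u \<in> carrier F \<and> C u \<in> S \<and> C (free_gen x \<otimes>\<^bsub>F\<^esub> u) \<in> S})"
  define p where "p = (\<lambda>x c. C (free_gen x \<otimes>\<^bsub>F\<^esub> (SOME u. u \<in> carrier F \<and> c = C u)))"
  have p: "p x (C u) = C (free_gen x \<otimes>\<^bsub>F\<^esub> u)" if "u \<in> carrier F" "x \<in> X" for x u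
  proof -
    have "\<exists>v. v \<in> carrier F \<and> C u = C v" using that by blast
    from someI_ex[OF this] show ?thesis
      unfolding p_def using that by (subst C_mult) (auto simp: gF)
  qed
  have "\<exists>q. bij_betw q S S \<and> (\<forall>c \<in> D x. q c = p x c)" if x: "x \<in> X" for x
  proof (rule extend_partial_injection[OF \<open>finite S\<close>])
    show "D x \<subseteq> S" "p x ` D x \<subseteq> S"
      using x by (auto simp: D_def p)
    show "inj_on (p x) (D x)"
      unfolding inj_on_def D_def
    proof (clarify)
      fix u v
      assume "u \<in> carrier F" "v \<in> carrier F" "p x (C u) = p x (C v)"
      then show "C u = C v"
        using x by (simp add: p C_mult gF[OF x] del: mult_free_group)
    qed
  qed
  then obtain q where q: "\<And>x. x \<in> X \<Longrightarrow> bij_betw (q x) S S"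
      "\<And>x c. x \<in> X \<Longrightarrow> c \<in> D x \<Longrightarrow> q x c = p x c"
    by metis
  define W where "W = BijGroup S"
  interpret W: group W unfolding W_def by (rule group_BijGroup)
  define \<rho> where "\<rho> = (\<lambda>x. restrict (q x) S)"
  have \<rho>: "\<rho> \<in> X \<rightarrow> carrier W"
    using q(1) by (auto simp: \<rho>_def W_def BijGroup_def Bij_def bij_betw_def inj_on_def)
  define \<theta> where "\<theta> = word_eval W \<rho>"
  have \<theta>: "\<theta> \<in> hom F W"
    unfolding \<theta>_def F_def by (rule word_eval_hom[OF W.is_group \<rho>])
  interpret \<theta>: group_hom F W \<theta> using \<theta> by unfold_locales
  have app: "(\<alpha> \<otimes>\<^bsub>W\<^esub> \<beta>) c = \<alpha> (\<beta> c)" if "\<alpha> \<in> carrier W" "\<beta> \<in> carrier W" "c \<in> S" for \<alpha> \<beta> c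
    using that by (simp add: W_def BijGroup_def compose_def)
  have oneW: "\<one>\<^bsub>W\<^esub> c = c" if "c \<in> S" for c
    using that by (simp add: W_def BijGroup_def)
  have cl: "\<alpha> c \<in> S" if "\<alpha> \<in> carrier W" "c \<in> S" for \<alpha> c
    using that by (auto simp: W_def BijGroup_def Bij_def bij_betw_def)
  have gen: "\<theta> (free_gen x) (C u) = C (free_gen x \<otimes>\<^bsub>F\<^esub> u)"
    if "x \<in> X" "u \<in> carrier F" "C u \<in> S" "C (free_gen x \<otimes>\<^bsub>F\<^esub> u) \<in> S" for x u
  proof -
    have "C u \<in> D x" using that by (auto simp: D_def)
    then show ?thesis
      using that q(2)[OF that(1), of "C u"] word_eval_free_gen[OF W.is_group \<rho> that(1)]
      by (simp add: \<theta>_def \<rho>_def p)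
  qed
  have invW: "(inv\<^bsub>W\<^esub> \<alpha>) c = d" if "\<alpha> \<in> carrier W" "d \<in> S" "\<alpha> d = c" for \<alpha> c d
    using that app[of "inv\<^bsub>W\<^esub> \<alpha>" \<alpha> d] oneW by simp
  have move: "\<theta> w (C []) = C w" if "w \<in> L" for w
    using that
  proof (induction w)
    case Nil
    have "C [] \<in> S" using Nil by (auto simp: S_def)
    then show ?case using oneW \<theta>.hom_one by (simp add: F_def)
  next
    case (Cons a w)
    have aw: "a # w \<in> carrier F" "w \<in> carrier F" "w \<in> L" "C w \<in> S" "C (a # w) \<in> S"
      using Cons.prems Lc LC by (auto simp: S_def)
    note fc = free_group_Cons[OF aw(1)[unfolded F_def], folded F_def]
    have x: "fst a \<in> X" using aw(1) by (auto simp: F_def carrier_free_group)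
    have fx: "free_gen (fst a) \<in> carrier F" using x by (simp add: F_def free_gen_closed)
    have nil: "C [] \<in> S"
      by (auto simp: S_def L_def)
    have "\<theta> [a] (C w) = C (a # w)"
    proof (cases "snd a")
      case True
      then show ?thesis using gen[OF x aw(2,4)] fc(3,4) aw(5) by simp
    next
      case False
      \<comment> \<open>For an inverse letter the generator itself carries the coset of
        \<open>a # w\<close> to that of w inside S; inverting its permutation gives the required
        step.\<close>
      have "free_gen (fst a) \<otimes>\<^bsub>F\<^esub> (a # w) = w"
        unfolding fc(3) using False fc(4) fx aw(2) by (simp add: F.m_assoc[symmetric])
      then have "\<theta> (free_gen (fst a)) (C (a # w)) = C w"
        using gen[OF x aw(1) aw(5)] aw(4) by simp
      then show ?thesis
        using False fc(4) fx invW[OF \<theta>.hom_closed[OF fx] aw(5)] by simp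
    qed
    moreover have "\<theta> (a # w) = \<theta> [a] \<otimes>\<^bsub>W\<^esub> \<theta> w"
      by (subst fc(3)) (rule \<theta>.hom_mult[OF fc(1,2)])
    ultimately show ?case using Cons.IH[OF aw(3)] fc(1,2) nil by (simp add: app)
  qed
  have BL: "w \<in> L" if "w \<in> insert g B" for w
  proof -
    have "[] @ w \<in> insert g B" using that by simp
    then show ?thesis unfolding L_def by blast
  qed
  have nil: "[] \<in> L"
    by (auto simp: L_def)
  then have nilS: "C [] \<in> S" by (simp add: S_def)
  have C1: "C w = C [] \<longleftrightarrow> w \<in> U" if "w \<in> carrier F" for w
    using C_iff[of w "[]"] that F.inv_one F.one_closed F.l_one[OF that] by (simp add: F_def)
  have fixU: "\<theta> w (C []) = C []" if "w \<in> U" for w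
    using that unfolding U_def
  proof (induction rule: generate.induct)
    case one
    then show ?case using oneW nilS \<theta>.hom_one by simp
  next
    case (incl h)
    then show ?case using move[OF BL] C1[of h] B(2) generate.incl[of h B F] by (auto simp: U_def)
  next
    case (inv h)
    then have "\<theta> h (C []) = C []"
      using move[OF BL] C1[of h] B(2) generate.incl[of h B F] by (auto simp: U_def)
    moreover have "h \<in> carrier F" using inv B(2) by auto
    ultimately show ?case using invW[OF \<theta>.hom_closed nilS, of h] by simp
  next
    case (eng h1 h2)
    then have "h1 \<in> carrier F" "h2 \<in> carrier F"
      using subgroup.mem_carrier[OF U] by (auto simp: U_def)
    then show ?case using eng nilS by (simp add: app)
  qed
  have "\<theta> g \<notin> \<theta> ` U"
  proof
    assume "\<theta> g \<in> \<theta> ` U"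
    then have "\<theta> g (C []) = C []" using fixU by auto
    then show False using move[OF BL, of g] C1[OF g(1)] g(2) by (simp add: U_def)
  qed
  moreover obtain V :: "'c monoid" and h where V: "group V" "finite (carrier V)" "h \<in> iso W V"
    using finite_group_copy[OF W.is_group _ inf] finite_Bij[OF \<open>finite S\<close>] unfolding W_def by blast
  moreover have "h \<circ> \<theta> \<in> hom F V"
    using V(3) \<theta> hom_compose[of \<theta> F W h V] by (auto simp: iso_def)
  moreover have "h (\<theta> g) \<notin> (\<lambda>u. h (\<theta> u)) ` U"
  proof
    assume "h (\<theta> g) \<in> (\<lambda>u. h (\<theta> u)) ` U"
    then obtain u where "u \<in> U" "h (\<theta> g) = h (\<theta> u)" by auto
    moreover have "inj_on h (carrier W)" using V(3) by (auto simp: iso_def bij_betw_def)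
    ultimately have "\<theta> g = \<theta> u"
      using g(1) subgroup.mem_carrier[OF U] \<theta>.hom_closed by (auto dest: inj_onD)
    then show False using \<open>\<theta> g \<notin> \<theta> ` U\<close> \<open>u \<in> U\<close> by auto
  qed
  ultimately show ?thesis unfolding U_def by (intro exI[of _ V] exI[of _ "h \<circ> \<theta>"]) (auto simp: image_comp)
qed

section \<open>Spaces with a base of levels\<close>

lemma continuous_map_into_discreteI:
  assumes "\<And>x. x \<in> topspace X \<Longrightarrow> \<phi> x \<in> S"
    and "\<And>x. x \<in> topspace X \<Longrightarrow> \<exists>U. openin X U \<and> x \<in> U \<and> (\<forall>y \<in> U. \<phi> y = \<phi> x)"
  shows "continuous_map X (discrete_topology S) \<phi>"
proof -
  have "openin X {x \<in> topspace X. \<phi> x \<in> U}" for U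
  proof (subst openin_subopen, intro ballI)
    fix x assume x: "x \<in> {x \<in> topspace X. \<phi> x \<in> U}"
    then obtain V where "openin X V" "x \<in> V" "\<forall>y \<in> V. \<phi> y = \<phi> x"
      using assms(2) by blast
    then show "\<exists>V. openin X V \<and> x \<in> V \<and> V \<subseteq> {x \<in> topspace X. \<phi> x \<in> U}"
      using x openin_subset by (intro exI[of _ V]) fastforce
  qed
  then show ?thesis
    using assms(1) by (auto simp: continuous_map_def)
qed

lemma openin_discrete_fiber:
  assumes "continuous_map X (discrete_topology S) \<phi>" "x \<in> topspace X"
  shows "openin X {y \<in> topspace X. \<phi> y = \<phi> x}"
proof -
  have "\<phi> x \<in> S" using assms by (auto simp: continuous_map_def)
  then have "openin X {y \<in> topspace X. \<phi> y \<in> {\<phi> x}}"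
    using assms(1) by (auto simp only: continuous_map_def openin_discrete_topology)
  then show ?thesis by simp
qed

text \<open>A space \<open>X\<close> whose topology has as a base the classes of the relations
  \<open>lev N x = lev N y\<close>, which become finer as \<open>N\<close> gets smaller.\<close>

locale leveled_space =
  fixes X :: "'x topology" and I :: "'n set set" and lev :: "'n set \<Rightarrow> 'x \<Rightarrow> 'l"
  assumes nonempty: "I \<noteq> {}"
    and Int_closed: "\<lbrakk>N \<in> I; M \<in> I\<rbrakk> \<Longrightarrow> N \<inter> M \<in> I"
    and mono: "\<lbrakk>N \<in> I; M \<in> I; N \<subseteq> M; x \<in> topspace X; y \<in> topspace X; lev N x = lev N y\<rbrakk> \<Longrightarrow> lev M x = lev M y"
    and level_open: "\<lbrakk>N \<in> I; x \<in> topspace X\<rbrakk> \<Longrightarrow> openin X {y \<in> topspace X. lev N y = lev N x}"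
    and level_base: "\<lbrakk>openin X V; x \<in> V\<rbrakk> \<Longrightarrow> \<exists>N \<in> I. \<forall>y \<in> topspace X. lev N y = lev N x \<longrightarrow> y \<in> V"
begin

lemma lower_bound:
  assumes "finite J" "J \<subseteq> I"
  shows "\<exists>N \<in> I. \<forall>M \<in> J. N \<subseteq> M"
  using assms
proof (induction J)
  case empty
  then show ?case using nonempty by auto
next
  case (insert M J)
  then obtain N where "N \<in> I" "\<forall>M \<in> J. N \<subseteq> M" by auto
  then show ?case using Int_closed[of M N] insert.prems by (intro bexI[of _ "M \<inter> N"]) auto
qed

lemma continuous_map_discrete_level:
  assumes "N \<in> I" "\<And>x. x \<in> topspace X \<Longrightarrow> \<phi> x \<in> S"
    and "\<And>x y. \<lbrakk>x \<in> topspace X; y \<in> topspace X; lev N x = lev N y\<rbrakk> \<Longrightarrow> \<phi> x = \<phi> y"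
  shows "continuous_map X (discrete_topology S) \<phi>"
  using level_open[OF assms(1)] assms(2,3)
  by (intro continuous_map_into_discreteI) (blast intro!: exI[of _ "{y \<in> topspace X. lev N y = lev N _}"])+

text \<open>\<phi> is constant on some level class around each point. By compactness finitely many
  of these classes cover the space, and a level below all of theirs works everywhere.\<close>

lemma discrete_factors_through_level:
  assumes "compact_space X" "continuous_map X (discrete_topology S) \<phi>"
  shows "\<exists>N \<in> I. \<forall>x \<in> topspace X. \<forall>y \<in> topspace X. lev N x = lev N y \<longrightarrow> \<phi> x = \<phi> y"
proof -
  have "\<forall>x \<in> topspace X. \<exists>N \<in> I. \<forall>y \<in> topspace X. lev N y = lev N x \<longrightarrow> \<phi> y = \<phi> x"
    using level_base[OF openin_discrete_fiber[OF assms(2)]] by fastforce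
  then obtain N where N: "\<And>x. x \<in> topspace X \<Longrightarrow> N x \<in> I"
      "\<And>x y. \<lbrakk>x \<in> topspace X; y \<in> topspace X; lev (N x) y = lev (N x) x\<rbrakk> \<Longrightarrow> \<phi> y = \<phi> x"
    by metis
  define C where "C = (\<lambda>x. {y \<in> topspace X. lev (N x) y = lev (N x) x})"
  have "\<forall>U \<in> C ` topspace X. openin X U"
    using level_open N(1) by (auto simp: C_def)
  moreover have "topspace X \<subseteq> \<Union>(C ` topspace X)"
    by (auto simp: C_def)
  ultimately have "\<exists>F. finite F \<and> F \<subseteq> C ` topspace X \<and> topspace X \<subseteq> \<Union>F"
    using assms(1)[unfolded compact_space_alt, rule_format, of "C ` topspace X"] by blast
  then obtain D where D: "finite D" "D \<subseteq> topspace X" "topspace X \<subseteq> \<Union>(C ` D)"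
    by (metis finite_subset_image)
  obtain M where M: "M \<in> I" "\<forall>x \<in> D. M \<subseteq> N x"
    using lower_bound[of "N ` D"] D(1,2) N(1) by blast
  have "\<phi> x = \<phi> y" if xy: "x \<in> topspace X" "y \<in> topspace X" "lev M x = lev M y" for x y
  proof -
    obtain z where z: "z \<in> D" "lev (N z) x = lev (N z) z"
      using D(3) xy by (auto simp: C_def)
    then have "lev (N z) y = lev (N z) z"
      using mono[OF M(1) N(1) _ xy] M(2) D(2) by (metis subsetD)
    then show ?thesis using N(2)[of z x] N(2)[of z y] z xy D(2) by (metis subsetD)
  qed
  then show ?thesis using M(1) by blast
qed

lemma leveled_subspace:
  assumes "P \<subseteq> topspace X"
  shows "leveled_space (subtopology X P) I lev"
proof
  have ts: "topspace (subtopology X P) = P" using assms by auto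
  fix N x assume N: "N \<in> I" "x \<in> topspace (subtopology X P)"
  then have "openin X {y \<in> topspace X. lev N y = lev N x}"
    using level_open assms ts by blast
  moreover have "{y \<in> topspace (subtopology X P). lev N y = lev N x} = {y \<in> topspace X. lev N y = lev N x} \<inter> P"
    using assms by auto
  ultimately show "openin (subtopology X P) {y \<in> topspace (subtopology X P). lev N y = lev N x}"
    unfolding openin_subtopology by blast
next
  fix V x assume "openin (subtopology X P) V" "x \<in> V"
  then obtain W where "openin X W" "V = W \<inter> P" by (auto simp: openin_subtopology)
  then show "\<exists>N \<in> I. \<forall>y \<in> topspace (subtopology X P). lev N y = lev N x \<longrightarrow> y \<in> V"
    using level_base[of W x] \<open>x \<in> V\<close> by fastforce
qed (use nonempty Int_closed mono in auto)

text \<open>Cochains are functions on finite powers. A basic open set of a power constrains finitely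
  many factors, whose levels have a common lower bound, so one level applied to every component is
  enough.\<close>

lemma leveled_power:
  "leveled_space (product_topology (\<lambda>_. X) {..<k}) I (\<lambda>N x. \<lambda>i \<in> {..<k::nat}. lev N (x i))"
proof
  fix N M x y
  assume NM: "N \<in> I" "M \<in> I" "N \<subseteq> M" and xy: "x \<in> topspace (product_topology (\<lambda>_. X) {..<k})"
    "y \<in> topspace (product_topology (\<lambda>_. X) {..<k})"
    and eq: "(\<lambda>i\<in>{..<k}. lev N (x i)) = (\<lambda>i\<in>{..<k}. lev N (y i))"
  have "lev M (x i) = lev M (y i)" if i: "i < k" for i
  proof (rule mono[OF NM])
    show "lev N (x i) = lev N (y i)" using fun_cong[OF eq, of i] i by simp
  qed (use xy i in auto)
  then show "(\<lambda>i\<in>{..<k}. lev M (x i)) = (\<lambda>i\<in>{..<k}. lev M (y i))"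
    by (auto simp: restrict_def)
next
  fix N x assume N: "N \<in> I" and x: "x \<in> topspace (product_topology (\<lambda>_. X) {..<k})"
  have "openin (product_topology (\<lambda>_. X) {..<k}) (\<Pi>\<^sub>E i\<in>{..<k}. {y \<in> topspace X. lev N y = lev N (x i)})"
    using N x by (subst openin_PiE) (auto intro: level_open)
  moreover have "(\<Pi>\<^sub>E i\<in>{..<k}. {y \<in> topspace X. lev N y = lev N (x i)})
      = {y \<in> topspace (product_topology (\<lambda>_. X) {..<k}). (\<lambda>i\<in>{..<k}. lev N (y i)) = (\<lambda>i\<in>{..<k}. lev N (x i))}"
    (is "?A = ?B")
  proof
    show "?A \<subseteq> ?B"
    proof
      fix y assume "y \<in> ?A"
      then have y: "y \<in> extensional {..<k}" "\<And>i. i < k \<Longrightarrow> y i \<in> topspace X \<and> lev N (y i) = lev N (x i)"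
        by (auto simp: PiE_iff)
      then have "(\<lambda>i\<in>{..<k}. lev N (y i)) = (\<lambda>i\<in>{..<k}. lev N (x i))"
        by (intro restrict_ext) simp
      then show "y \<in> ?B" using y by (simp add: PiE_iff)
    qed
    show "?B \<subseteq> ?A"
    proof
      fix y assume y: "y \<in> ?B"
      then have "(\<lambda>i\<in>{..<k}. lev N (y i)) = (\<lambda>i\<in>{..<k}. lev N (x i))" by blast
      from fun_cong[OF this] have "lev N (y i) = lev N (x i)" if "i < k" for i
        using that by (metis lessThan_iff restrict_apply')
      then show "y \<in> ?A" using y by (auto simp: PiE_iff)
    qed
  qed
  ultimately show "openin (product_topology (\<lambda>_. X) {..<k})
      {y \<in> topspace (product_topology (\<lambda>_. X) {..<k}). (\<lambda>i\<in>{..<k}. lev N (y i)) = (\<lambda>i\<in>{..<k}. lev N (x i))}"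
    by simp
next
  fix V x assume "openin (product_topology (\<lambda>_. X) {..<k}) V" "x \<in> V"
  then obtain U where U: "\<And>i. i < k \<Longrightarrow> openin X (U i)" "x \<in> Pi\<^sub>E {..<k} U" "Pi\<^sub>E {..<k} U \<subseteq> V"
    unfolding openin_product_topology_alt by (metis lessThan_iff)
  have "\<forall>i \<in> {..<k}. \<exists>N \<in> I. \<forall>y \<in> topspace X. lev N y = lev N (x i) \<longrightarrow> y \<in> U i"
    using level_base U by (auto simp: PiE_iff)
  then obtain N where N: "\<And>i. i < k \<Longrightarrow> N i \<in> I"
      "\<And>i y. \<lbrakk>i < k; y \<in> topspace X; lev (N i) y = lev (N i) (x i)\<rbrakk> \<Longrightarrow> y \<in> U i"
    by (metis lessThan_iff)
  have "N ` {..<k} \<subseteq> I" using N(1) by auto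
  then obtain M where M: "M \<in> I" "\<forall>i<k. M \<subseteq> N i"
    using lower_bound[of "N ` {..<k}"] by auto
  have xX: "x i \<in> topspace X" if "i < k" for i
    using U(1)[OF that] U(2) that by (auto simp: PiE_iff dest: openin_subset)
  have "y \<in> V" if y: "y \<in> topspace (product_topology (\<lambda>_. X) {..<k})"
    and eq: "(\<lambda>i\<in>{..<k}. lev M (y i)) = (\<lambda>i\<in>{..<k}. lev M (x i))" for y
  proof -
    have "y i \<in> U i" if i: "i < k" for i
    proof (rule N(2)[OF i])
      show "y i \<in> topspace X" using y i by auto
      have "lev M (y i) = lev M (x i)" using fun_cong[OF eq, of i] i by simp
      then show "lev (N i) (y i) = lev (N i) (x i)"
        by (intro mono[OF M(1) N(1)[OF i] M(2)[rule_format, OF i] \<open>y i \<in> topspace X\<close> xX[OF i]])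
    qed
    then have "y \<in> Pi\<^sub>E {..<k} U" using y by (auto simp: PiE_iff)
    then show ?thesis using U(3) by blast
  qed
  then show "\<exists>N\<in>I. \<forall>y\<in>topspace (product_topology (\<lambda>_. X) {..<k}).
      (\<lambda>i\<in>{..<k}. lev N (y i)) = (\<lambda>i\<in>{..<k}. lev N (x i)) \<longrightarrow> y \<in> V"
    using M(1) by blast
qed (use nonempty Int_closed in auto)

end

section \<open>Profinite completions\<close>

text \<open>On A the map k factors through h. Finiteness of an index is transferred this way, for
  kernels and for intersections.\<close>

lemma finite_image_factor:
  assumes "finite (h ` A)" "\<And>x y. \<lbrakk>x \<in> A; y \<in> A; h x = h y\<rbrakk> \<Longrightarrow> k x = k y"
  shows "finite (k ` A)"
proof -
  have "k ` A \<subseteq> (\<lambda>b. k (SOME x. x \<in> A \<and> h x = b)) ` h ` A"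
  proof (clarify)
    fix x assume x: "x \<in> A"
    let ?y = "SOME y. y \<in> A \<and> h y = h x"
    have "?y \<in> A \<and> h ?y = h x" by (rule someI[of _ x]) (use x in simp)
    then have "k x = k ?y" using assms(2)[of x ?y] x by simp
    then show "k x \<in> (\<lambda>b. k (SOME x. x \<in> A \<and> h x = b)) ` h ` A" using x by auto
  qed
  then show ?thesis using assms(1) finite_subset by blast
qed

section \<open>Normal subgroups of finite index\<close>

context group
begin

lemma FIN_normal: "N \<in> finite_index_normal G \<Longrightarrow> N \<lhd> G"
  by (simp add: finite_index_normal_def)

lemma FIN_subgroup: "N \<in> finite_index_normal G \<Longrightarrow> subgroup N G"
  by (simp add: FIN_normal normal_imp_subgroup)

lemma finite_FIN_quotient: "N \<in> finite_index_normal G \<Longrightarrow> finite (carrier (G Mod N))"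
  by (simp add: finite_index_normal_def FactGroup_def)

lemma group_FIN_quotient: "N \<in> finite_index_normal G \<Longrightarrow> group (G Mod N)"
  using FIN_normal normal.factorgroup_is_group by blast

lemma rcos_eq_iff:
  assumes "subgroup N G" "x \<in> carrier G" "y \<in> carrier G"
  shows "N #> x = N #> y \<longleftrightarrow> x \<in> N #> y"
proof
  assume "N #> x = N #> y"
  then show "x \<in> N #> y" using rcos_self[OF assms(2,1)] by simp
next
  assume "x \<in> N #> y"
  then show "N #> x = N #> y" using repr_independence[OF _ assms(3,1)] by simp
qed

lemma rcos_eq_iff_inv:
  assumes "subgroup N G" "x \<in> carrier G" "y \<in> carrier G"
  shows "N #> x = N #> y \<longleftrightarrow> x \<otimes> inv y \<in> N"
  using rcos_eq_iff[OF assms] subgroup.rcos_module[OF assms(1) is_group assms(3,2)] by simp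

lemma rcos_eq_self_iff:
  assumes "subgroup N G" "x \<in> carrier G"
  shows "N #> x = N \<longleftrightarrow> x \<in> N"
  using rcos_eq_iff_inv[OF assms one_closed] coset_mult_one[OF subgroup.subset[OF assms(1)]] assms(2) by simp

lemma mem_rcosD:
  assumes "subgroup N G" "C \<in> carrier (G Mod N)" "x \<in> C"
  shows "x \<in> carrier G" "C = N #> x"
proof -
  obtain y where y: "y \<in> carrier G" "C = N #> y"
    using assms(2) by (auto simp: carrier_FactGroup)
  then show "x \<in> carrier G" using assms r_coset_subset_G subgroup.subset by blast
  then show "C = N #> x" using rcos_eq_iff[OF assms(1) _ y(1), of x] assms(3) y(2) by blast
qed

lemma kernel_FIN:
  assumes "group H" "h \<in> hom G H" "finite (h ` carrier G)"
  shows "kernel G H h \<in> finite_index_normal G"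
proof -
  interpret H: group H by fact
  interpret h: group_hom G H h using assms(2) by unfold_locales
  have "finite ((\<lambda>x. kernel G H h #> x) ` carrier G)"
  proof (rule finite_image_factor[OF assms(3)])
    fix x y assume "x \<in> carrier G" "y \<in> carrier G" "h x = h y"
    then show "kernel G H h #> x = kernel G H h #> y"
      by (subst rcos_eq_iff_inv[OF h.subgroup_kernel]) (auto simp: kernel_def)
  qed
  moreover have "rcosets (kernel G H h) = (\<lambda>x. kernel G H h #> x) ` carrier G"
    by (auto simp: RCOSETS_def)
  ultimately show ?thesis
    using h.normal_kernel by (simp add: finite_index_normal_def)
qed

text \<open>The preimage is the kernel of the composite of h with the projection modulo M. Such
  preimages are the levels that determine a homomorphism between completions.\<close>

lemma vimage_FIN:
  assumes "group H" "h \<in> hom G H" "M \<in> finite_index_normal H"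
  shows "{g \<in> carrier G. h g \<in> M} \<in> finite_index_normal G"
proof -
  interpret H: group H by fact
  interpret M: normal M H by (rule H.FIN_normal[OF assms(3)])
  have "(\<lambda>a. M #>\<^bsub>H\<^esub> a) \<circ> h \<in> hom G (H Mod M)"
    by (rule Group.hom_compose[OF assms(2) M.r_coset_hom_Mod])
  moreover have "((\<lambda>a. M #>\<^bsub>H\<^esub> a) \<circ> h) ` carrier G \<subseteq> carrier (H Mod M)"
    using assms(2) by (auto simp: carrier_FactGroup hom_def)
  ultimately have "kernel G (H Mod M) ((\<lambda>a. M #>\<^bsub>H\<^esub> a) \<circ> h) \<in> finite_index_normal G"
    using kernel_FIN[OF M.factorgroup_is_group] H.finite_FIN_quotient[OF assms(3)] finite_subset by blast
  moreover have "kernel G (H Mod M) ((\<lambda>a. M #>\<^bsub>H\<^esub> a) \<circ> h) = {g \<in> carrier G. h g \<in> M}"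
    using H.rcos_eq_self_iff[OF H.FIN_subgroup[OF assms(3)]] assms(2) by (auto simp: kernel_def hom_def)
  ultimately show ?thesis by simp
qed

lemma FIN_Int:
  assumes "N \<in> finite_index_normal G" "M \<in> finite_index_normal G"
  shows "N \<inter> M \<in> finite_index_normal G"
proof -
  have sN: "subgroup N G" and sM: "subgroup M G" using assms by (simp_all add: FIN_subgroup)
  have "finite ((\<lambda>x. (N \<inter> M) #> x) ` carrier G)"
  proof (rule finite_image_factor[of "\<lambda>x. (N #> x, M #> x)"])
    show "finite ((\<lambda>x. (N #> x, M #> x)) ` carrier G)"
      by (rule finite_subset[OF _ finite_cartesian_product[OF finite_FIN_quotient[OF assms(1)] finite_FIN_quotient[OF assms(2)]]])
         (auto simp: carrier_FactGroup)
    fix x y assume "x \<in> carrier G" "y \<in> carrier G" "(N #> x, M #> x) = (N #> y, M #> y)"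
    then show "(N \<inter> M) #> x = (N \<inter> M) #> y"
      using rcos_eq_iff_inv[OF sN] rcos_eq_iff_inv[OF sM] rcos_eq_iff_inv[OF subgroups_Inter_pair[OF sN sM]] by simp
  qed
  moreover have "rcosets (N \<inter> M) = (\<lambda>x. (N \<inter> M) #> x) ` carrier G"
    by (auto simp: RCOSETS_def)
  ultimately show ?thesis
    using normal_subgroup_intersect assms by (simp add: finite_index_normal_def)
qed

lemma carrier_FIN: "carrier G \<in> finite_index_normal G"
proof -
  have "{g \<in> carrier G. (\<lambda>_. \<one>) g \<in> {\<one>}} \<in> finite_index_normal G"
    using kernel_FIN[OF is_group, of "\<lambda>_. \<one>"] by (auto simp: kernel_def hom_def intro: finite_subset[of _ "{\<one>}"])
  then show ?thesis by simp
qed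

section \<open>The inverse limit of finite quotients as a profinite group\<close>

abbreviation (input) "PC \<equiv> profinite_completion G"
abbreviation (input) "PT \<equiv> profinite_completion_topology G"

lemma completion_carrier_iff:
  "x \<in> carrier PC \<longleftrightarrow> x \<in> (\<Pi>\<^sub>E N \<in> finite_index_normal G. carrier (G Mod N)) \<and>
     (\<forall>N \<in> finite_index_normal G. \<forall>M \<in> finite_index_normal G. N \<subseteq> M \<longrightarrow> x N \<subseteq> x M)"
  by (simp add: profinite_completion_def)

lemma completion_level_closed:
  "\<lbrakk>x \<in> carrier PC; N \<in> finite_index_normal G\<rbrakk> \<Longrightarrow> x N \<in> carrier (G Mod N)"
  by (auto simp: completion_carrier_iff)

lemma completion_mult:
  "N \<in> finite_index_normal G \<Longrightarrow> (x \<otimes>\<^bsub>PC\<^esub> y) N = x N <#> y N"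
  by (simp add: profinite_completion_def)

lemma completion_one: "N \<in> finite_index_normal G \<Longrightarrow> \<one>\<^bsub>PC\<^esub> N = N"
  by (simp add: profinite_completion_def)

lemma completion_eqI:
  assumes "x \<in> carrier PC" "y \<in> carrier PC" "\<And>N. N \<in> finite_index_normal G \<Longrightarrow> x N = y N"
  shows "x = y"
  using assms by (auto simp: completion_carrier_iff intro: PiE_ext)

lemma completion_mono:
  "\<lbrakk>x \<in> carrier PC; N \<in> finite_index_normal G; M \<in> finite_index_normal G; N \<subseteq> M\<rbrakk> \<Longrightarrow> x N \<subseteq> x M"
  by (auto simp: completion_carrier_iff)

lemma completion_rep:
  assumes "x \<in> carrier PC" "N \<in> finite_index_normal G"
  obtains g where "g \<in> carrier G" "x N = N #> g" "g \<in> x N"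
proof -
  obtain g where g: "g \<in> carrier G" "x N = N #> g"
    using completion_level_closed[OF assms] by (auto simp: carrier_FactGroup)
  then show ?thesis using that rcos_self[OF g(1) FIN_subgroup[OF assms(2)]] by simp
qed

lemma completion_repD:
  assumes "x \<in> carrier PC" "N \<in> finite_index_normal G" "g \<in> x N"
  shows "g \<in> carrier G" "x N = N #> g"
  using mem_rcosD[OF FIN_subgroup[OF assms(2)] completion_level_closed[OF assms(1,2)] assms(3)] by auto

lemma completion_rep_mono:
  assumes "x \<in> carrier PC" "N \<in> finite_index_normal G" "M \<in> finite_index_normal G" "N \<subseteq> M"
    "g \<in> carrier G" "x N = N #> g"
  shows "x M = M #> g"
proof -
  have "g \<in> x N" using rcos_self[OF assms(5) FIN_subgroup[OF assms(2)]] assms(6) by simp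
  then show ?thesis using completion_mono[OF assms(1-4)] completion_repD[OF assms(1,3)] by blast
qed

lemma completion_level_mono:
  assumes "N \<in> finite_index_normal G" "M \<in> finite_index_normal G" "N \<subseteq> M"
    "x \<in> carrier PC" "y \<in> carrier PC" "x N = y N"
  shows "x M = y M"
proof -
  obtain g where g: "g \<in> carrier G" "x N = N #> g" using completion_rep assms by metis
  then show ?thesis
    using completion_rep_mono[OF assms(4) assms(1-3) g] completion_rep_mono[OF assms(5) assms(1-3) g(1)] assms(6) by simp
qed

lemma rcos_mult:
  "\<lbrakk>N \<in> finite_index_normal G; a \<in> carrier G; b \<in> carrier G\<rbrakk> \<Longrightarrow> (N #> a) <#> (N #> b) = N #> (a \<otimes> b)"
  using normal.rcos_sum FIN_normal by metis

text \<open>Products and inverses of subsets are monotone under inclusion, so the compatible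
  families are closed under the operations of the product group.\<close>

lemma group_completion: "group PC"
proof -
  let ?I = "finite_index_normal G"
  let ?Q = "product_group ?I (\<lambda>N. G Mod N)"
  interpret Q: group ?Q by (rule product_group) (rule group_FIN_quotient)
  have PC: "?Q\<lparr>carrier := carrier PC\<rparr> = PC" by (simp add: profinite_completion_def)
  have "subgroup (carrier PC) ?Q"
  proof (rule Q.subgroupI)
    show "carrier PC \<subseteq> carrier ?Q" by (rule subsetI) (simp add: completion_carrier_iff)
    have "\<one>\<^bsub>?Q\<^esub> \<in> carrier PC"
      using Q.one_closed by (auto simp: completion_carrier_iff)
    then show "carrier PC \<noteq> {}" by blast
  next
    fix x assume x: "x \<in> carrier PC"
    then have xQ: "x \<in> carrier ?Q" by (auto simp: completion_carrier_iff)
    have i: "(inv\<^bsub>?Q\<^esub> x) N = set_inv (x N)" if "N \<in> ?I" for N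
      using xQ that inv_product_group[of x ?I "\<lambda>N. G Mod N"] group_FIN_quotient
        normal.inv_FactGroup[OF FIN_normal[OF that]] completion_level_closed[OF x that] by simp
    show "inv\<^bsub>?Q\<^esub> x \<in> carrier PC"
      unfolding completion_carrier_iff
    proof (intro conjI ballI impI)
      fix N M assume "N \<in> ?I" "M \<in> ?I" "N \<subseteq> M"
      then show "(inv\<^bsub>?Q\<^esub> x) N \<subseteq> (inv\<^bsub>?Q\<^esub> x) M"
        using completion_mono[OF x, of N M] i by (auto simp: SET_INV_def)
    qed (use Q.inv_closed[OF xQ] in simp)
  next
    fix x y assume x: "x \<in> carrier PC" and y: "y \<in> carrier PC"
    then have "x \<otimes>\<^bsub>?Q\<^esub> y \<in> carrier ?Q"
      by (intro Q.m_closed) (auto simp: completion_carrier_iff)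
    then show "x \<otimes>\<^bsub>?Q\<^esub> y \<in> carrier PC"
      unfolding completion_carrier_iff
    proof (intro conjI ballI impI)
      fix N M assume "N \<in> ?I" "M \<in> ?I" "N \<subseteq> M"
      then show "(x \<otimes>\<^bsub>?Q\<^esub> y) N \<subseteq> (x \<otimes>\<^bsub>?Q\<^esub> y) M"
        using mono_set_mult[OF completion_mono[OF x, of N M] completion_mono[OF y, of N M]] by simp
    qed simp
  qed
  from Q.subgroup_imp_group[OF this] show ?thesis unfolding PC .
qed

lemma completion_inv:
  assumes "N \<in> finite_index_normal G" "x \<in> carrier PC" "g \<in> carrier G" "x N = N #> g"
  shows "(inv\<^bsub>PC\<^esub> x) N = N #> inv g"
proof -
  interpret PC: group PC by (rule group_completion)
  obtain h where h: "h \<in> carrier G" "(inv\<^bsub>PC\<^esub> x) N = N #> h"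
    using completion_rep assms PC.inv_closed by metis
  have "(inv\<^bsub>PC\<^esub> x \<otimes>\<^bsub>PC\<^esub> x) N = N" using completion_one[OF assms(1)] assms(2) PC.l_inv by simp
  then have "N #> (h \<otimes> g) = N"
    using h(2) assms(4) by (simp only: completion_mult[OF assms(1)] rcos_mult[OF assms(1) h(1) assms(3)])
  then have "h \<otimes> g \<in> N" using rcos_eq_self_iff[OF FIN_subgroup[OF assms(1)]] h assms by simp
  then show ?thesis using h assms rcos_eq_iff_inv[OF FIN_subgroup[OF assms(1)]] by simp
qed

lemma completion_map_level:
  "N \<in> finite_index_normal G \<Longrightarrow> profinite_completion_map G g N = N #> g"
  by (simp add: profinite_completion_map_def)

lemma completion_map_closed:
  assumes "g \<in> carrier G"
  shows "profinite_completion_map G g \<in> carrier PC"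
  using assms by (auto simp: completion_carrier_iff profinite_completion_map_def carrier_FactGroup r_coset_def)

lemma completion_map_hom: "profinite_completion_map G \<in> hom G PC"
proof (rule homI)
  interpret PC: group PC by (rule group_completion)
  fix a b assume ab: "a \<in> carrier G" "b \<in> carrier G"
  show "profinite_completion_map G (a \<otimes> b) = profinite_completion_map G a \<otimes>\<^bsub>PC\<^esub> profinite_completion_map G b"
    using ab by (intro completion_eqI PC.m_closed completion_map_closed)
      (auto simp: completion_mult completion_map_level rcos_mult)
qed (rule completion_map_closed)

lemma topspace_completion: "topspace PT = carrier PC"
proof -
  have "carrier PC \<subseteq> (\<Pi>\<^sub>E N \<in> finite_index_normal G. carrier (G Mod N))"
    by (rule subsetI) (simp add: completion_carrier_iff)
  then show ?thesis by (simp add: profinite_completion_topology_def Int_absorb1)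
qed

lemma completion_projection:
  "N \<in> finite_index_normal G \<Longrightarrow> continuous_map PT (discrete_topology (carrier (G Mod N))) (\<lambda>x. x N)"
  unfolding profinite_completion_topology_def
  using continuous_map_from_subtopology[OF continuous_map_product_projection] .

text \<open>A basic open set restricts finitely many coordinates. The intersection of the
  corresponding subgroups again has finite index, and the coordinate there determines all the
  others.\<close>

lemma leveled_completion: "leveled_space PT (finite_index_normal G) (\<lambda>N x. x N)"
proof
  show "finite_index_normal G \<noteq> {}" using carrier_FIN by blast
next
  fix N M x y assume "N \<in> finite_index_normal G" "M \<in> finite_index_normal G" "N \<subseteq> M"
    "x \<in> topspace PT" "y \<in> topspace PT" "x N = y N"
  then show "x M = y M" unfolding topspace_completion by (rule completion_level_mono)
next
  fix N x assume "N \<in> finite_index_normal G" "x \<in> topspace PT"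
  then show "openin PT {y \<in> topspace PT. y N = x N}"
    using openin_discrete_fiber[OF completion_projection] by blast
next
  fix V x assume "openin PT V" and xV: "x \<in> V"
  then obtain W where W: "V = W \<inter> carrier PC"
      "openin (product_topology (\<lambda>N. discrete_topology (carrier (G Mod N))) (finite_index_normal G)) W"
    by (auto simp: profinite_completion_topology_def openin_subtopology)
  then obtain U where U: "finite {N \<in> finite_index_normal G. U N \<noteq> carrier (G Mod N)}"
      "x \<in> Pi\<^sub>E (finite_index_normal G) U" "Pi\<^sub>E (finite_index_normal G) U \<subseteq> W"
    using xV unfolding openin_product_topology_alt by (auto simp: topspace_discrete_topology)
  let ?J = "{N \<in> finite_index_normal G. U N \<noteq> carrier (G Mod N)}"
  have "\<exists>N \<in> finite_index_normal G. \<forall>M \<in> J. N \<subseteq> M" if "finite J" "J \<subseteq> finite_index_normal G" for J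
    using that
  proof (induction J)
    case (insert M J)
    then obtain N where "N \<in> finite_index_normal G" "\<forall>M \<in> J. N \<subseteq> M" by auto
    then show ?case using FIN_Int[of M N] insert.prems by (intro bexI[of _ "M \<inter> N"]) auto
  qed (use carrier_FIN in auto)
  then obtain N where N: "N \<in> finite_index_normal G" "\<forall>M \<in> ?J. N \<subseteq> M"
    using U(1) by blast
  have x: "x \<in> carrier PC" using xV W(1) by auto
  have "y \<in> V" if y: "y \<in> carrier PC" "y N = x N" for y
  proof -
    have "y M \<in> U M" if M: "M \<in> finite_index_normal G" for M
    proof (cases "M \<in> ?J")
      case True
      then have "y M = x M" using completion_level_mono[OF N(1) M _ y(1) x y(2)] N(2) by blast
      then show ?thesis using U(2) M by auto
    next
      case False
      then show ?thesis using M completion_level_closed[OF y(1) M] by auto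
    qed
    then have "y \<in> Pi\<^sub>E (finite_index_normal G) U" using y(1) by (auto simp: completion_carrier_iff PiE_iff)
    then show ?thesis using U(3) W(1) y(1) by auto
  qed
  then show "\<exists>N \<in> finite_index_normal G. \<forall>y \<in> topspace PT. y N = x N \<longrightarrow> y \<in> V"
    using N(1) topspace_completion by auto
qed (rule FIN_Int)

lemma continuous_map_into_completion:
  assumes "\<And>x. x \<in> topspace X \<Longrightarrow> \<phi> x \<in> carrier PC"
    and "\<And>N x. \<lbrakk>N \<in> finite_index_normal G; x \<in> topspace X\<rbrakk> \<Longrightarrow> \<exists>U. openin X U \<and> x \<in> U \<and> (\<forall>y \<in> U. \<phi> y N = \<phi> x N)"
  shows "continuous_map X PT \<phi>"
  unfolding profinite_completion_topology_def continuous_map_in_subtopology continuous_map_componentwise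
  using assms completion_level_closed[OF assms(1)]
  by (auto intro!: continuous_map_into_discreteI simp: completion_carrier_iff PiE_iff)

text \<open>The ambient product of finite discrete spaces is compact, and the compatible families
  are closed in it: a violation of compatibility involves two coordinates only, so it persists on a
  neighbourhood.\<close>

lemma compact_space_completion: "compact_space PT"
proof -
  let ?X = "product_topology (\<lambda>N. discrete_topology (carrier (G Mod N))) (finite_index_normal G)"
  have cX: "compact_space ?X"
    using finite_FIN_quotient by (auto simp: compact_space_product_topology compact_space_discrete_topology)
  have "openin ?X (topspace ?X - carrier PC)"
  proof (subst openin_subopen, intro ballI)
    fix x assume x: "x \<in> topspace ?X - carrier PC"
    then obtain N M where NM: "N \<in> finite_index_normal G" "M \<in> finite_index_normal G" "N \<subseteq> M" "\<not> x N \<subseteq> x M"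
      by (auto simp: completion_carrier_iff)
    let ?V = "{y \<in> topspace ?X. y N = x N} \<inter> {y \<in> topspace ?X. y M = x M}"
    have "openin ?X ?V"
      using x by (intro openin_Int openin_discrete_fiber[OF continuous_map_product_projection[OF NM(1)]]
          openin_discrete_fiber[OF continuous_map_product_projection[OF NM(2)]]) auto
    moreover have "x \<in> ?V" using x by blast
    moreover have "y \<notin> carrier PC" if "y \<in> ?V" for y
      using completion_mono[of y N M] NM that by auto
    then have "?V \<subseteq> topspace ?X - carrier PC" by blast
    ultimately show "\<exists>V. openin ?X V \<and> x \<in> V \<and> V \<subseteq> topspace ?X - carrier PC" by blast
  qed
  moreover have "carrier PC \<subseteq> topspace ?X" by (rule subsetI) (simp add: completion_carrier_iff)
  ultimately have "closedin ?X (carrier PC)" by (simp add: closedin_def)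
  then show ?thesis
    unfolding profinite_completion_topology_def using cX closedin_compact_space compact_space_subtopology by blast
qed

lemma Hausdorff_space_completion: "Hausdorff_space PT"
  unfolding profinite_completion_topology_def
  by (rule Hausdorff_space_subtopology) (simp add: Hausdorff_space_product_topology Hausdorff_space_discrete_topology)

lemma totally_disconnected_completion:
  assumes "connectedin PT C" "x \<in> C" "y \<in> C"
  shows "x = y"
proof (rule completion_eqI)
  show "x \<in> carrier PC" "y \<in> carrier PC"
    using assms connectedin_subset_topspace topspace_completion by blast+
  fix N assume "N \<in> finite_index_normal G"
  then have "connectedin (discrete_topology (carrier (G Mod N))) ((\<lambda>x. x N) ` C)"
    using connectedin_continuous_map_image[OF completion_projection assms(1)] by blast
  then obtain a where "(\<lambda>x. x N) ` C \<subseteq> {a}" unfolding connectedin_discrete_topology by blast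
  then show "x N = y N" using assms(2,3) by blast
qed

theorem profinite_group_completion: "profinite_group PC PT"
proof -
  interpret PC: group PC by (rule group_completion)
  interpret leveled_space PT "finite_index_normal G" "\<lambda>N x. x N" by (rule leveled_completion)
  have "continuous_map (prod_topology PT PT) PT (\<lambda>(x, y). x \<otimes>\<^bsub>PC\<^esub> y)"
  proof (rule continuous_map_into_completion)
    fix z assume "z \<in> topspace (prod_topology PT PT)"
    then show "(case z of (x, y) \<Rightarrow> x \<otimes>\<^bsub>PC\<^esub> y) \<in> carrier PC"
      by (auto simp: topspace_completion)
  next
    fix N z assume N: "N \<in> finite_index_normal G" and z: "z \<in> topspace (prod_topology PT PT)"
    obtain x y where xy: "z = (x, y)" "x \<in> topspace PT" "y \<in> topspace PT" using z by auto
    let ?U = "{v \<in> topspace PT. v N = x N} \<times> {v \<in> topspace PT. v N = y N}"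
    show "\<exists>U. openin (prod_topology PT PT) U \<and> z \<in> U \<and>
        (\<forall>w \<in> U. (case w of (x, y) \<Rightarrow> x \<otimes>\<^bsub>PC\<^esub> y) N = (case z of (x, y) \<Rightarrow> x \<otimes>\<^bsub>PC\<^esub> y) N)"
      using N xy by (intro exI[of _ ?U]) (auto simp: openin_prod_Times_iff completion_mult intro: level_open)
  qed
  moreover have "continuous_map PT PT (\<lambda>x. inv\<^bsub>PC\<^esub> x)"
  proof (rule continuous_map_into_completion)
    fix x assume "x \<in> topspace PT"
    then show "inv\<^bsub>PC\<^esub> x \<in> carrier PC" by (simp add: topspace_completion)
  next
    fix N x assume N: "N \<in> finite_index_normal G" and x: "x \<in> topspace PT"
    have "(inv\<^bsub>PC\<^esub> y) N = (inv\<^bsub>PC\<^esub> x) N" if "y \<in> topspace PT" "y N = x N" for y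
    proof -
      have xy: "x \<in> carrier PC" "y \<in> carrier PC" using that x by (simp_all add: topspace_completion)
      obtain g where g: "g \<in> carrier G" "x N = N #> g" by (rule completion_rep[OF xy(1) N])
      show ?thesis
        using completion_inv[OF N xy(1) g] completion_inv[OF N xy(2) g(1)] that(2) g(2) by simp
    qed
    then show "\<exists>U. openin PT U \<and> x \<in> U \<and> (\<forall>y \<in> U. (inv\<^bsub>PC\<^esub> y) N = (inv\<^bsub>PC\<^esub> x) N)"
      using x level_open[OF N x] by (intro exI[of _ "{y \<in> topspace PT. y N = x N}"]) blast
  qed
  ultimately show ?thesis
    unfolding profinite_group_def topological_group_def
    using group_completion topspace_completion compact_space_completion Hausdorff_space_completion
      totally_disconnected_completion by blast
qed

end

lemma profinite_group_closed_subgroup: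
  assumes "profinite_group G T" "subgroup H G" "closedin T H"
  shows "profinite_group (G\<lparr>carrier := H\<rparr>) (subtopology T H)"
proof -
  have G: "group G" and ts: "topspace T = carrier G"
    and m: "continuous_map (prod_topology T T) T (\<lambda>(x, y). x \<otimes>\<^bsub>G\<^esub> y)"
    and i: "continuous_map T T (\<lambda>x. inv\<^bsub>G\<^esub> x)"
    using assms(1) by (auto simp: profinite_group_def topological_group_def)
  interpret G: group G by (rule G)
  have Hc: "H \<subseteq> carrier G" using assms(2) by (rule subgroup.subset)
  have "continuous_map (prod_topology (subtopology T H) (subtopology T H)) (subtopology T H) (\<lambda>(x, y). x \<otimes>\<^bsub>G\<^esub> y)"
    unfolding subtopology_Times[symmetric] continuous_map_in_subtopology
    using continuous_map_from_subtopology[OF m] assms(2) by (auto intro: subgroup.m_closed)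
  moreover have "continuous_map (subtopology T H) (subtopology T H) (\<lambda>x. inv\<^bsub>G\<lparr>carrier := H\<rparr>\<^esub> x)"
  proof (rule continuous_map_eq)
    show "continuous_map (subtopology T H) (subtopology T H) (\<lambda>x. inv\<^bsub>G\<^esub> x)"
      unfolding continuous_map_in_subtopology
      using continuous_map_from_subtopology[OF i] assms(2) by (auto intro: subgroup.m_inv_closed)
  qed (use G.m_inv_consistent[OF assms(2)] in auto)
  ultimately have "topological_group (G\<lparr>carrier := H\<rparr>) (subtopology T H)"
    using G.subgroup_imp_group[OF assms(2)] ts Hc by (auto simp: topological_group_def)
  moreover have "compact_space (subtopology T H)"
    using assms by (simp add: profinite_group_def closedin_compact_space compact_space_subtopology)
  ultimately show ?thesis
    using assms(1) by (auto simp: profinite_group_def Hausdorff_space_subtopology connectedin_subtopology)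
qed

section \<open>Functoriality of the completion\<close>

definition completion_hom ::
    "('a, 'b) monoid_scheme \<Rightarrow> ('c, 'd) monoid_scheme \<Rightarrow> ('a \<Rightarrow> 'c) \<Rightarrow> ('a set \<Rightarrow> 'a set) \<Rightarrow> 'c set \<Rightarrow> 'c set" where
  "completion_hom G H h x = (\<lambda>M \<in> finite_index_normal H.
     M #>\<^bsub>H\<^esub> h (SOME g. g \<in> x {g \<in> carrier G. h g \<in> M}))"

context
  fixes G (structure) and H (structure) and h
  assumes G: "group G" and H: "group H" and h: "h \<in> hom G H"
begin

interpretation G: group G by (rule G)
interpretation H: group H by (rule H)
interpretation h: group_hom G H h using h by unfold_locales

text \<open>Two representatives of x modulo the preimage of M differ by an element that h sends into
  M. Hence the choice made in \<open>completion_hom\<close> is immaterial, and any finer level N may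
  be used to compute the value.\<close>

lemma completion_hom_level:
  assumes "x \<in> carrier (profinite_completion G)" "M \<in> finite_index_normal H"
    "N \<in> finite_index_normal G" "N \<subseteq> {g \<in> carrier G. h g \<in> M}" "g \<in> carrier G" "x N = N #>\<^bsub>G\<^esub> g"
  shows "completion_hom G H h x M = M #>\<^bsub>H\<^esub> h g"
proof -
  let ?K = "{g \<in> carrier G. h g \<in> M}"
  have K: "?K \<in> finite_index_normal G" by (rule G.vimage_FIN[OF H h assms(2)])
  have xK: "x ?K = ?K #>\<^bsub>G\<^esub> g" by (rule G.completion_rep_mono[OF assms(1,3) K assms(4-6)])
  define g' where "g' = (SOME g. g \<in> x ?K)"
  have "g \<in> x ?K" using xK G.rcos_self[OF assms(5) G.FIN_subgroup[OF K]] by simp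
  then have "g' \<in> x ?K" unfolding g'_def by (rule someI)
  note r = G.completion_repD[OF assms(1) K this]
  have "?K #>\<^bsub>G\<^esub> g' = ?K #>\<^bsub>G\<^esub> g" using r(2) xK by simp
  then have "g' \<otimes>\<^bsub>G\<^esub> inv\<^bsub>G\<^esub> g \<in> ?K"
    using G.rcos_eq_iff_inv[OF G.FIN_subgroup[OF K] r(1) assms(5)] by simp
  then have "M #>\<^bsub>H\<^esub> h g' = M #>\<^bsub>H\<^esub> h g"
    using r(1) assms(5) by (subst H.rcos_eq_iff_inv[OF H.FIN_subgroup[OF assms(2)]]) auto
  then show ?thesis using assms(2) by (simp add: completion_hom_def g'_def)
qed

lemma completion_hom_rep:
  assumes "x \<in> carrier (profinite_completion G)" "M \<in> finite_index_normal H"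
  obtains g where "g \<in> carrier G" "x {g \<in> carrier G. h g \<in> M} = {g \<in> carrier G. h g \<in> M} #>\<^bsub>G\<^esub> g"
    "completion_hom G H h x M = M #>\<^bsub>H\<^esub> h g"
proof -
  have K: "{g \<in> carrier G. h g \<in> M} \<in> finite_index_normal G" by (rule G.vimage_FIN[OF H h assms(2)])
  obtain g where "g \<in> carrier G" "x {g \<in> carrier G. h g \<in> M} = {g \<in> carrier G. h g \<in> M} #>\<^bsub>G\<^esub> g"
    by (rule G.completion_rep[OF assms(1) K])
  then show ?thesis using that completion_hom_level[OF assms K order_refl] by blast
qed

lemma completion_hom_closed:
  assumes x: "x \<in> carrier (profinite_completion G)"
  shows "completion_hom G H h x \<in> carrier (profinite_completion H)"
  unfolding H.completion_carrier_iff
proof (intro conjI ballI impI)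
  show "completion_hom G H h x \<in> (\<Pi>\<^sub>E M \<in> finite_index_normal H. carrier (H Mod M))"
  proof (rule PiE_I)
    fix M assume M: "M \<in> finite_index_normal H"
    obtain g where "g \<in> carrier G" "completion_hom G H h x M = M #>\<^bsub>H\<^esub> h g"
      by (rule completion_hom_rep[OF x M])
    then show "completion_hom G H h x M \<in> carrier (H Mod M)"
      by (simp add: carrier_FactGroup)
  qed (simp add: completion_hom_def)
  fix N M assume NM: "N \<in> finite_index_normal H" "M \<in> finite_index_normal H" "N \<subseteq> M"
  let ?K = "\<lambda>M. {g \<in> carrier G. h g \<in> M}"
  have K: "?K N \<in> finite_index_normal G" "?K N \<subseteq> ?K M" "?K N \<subseteq> ?K N"
    using G.vimage_FIN[OF H h] NM by auto
  obtain g where g: "g \<in> carrier G" "x (?K N) = ?K N #>\<^bsub>G\<^esub> g"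
    by (rule G.completion_rep[OF x K(1)])
  show "completion_hom G H h x N \<subseteq> completion_hom G H h x M"
    using completion_hom_level[OF x NM(1) K(1,3) g] completion_hom_level[OF x NM(2) K(1,2) g] NM(3)
    by (auto simp: r_coset_def)
qed

lemma completion_hom_hom: "completion_hom G H h \<in> hom (profinite_completion G) (profinite_completion H)"
proof (rule homI)
  interpret PG: group "profinite_completion G" by (rule G.group_completion)
  interpret PH: group "profinite_completion H" by (rule H.group_completion)
  fix x y assume x: "x \<in> carrier (profinite_completion G)" and y: "y \<in> carrier (profinite_completion G)"
  show "completion_hom G H h (x \<otimes>\<^bsub>profinite_completion G\<^esub> y)
      = completion_hom G H h x \<otimes>\<^bsub>profinite_completion H\<^esub> completion_hom G H h y"
  proof (rule H.completion_eqI)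
    fix M assume M: "M \<in> finite_index_normal H"
    let ?K = "{g \<in> carrier G. h g \<in> M}"
    have K: "?K \<in> finite_index_normal G" by (rule G.vimage_FIN[OF H h M])
    obtain a where a: "a \<in> carrier G" "x ?K = ?K #>\<^bsub>G\<^esub> a" "completion_hom G H h x M = M #>\<^bsub>H\<^esub> h a"
      by (rule completion_hom_rep[OF x M])
    obtain b where b: "b \<in> carrier G" "y ?K = ?K #>\<^bsub>G\<^esub> b" "completion_hom G H h y M = M #>\<^bsub>H\<^esub> h b"
      by (rule completion_hom_rep[OF y M])
    have "(x \<otimes>\<^bsub>profinite_completion G\<^esub> y) ?K = ?K #>\<^bsub>G\<^esub> (a \<otimes>\<^bsub>G\<^esub> b)"
      using a b by (simp add: G.completion_mult[OF K] G.rcos_mult[OF K])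
    then have "completion_hom G H h (x \<otimes>\<^bsub>profinite_completion G\<^esub> y) M = M #>\<^bsub>H\<^esub> h (a \<otimes>\<^bsub>G\<^esub> b)"
      by (rule completion_hom_level[OF PG.m_closed[OF x y] M K order_refl G.m_closed[OF a(1) b(1)]])
    then show "completion_hom G H h (x \<otimes>\<^bsub>profinite_completion G\<^esub> y) M
        = (completion_hom G H h x \<otimes>\<^bsub>profinite_completion H\<^esub> completion_hom G H h y) M"
      using a b by (simp only: H.completion_mult[OF M] H.rcos_mult[OF M] h.hom_mult h.hom_closed)
  qed (use x y completion_hom_closed in auto)
qed (rule completion_hom_closed)

lemma continuous_completion_hom:
  "continuous_map (profinite_completion_topology G) (profinite_completion_topology H) (completion_hom G H h)"
proof (rule H.continuous_map_into_completion)
  fix x assume "x \<in> topspace (profinite_completion_topology G)"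
  then show "completion_hom G H h x \<in> carrier (profinite_completion H)"
    using completion_hom_closed by (simp add: G.topspace_completion)
next
  interpret L: leveled_space "profinite_completion_topology G" "finite_index_normal G" "\<lambda>N x. x N"
    by (rule G.leveled_completion)
  fix M x assume M: "M \<in> finite_index_normal H" and x: "x \<in> topspace (profinite_completion_topology G)"
  let ?K = "{g \<in> carrier G. h g \<in> M}"
  have K: "?K \<in> finite_index_normal G" by (rule G.vimage_FIN[OF H h M])
  have x': "x \<in> carrier (profinite_completion G)" using x by (simp add: G.topspace_completion)
  have "completion_hom G H h y M = completion_hom G H h x M"
    if "y \<in> topspace (profinite_completion_topology G)" "y ?K = x ?K" for y
    using that M by (simp add: completion_hom_def)
  then show "\<exists>U. openin (profinite_completion_topology G) U \<and> x \<in> U \<and>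
      (\<forall>y \<in> U. completion_hom G H h y M = completion_hom G H h x M)"
    using L.level_open[OF K x] x
    by (intro exI[of _ "{y \<in> topspace (profinite_completion_topology G). y ?K = x ?K}"]) blast
qed

end

(* One_nat_def would turn {1..n} into {Suc 0..n}. *)
declare mult_free_group [simp del] one_free_group [simp del] One_nat_def [simp del]
  mult_FactGroup [simp del] one_FactGroup [simp del]

section \<open>The HNN-extension\<close>

lemma (in group) normal_closure_normal:
  assumes "R \<subseteq> carrier G"
  shows "normal_closure G R \<lhd> G"
proof (rule normal_inv_iff[THEN iffD2], intro conjI ballI)
  have "carrier G \<lhd> G" by (rule normal_inv_iff[THEN iffD2]) (simp add: subgroup_self)
  then show "subgroup (normal_closure G R) G"
    unfolding normal_closure_def using assms by (intro subgroups_Inter) (auto intro: normal_imp_subgroup)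
next
  fix x h assume "x \<in> carrier G" "h \<in> normal_closure G R"
  then show "x \<otimes> h \<otimes> inv x \<in> normal_closure G R"
    unfolding normal_closure_def using normal_inv_iff by auto
qed

lemma (in group) normal_closure_incl: "R \<subseteq> normal_closure G R"
  unfolding normal_closure_def by blast

lemma (in group) normal_closure_least: "\<lbrakk>N \<lhd> G; R \<subseteq> N\<rbrakk> \<Longrightarrow> normal_closure G R \<subseteq> N"
  unfolding normal_closure_def by blast

lemma cancel_cons_map:
  assumes "inj g"
  shows "cancel_cons ((\<lambda>(i, s). (g i, s)) a) (map (\<lambda>(i, s). (g i, s)) w)
    = map (\<lambda>(i, s). (g i, s)) (cancel_cons a w)"
  using assms by (cases w) (auto simp: case_prod_beta inj_eq)

lemma hnn_word_hom: "hnn_word \<in> hom (free_group {1..n}) (free_group (hnn_gens n))"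
proof (rule homI)
  fix w assume "w \<in> carrier (free_group {1..n})"
  then show "hnn_word w \<in> carrier (free_group (hnn_gens n))"
    by (auto simp: carrier_free_group hnn_word_def reduced_word_def successively_map case_prod_beta hnn_gens_def
        elim!: successively_mono)
next
  fix u v :: "nat word"
  have "foldr cancel_cons (hnn_word u) (hnn_word v) = hnn_word (foldr cancel_cons u v)"
    unfolding hnn_word_def by (induction u) (auto simp: cancel_cons_map[symmetric])
  then show "hnn_word (u \<otimes>\<^bsub>free_group {1..n}\<^esub> v) = hnn_word u \<otimes>\<^bsub>free_group (hnn_gens n)\<^esub> hnn_word v"
    by (simp add: mult_free_group)
qed

lemma (in group) conj_hom:
  assumes "h \<in> hom H G" "c \<in> carrier G"
  shows "(\<lambda>w. inv c \<otimes> h w \<otimes> c) \<in> hom H G"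
proof (rule homI)
  fix u v assume "u \<in> carrier H" "v \<in> carrier H"
  then have "h u \<in> carrier G" "h v \<in> carrier G" "h (u \<otimes>\<^bsub>H\<^esub> v) = h u \<otimes> h v"
    using assms(1) by (auto simp: hom_def)
  moreover have "c \<otimes> (inv c \<otimes> (h v \<otimes> c)) = h v \<otimes> c"
    using \<open>h v \<in> carrier G\<close> assms(2) by (simp add: m_assoc[symmetric])
  ultimately show "inv c \<otimes> h (u \<otimes>\<^bsub>H\<^esub> v) \<otimes> c = (inv c \<otimes> h u \<otimes> c) \<otimes> (inv c \<otimes> h v \<otimes> c)"
    using assms(2) by (simp add: m_assoc)
qed (use assms in \<open>auto simp: hom_def\<close>)

locale hnn =
  fixes n :: nat and f :: "nat word \<Rightarrow> nat word"
  assumes endo: "f \<in> hom (free_group {1..n}) (free_group {1..n})"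
begin

abbreviation "F \<equiv> free_group {1..n}"
abbreviation "E \<equiv> free_group (hnn_gens n)"
abbreviation "K \<equiv> normal_closure E (hnn_relators n f)"
abbreviation "\<Gamma> \<equiv> hnn_group n f"
abbreviation "\<iota> \<equiv> hnn_base_map n f"
abbreviation "FIN \<equiv> finite_index_normal \<Gamma>"

definition "\<tau> = K #>\<^bsub>E\<^esub> free_gen None"

lemma Gamma_eq: "\<Gamma> = E Mod K"
  by (simp add: hnn_group_def presented_group_def)

sublocale F: group F by (rule group_free_group)
sublocale E: group E by (rule group_free_group)
sublocale f: group_hom F F f using endo by unfold_locales

lemma free_gen_F: "i \<in> {1..n} \<Longrightarrow> free_gen i \<in> carrier F"
  by (rule free_gen_closed)

lemma free_gen_E: "free_gen None \<in> carrier E" "i \<in> {1..n} \<Longrightarrow> free_gen (Some i) \<in> carrier E"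
  by (rule free_gen_closed, simp add: hnn_gens_def)+

lemma hnn_word_closed: "w \<in> carrier F \<Longrightarrow> hnn_word w \<in> carrier E"
  by (rule hom_in_carrier[OF hnn_word_hom])

lemma relators_closed: "hnn_relators n f \<subseteq> carrier E"
proof -
  have "hnn_word (f (free_gen i)) \<in> carrier E" if "i \<in> {1..n}" for i
    using hnn_word_closed[OF f.hom_closed[OF free_gen_F[OF that]]] .
  then show ?thesis
    unfolding hnn_relators_def Let_def using free_gen_E by auto
qed

sublocale K: normal K E by (rule E.normal_closure_normal[OF relators_closed])

sublocale \<Gamma>: group \<Gamma> unfolding Gamma_eq by (rule K.factorgroup_is_group)

lemma quotient_hom: "(\<lambda>e. K #>\<^bsub>E\<^esub> e) \<in> hom E \<Gamma>"
  unfolding Gamma_eq by (rule K.r_coset_hom_Mod)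

sublocale q: group_hom E \<Gamma> "\<lambda>e. K #>\<^bsub>E\<^esub> e" using quotient_hom by unfold_locales

lemma base_map_hom: "\<iota> \<in> hom F \<Gamma>"
  using Group.hom_compose[OF hnn_word_hom quotient_hom] by (simp add: hnn_base_map_def[abs_def] comp_def)

sublocale \<iota>: group_hom F \<Gamma> \<iota> using base_map_hom by unfold_locales

lemma stable_closed [simp]: "\<tau> \<in> carrier \<Gamma>"
  unfolding \<tau>_def by (rule q.hom_closed) (rule free_gen_closed, simp add: hnn_gens_def)

lemma base_map_free_gen: "\<iota> (free_gen i) = K #>\<^bsub>E\<^esub> free_gen (Some i)"
  by (simp add: hnn_base_map_def hnn_word_def free_gen_def)

text \<open>Both sides are homomorphisms in w, and the relators make them agree on the
  generators.\<close>

lemma base_relation: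
  assumes "w \<in> carrier F"
  shows "inv\<^bsub>\<Gamma>\<^esub> \<tau> \<otimes>\<^bsub>\<Gamma>\<^esub> \<iota> w \<otimes>\<^bsub>\<Gamma>\<^esub> \<tau> = \<iota> (f w)"
proof (rule free_group_hom_eq[OF \<Gamma>.is_group _ _ _ assms])
  show "(\<lambda>w. inv\<^bsub>\<Gamma>\<^esub> \<tau> \<otimes>\<^bsub>\<Gamma>\<^esub> \<iota> w \<otimes>\<^bsub>\<Gamma>\<^esub> \<tau>) \<in> hom F \<Gamma>"
    by (rule \<Gamma>.conj_hom[OF base_map_hom stable_closed])
  show "(\<lambda>w. \<iota> (f w)) \<in> hom F \<Gamma>"
    using Group.hom_compose[OF endo base_map_hom] by (simp add: comp_def)
  fix i assume i: "i \<in> {1..n}"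
  have t: "free_gen None \<in> carrier E" and x: "free_gen (Some i) \<in> carrier E"
    and y: "hnn_word (f (free_gen i)) \<in> carrier E"
    using i hnn_word_closed free_gen_E free_gen_F by auto
  have "inv\<^bsub>E\<^esub> free_gen None \<otimes>\<^bsub>E\<^esub> free_gen (Some i) \<otimes>\<^bsub>E\<^esub> free_gen None
      \<otimes>\<^bsub>E\<^esub> inv\<^bsub>E\<^esub> hnn_word (f (free_gen i)) \<in> K"
    using i E.normal_closure_incl[of "hnn_relators n f"] unfolding hnn_relators_def Let_def by blast
  then have "K #>\<^bsub>E\<^esub> (inv\<^bsub>E\<^esub> free_gen None \<otimes>\<^bsub>E\<^esub> free_gen (Some i) \<otimes>\<^bsub>E\<^esub> free_gen None)
      = K #>\<^bsub>E\<^esub> hnn_word (f (free_gen i))"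
    using t x y by (subst E.rcos_eq_iff_inv[OF K.is_subgroup]) auto
  then have "inv\<^bsub>\<Gamma>\<^esub> (K #>\<^bsub>E\<^esub> free_gen None) \<otimes>\<^bsub>\<Gamma>\<^esub> (K #>\<^bsub>E\<^esub> free_gen (Some i)) \<otimes>\<^bsub>\<Gamma>\<^esub> (K #>\<^bsub>E\<^esub> free_gen None)
      = K #>\<^bsub>E\<^esub> hnn_word (f (free_gen i))"
    using t x y by (simp only: q.hom_mult q.hom_inv E.m_closed E.inv_closed)
  then show "inv\<^bsub>\<Gamma>\<^esub> \<tau> \<otimes>\<^bsub>\<Gamma>\<^esub> \<iota> (free_gen i) \<otimes>\<^bsub>\<Gamma>\<^esub> \<tau> = \<iota> (f (free_gen i))"
    by (simp only: \<tau>_def base_map_free_gen) (simp add: hnn_base_map_def)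
qed

lemma subgroup_eq_Gamma:
  assumes S: "subgroup S \<Gamma>" and "\<tau> \<in> S" "\<And>i. i \<in> {1..n} \<Longrightarrow> \<iota> (free_gen i) \<in> S" "\<gamma> \<in> carrier \<Gamma>"
  shows "\<gamma> \<in> S"
proof -
  obtain e where e: "e \<in> carrier E" "\<gamma> = K #>\<^bsub>E\<^esub> e"
    using assms(4) unfolding Gamma_eq by (auto simp: carrier_FactGroup)
  let ?S = "{e \<in> carrier E. K #>\<^bsub>E\<^esub> e \<in> S}"
  have "subgroup ?S E"
  proof (rule E.subgroupI)
    have "\<one>\<^bsub>E\<^esub> \<in> ?S" using q.hom_one subgroup.one_closed[OF S] by simp
    then show "?S \<noteq> {}" by blast
  next
    fix a assume "a \<in> ?S"
    then show "inv\<^bsub>E\<^esub> a \<in> ?S" using q.hom_inv[of a] subgroup.m_inv_closed[OF S, of "K #>\<^bsub>E\<^esub> a"] by simp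
  next
    fix a b assume "a \<in> ?S" "b \<in> ?S"
    then show "a \<otimes>\<^bsub>E\<^esub> b \<in> ?S"
      using q.hom_mult[of a b] subgroup.m_closed[OF S, of "K #>\<^bsub>E\<^esub> a" "K #>\<^bsub>E\<^esub> b"] by simp
  qed auto
  moreover have "free_gen ` hnn_gens n \<subseteq> ?S"
    using assms(2,3) by (auto simp: hnn_gens_def \<tau>_def base_map_free_gen intro!: free_gen_closed)
  ultimately have "e \<in> ?S" using free_group_subgroup_eq e(1) by blast
  then show ?thesis using e(2) by simp
qed

text \<open>Von Dyck: the map on free generators given by g and t kills every relator by
  \<open>rel\<close>, hence the normal closure of the relators, and so descends to \<Gamma>.\<close>

lemma hom_from_Gamma:
  assumes W: "group W" and g: "g \<in> hom F W" and t: "t \<in> carrier W"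
    and rel: "\<And>i. i \<in> {1..n} \<Longrightarrow> inv\<^bsub>W\<^esub> t \<otimes>\<^bsub>W\<^esub> g (free_gen i) \<otimes>\<^bsub>W\<^esub> t = g (f (free_gen i))"
  obtains h where "h \<in> hom \<Gamma> W" "\<And>w. w \<in> carrier F \<Longrightarrow> h (\<iota> w) = g w" "h \<tau> = t"
proof -
  interpret W: group W by (rule W)
  define \<xi> where "\<xi> = case_option t (\<lambda>i. g (free_gen i))"
  have \<xi>: "\<xi> \<in> hnn_gens n \<rightarrow> carrier W"
    using t g by (auto simp: \<xi>_def hnn_gens_def intro!: hom_in_carrier[OF g] free_gen_closed)
  define H where "H = word_eval W \<xi>"
  have H: "H \<in> hom E W" unfolding H_def by (rule word_eval_hom[OF W \<xi>])
  interpret H: group_hom E W H using H by unfold_locales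
  have Hgen: "H (free_gen None) = t" "\<And>i. i \<in> {1..n} \<Longrightarrow> H (free_gen (Some i)) = g (free_gen i)"
    unfolding H_def by (subst word_eval_free_gen[OF W \<xi>]; simp add: \<xi>_def hnn_gens_def)+
  have Hw: "H (hnn_word w) = g w" if "w \<in> carrier F" for w
  proof (rule free_group_hom_eq[OF W _ g _ that, of "\<lambda>w. H (hnn_word w)"])
    show "(\<lambda>w. H (hnn_word w)) \<in> hom F W"
      using Group.hom_compose[OF hnn_word_hom H] by (simp add: comp_def)
    fix i assume "i \<in> {1..n}"
    then show "H (hnn_word (free_gen i)) = g (free_gen i)"
      using Hgen(2) by (simp add: hnn_word_def free_gen_def)
  qed
  have "hnn_relators n f \<subseteq> kernel E W H"
  proof
    fix r assume "r \<in> hnn_relators n f"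
    then obtain i where i: "i \<in> {1..n}" and r: "r = inv\<^bsub>E\<^esub> free_gen None \<otimes>\<^bsub>E\<^esub> free_gen (Some i) \<otimes>\<^bsub>E\<^esub> free_gen None
        \<otimes>\<^bsub>E\<^esub> inv\<^bsub>E\<^esub> hnn_word (f (free_gen i))"
      unfolding hnn_relators_def Let_def by blast
    have c: "free_gen None \<in> carrier E" "free_gen (Some i) \<in> carrier E" "hnn_word (f (free_gen i)) \<in> carrier E"
      and gi: "f (free_gen i) \<in> carrier F"
      using i hnn_word_closed free_gen_E free_gen_F by auto
    then have "H r = inv\<^bsub>W\<^esub> t \<otimes>\<^bsub>W\<^esub> g (free_gen i) \<otimes>\<^bsub>W\<^esub> t \<otimes>\<^bsub>W\<^esub> inv\<^bsub>W\<^esub> g (f (free_gen i))"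
      unfolding r using Hgen(1) Hgen(2)[OF i] Hw[OF gi] by simp
    then have "H r = \<one>\<^bsub>W\<^esub>"
      using rel[OF i] hom_in_carrier[OF g gi] by simp
    then show "r \<in> kernel E W H" using c by (simp add: kernel_def r)
  qed
  then have K: "K \<subseteq> kernel E W H"
    by (rule E.normal_closure_least[OF H.normal_kernel])
  obtain h where h: "h \<in> hom (E Mod K) W" "\<And>e. e \<in> carrier E \<Longrightarrow> h (K #>\<^bsub>E\<^esub> e) = H e"
  proof (rule FactGroup_universal[OF H K.normal_axioms])
    fix x y assume xy: "x \<in> carrier E" "y \<in> carrier E" "K #>\<^bsub>E\<^esub> x = K #>\<^bsub>E\<^esub> y"
    then have "x \<otimes>\<^bsub>E\<^esub> inv\<^bsub>E\<^esub> y \<in> K" using E.rcos_eq_iff_inv[OF K.is_subgroup] by simp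
    then have "H (x \<otimes>\<^bsub>E\<^esub> inv\<^bsub>E\<^esub> y) = \<one>\<^bsub>W\<^esub>" using K by (auto simp: kernel_def)
    then have "H x \<otimes>\<^bsub>W\<^esub> inv\<^bsub>W\<^esub> H y = \<one>\<^bsub>W\<^esub>" using xy by simp
    then show "H x = H y" using xy by (metis H.hom_closed W.inv_equality W.inv_inv W.inv_closed)
  qed blast
  show ?thesis
  proof (rule that)
    show "h \<in> hom \<Gamma> W" using h(1) by (simp add: Gamma_eq)
    show "h \<tau> = t" unfolding \<tau>_def using Hgen(1) by (subst h(2)) (auto intro!: free_gen_closed simp: hnn_gens_def)
    fix w assume "w \<in> carrier F"
    then show "h (\<iota> w) = g w"
      unfolding hnn_base_map_def using Hw hom_in_carrier[OF hnn_word_hom] by (subst h(2)) auto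
  qed
qed

section \<open>Iterates of f in finite quotients\<close>

lemma funpow_closed: "w \<in> carrier F \<Longrightarrow> (f ^^ k) w \<in> carrier F"
  by (induction k) auto

lemma funpow_hom: "f ^^ k \<in> hom F F"
proof (induction k)
  case (Suc k)
  then show ?case using Group.hom_compose[OF Suc endo] by (simp add: comp_def)
qed (simp add: hom_def)

text \<open>Only natural exponents can occur, as the relation conjugates in one direction.
  Conjugation the other way is reached in finite quotients alone, by reducing exponents modulo the
  group order.\<close>

lemma conj_power:
  assumes Q: "group Q" and h: "h \<in> hom \<Gamma> Q" and w: "w \<in> carrier F"
  shows "inv\<^bsub>Q\<^esub> (h \<tau> [^]\<^bsub>Q\<^esub> k) \<otimes>\<^bsub>Q\<^esub> h (\<iota> w) \<otimes>\<^bsub>Q\<^esub> (h \<tau> [^]\<^bsub>Q\<^esub> (k::nat)) = h (\<iota> ((f ^^ k) w))"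
proof (induction k)
  interpret Q: group Q by (rule Q)
  interpret h: group_hom \<Gamma> Q h using h by unfold_locales
  case 0
  then show ?case using w by simp
next
  interpret Q: group Q by (rule Q)
  interpret h: group_hom \<Gamma> Q h using h by unfold_locales
  case (Suc k)
  have c: "h \<tau> \<in> carrier Q" "h \<tau> [^]\<^bsub>Q\<^esub> k \<in> carrier Q" "h (\<iota> w) \<in> carrier Q" "(f ^^ k) w \<in> carrier F"
    using w funpow_closed by auto
  have "inv\<^bsub>Q\<^esub> (h \<tau> [^]\<^bsub>Q\<^esub> Suc k) \<otimes>\<^bsub>Q\<^esub> h (\<iota> w) \<otimes>\<^bsub>Q\<^esub> (h \<tau> [^]\<^bsub>Q\<^esub> Suc k)
      = inv\<^bsub>Q\<^esub> h \<tau> \<otimes>\<^bsub>Q\<^esub> (inv\<^bsub>Q\<^esub> (h \<tau> [^]\<^bsub>Q\<^esub> k) \<otimes>\<^bsub>Q\<^esub> h (\<iota> w) \<otimes>\<^bsub>Q\<^esub> (h \<tau> [^]\<^bsub>Q\<^esub> k)) \<otimes>\<^bsub>Q\<^esub> h \<tau>"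
    using c by (simp add: Q.inv_mult_group Q.m_assoc)
  also have "\<dots> = h (inv\<^bsub>\<Gamma>\<^esub> \<tau> \<otimes>\<^bsub>\<Gamma>\<^esub> \<iota> ((f ^^ k) w) \<otimes>\<^bsub>\<Gamma>\<^esub> \<tau>)"
    unfolding Suc using c(4) by simp
  also have "\<dots> = h (\<iota> ((f ^^ Suc k) w))"
    using base_relation[OF c(4)] by simp
  finally show ?case .
qed

lemma finite_quotient_hom_periodic:
  assumes "group Q" "finite (carrier Q)" "h \<in> hom \<Gamma> Q"
  obtains m where "m > 0" "\<And>w. w \<in> carrier F \<Longrightarrow> h (\<iota> ((f ^^ m) w)) = h (\<iota> w)"
proof
  interpret Q: group Q by fact
  interpret h: group_hom \<Gamma> Q h using assms(3) by unfold_locales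
  \<comment> \<open>This fixes the period m as the order of Q, a power that kills the image of
    t.\<close>
  show "order Q > 0" using assms(2) Q.order_gt_0_iff_finite by simp
  fix w assume "w \<in> carrier F"
  then show "h (\<iota> ((f ^^ order Q) w)) = h (\<iota> w)"
    using conj_power[OF assms(1,3), of w "order Q"] Q.pow_order_eq_1[of "h \<tau>"] by simp
qed

text \<open>A homomorphism \<open>g : F \<rightarrow> W\<close> with \<open>g \<circ> f\<^sup>m = g\<close> is induced by a homomorphism from \<open>\<Gamma>\<close> to the
  permutations of \<open>W \<times> \<int>/m\<close>: a word \<open>w\<close> acts on the fibre over \<open>j\<close> as left multiplication by
  \<open>g (f\<^sup>j w)\<close>, and \<open>t\<close> shifts the fibres cyclically.\<close>

lemma periodic_hom_factors:
  assumes W: "group W" "finite (carrier W)" and g: "g \<in> hom F W"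
    and m: "m > 0" "\<And>w. w \<in> carrier F \<Longrightarrow> g ((f ^^ m) w) = g w"
  obtains N where "N \<in> FIN" "\<And>w. \<lbrakk>w \<in> carrier F; \<iota> w \<in> N\<rbrakk> \<Longrightarrow> g w = \<one>\<^bsub>W\<^esub>"
proof -
  interpret W: group W by (rule W)
  interpret g: group_hom F W g using g by unfold_locales
  define S where "S = carrier W \<times> {..<m}"
  define B where "B = BijGroup S"
  interpret B: group B unfolding B_def by (rule group_BijGroup)
  have Bc: "\<alpha> \<in> carrier B \<longleftrightarrow> \<alpha> \<in> extensional S \<and> bij_betw \<alpha> S S" for \<alpha>
    by (simp add: B_def BijGroup_def Bij_def)
  have Bm: "\<alpha> \<otimes>\<^bsub>B\<^esub> \<beta> = compose S \<alpha> \<beta>" if "\<alpha> \<in> carrier B" "\<beta> \<in> carrier B" for \<alpha> \<beta>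
    using that by (simp add: B_def BijGroup_def)
  define a where "a w = (\<lambda>(e, j) \<in> S. (g ((f ^^ j) w) \<otimes>\<^bsub>W\<^esub> e, j))" for w
  have a_ap: "a w (e, j) = (g ((f ^^ j) w) \<otimes>\<^bsub>W\<^esub> e, j)" if "e \<in> carrier W" "j < m" for w e j
    using that by (simp add: a_def S_def)
  have aS: "a w x \<in> S" if "x \<in> S" "w \<in> carrier F" for w x
    using that funpow_closed by (auto simp: S_def a_def)
  have a_mult: "a (u \<otimes>\<^bsub>F\<^esub> v) x = a u (a v x)" if u: "u \<in> carrier F" and v: "v \<in> carrier F" and x: "x \<in> S" for u v x
  proof -
    obtain e j where x': "x = (e, j)" "e \<in> carrier W" "j < m" using x by (auto simp: S_def)
    have c: "(f ^^ j) u \<in> carrier F" "(f ^^ j) v \<in> carrier F" using u v funpow_closed by auto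
    have "(f ^^ j) (u \<otimes>\<^bsub>F\<^esub> v) = (f ^^ j) u \<otimes>\<^bsub>F\<^esub> (f ^^ j) v"
      using hom_mult[OF funpow_hom u v] .
    then show ?thesis using x' c by (simp add: a_ap W.m_assoc)
  qed
  have a_one: "a \<one>\<^bsub>F\<^esub> x = x" if "x \<in> S" for x
  proof -
    interpret p: group_hom F F "f ^^ j" for j using funpow_hom by unfold_locales
    show ?thesis using that p.hom_one by (auto simp: S_def a_ap)
  qed
  have aB: "a w \<in> carrier B" if w: "w \<in> carrier F" for w
    unfolding Bc
  proof
    show "bij_betw (a w) S S"
      by (rule bij_betw_byWitness[where f' = "a (inv\<^bsub>F\<^esub> w)"])
         (use w aS in \<open>auto simp: a_mult[symmetric] a_one\<close>)
  qed (simp add: a_def)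
  have a_hom: "a \<in> hom F B"
  proof (rule homI)
    fix u v assume uv: "u \<in> carrier F" "v \<in> carrier F"
    have "a (u \<otimes>\<^bsub>F\<^esub> v) = compose S (a u) (a v)"
    proof (rule extensionalityI[of _ S])
      show "a (u \<otimes>\<^bsub>F\<^esub> v) \<in> extensional S" by (simp add: a_def)
    qed (use uv a_mult in \<open>auto simp: compose_def\<close>)
    then show "a (u \<otimes>\<^bsub>F\<^esub> v) = a u \<otimes>\<^bsub>B\<^esub> a v" using Bm[OF aB aB] uv by simp
  qed (rule aB)
  define s where "s = (\<lambda>(e, j) \<in> S. (e, Suc j mod m))"
  have s_ap: "s (e, j) = (e, Suc j mod m)" if "e \<in> carrier W" "j < m" for e j
    using that by (simp add: s_def S_def)
  have sS: "s x \<in> S" if "x \<in> S" for x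
    using that m(1) by (auto simp: s_def S_def)
  have sB: "s \<in> carrier B"
    unfolding Bc
  proof
    have "inj_on s S"
    proof (rule inj_onI)
      fix x y assume "x \<in> S" "y \<in> S" and eq: "s x = s y"
      then obtain e i e' j where xy: "x = (e, i)" "y = (e', j)" "e \<in> carrier W" "e' \<in> carrier W" "i < m" "j < m"
        by (auto simp: S_def)
      have ee: "e = e'" and "Suc i mod m = Suc j mod m"
        using eq xy by (simp_all add: s_ap)
      then have "i = j"
        using xy(5,6) by (metis Suc_lessI mod_less mod_self nat.inject nat.simps(3))
      then show "x = y" using xy ee by simp
    qed
    moreover have "finite S" using W(2) by (simp add: S_def)
    ultimately show "bij_betw s S S" using sS
      by (simp add: bij_betw_def endo_inj_surj image_subsetI)
  qed (simp add: s_def)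
  have eq: "compose S (a w) s = compose S s (a (f w))" if w: "w \<in> carrier F" for w
  proof (rule extensionalityI[of _ S])
    fix x assume x: "x \<in> S"
    then obtain e j where x': "x = (e, j)" "e \<in> carrier W" "j < m" by (auto simp: S_def)
    \<comment> \<open>The relation is immediate except on the last fibre j = m - 1, where the shift
      returns to fibre 0 and f^m appears; here periodicity of g is used.\<close>
    have "g ((f ^^ (Suc j mod m)) w) = g ((f ^^ j) (f w))"
    proof (cases "Suc j = m")
      case True
      then have "(f ^^ j) (f w) = (f ^^ m) w" by (metis comp_apply funpow_Suc_right)
      then show ?thesis using m(2)[OF w] True by simp
    next
      case False
      then show ?thesis using x'(3) by (simp add: funpow_swap1)
    qed
    moreover have "g ((f ^^ j) (f w)) \<in> carrier W" using w funpow_closed by simp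
    moreover have "Suc j mod m < m" using m(1) by simp
    ultimately show "compose S (a w) s x = compose S s (a (f w)) x"
      using x x' by (simp add: compose_def s_ap a_ap)
  qed (auto simp: compose_def)
  have "inv\<^bsub>B\<^esub> s \<otimes>\<^bsub>B\<^esub> a w \<otimes>\<^bsub>B\<^esub> s = a (f w)" if "w \<in> carrier F" for w
  proof -
    have c: "a w \<in> carrier B" "a (f w) \<in> carrier B" using aB that by simp_all
    have "a w \<otimes>\<^bsub>B\<^esub> s = s \<otimes>\<^bsub>B\<^esub> a (f w)"
      using eq[OF that] Bm[OF c(1) sB] Bm[OF sB c(2)] by simp
    then have "inv\<^bsub>B\<^esub> s \<otimes>\<^bsub>B\<^esub> a w \<otimes>\<^bsub>B\<^esub> s = inv\<^bsub>B\<^esub> s \<otimes>\<^bsub>B\<^esub> s \<otimes>\<^bsub>B\<^esub> a (f w)"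
      using c sB by (simp only: B.m_assoc B.inv_closed)
    then show ?thesis using c sB by simp
  qed
  then obtain h where h: "h \<in> hom \<Gamma> B" "\<And>w. w \<in> carrier F \<Longrightarrow> h (\<iota> w) = a w"
    using hom_from_Gamma[OF B.is_group a_hom sB] free_gen_closed by metis
  have "finite (carrier B)" unfolding B_def by (rule finite_Bij) (use W(2) in \<open>simp add: S_def\<close>)
  moreover have "h ` carrier \<Gamma> \<subseteq> carrier B" using h(1) by (auto simp: hom_def)
  ultimately have "kernel \<Gamma> B h \<in> FIN"
    using \<Gamma>.kernel_FIN[OF B.is_group h(1)] finite_subset by blast
  moreover have "g w = \<one>\<^bsub>W\<^esub>" if w: "w \<in> carrier F" "\<iota> w \<in> kernel \<Gamma> B h" for w
  proof -
    have "a w = \<one>\<^bsub>B\<^esub>" using w h(2) by (simp add: kernel_def)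
    \<comment> \<open>The action on the identity in fibre 0 reads off g w.\<close>
    then have "a w (\<one>\<^bsub>W\<^esub>, 0) = (\<one>\<^bsub>W\<^esub>, 0)"
      using m(1) by (simp add: B_def BijGroup_def S_def)
    then show ?thesis using w(1) m(1) by (simp add: a_ap)
  qed
  ultimately show ?thesis using that by blast
qed


section \<open>The closure of the base group\<close>

abbreviation "P \<equiv> hnn_base_closure n f"
abbreviation "PC \<equiv> profinite_completion \<Gamma>"
abbreviation "PT \<equiv> profinite_completion_topology \<Gamma>"
abbreviation "G\<^sub>P \<equiv> PC\<lparr>carrier := P\<rparr>"
abbreviation "T\<^sub>P \<equiv> subtopology PT P"
abbreviation "\<eta> w \<equiv> profinite_completion_map \<Gamma> (\<iota> w)"

sublocale PC: group PC by (rule \<Gamma>.group_completion)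
sublocale PT: leveled_space PT FIN "\<lambda>N x. x N" by (rule \<Gamma>.leveled_completion)

text \<open>The level classes form a base of the topology, so adherence to the image of F can be
  tested one finite quotient at a time.\<close>

lemma base_closure_iff:
  "x \<in> P \<longleftrightarrow> x \<in> carrier PC \<and> (\<forall>N \<in> FIN. \<exists>w \<in> carrier F. x N = N #>\<^bsub>\<Gamma>\<^esub> \<iota> w)"
proof (intro iffI conjI ballI)
  assume x: "x \<in> P"
  then show xc: "x \<in> carrier PC"
    by (simp add: hnn_base_closure_def in_closure_of \<Gamma>.topspace_completion)
  fix N assume N: "N \<in> FIN"
  have xt: "x \<in> topspace PT" using xc by (simp add: \<Gamma>.topspace_completion)
  have "\<exists>y. y \<in> (\<lambda>w. \<eta> w) ` carrier F \<and> y \<in> V" if "x \<in> V" "openin PT V" for V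
    using x that unfolding hnn_base_closure_def in_closure_of by simp
  from this[OF _ PT.level_open[OF N xt]]
  obtain y where "y \<in> (\<lambda>w. \<eta> w) ` carrier F" "y \<in> {y \<in> topspace PT. y N = x N}"
    using xt by auto
  then obtain w where "w \<in> carrier F" "\<eta> w N = x N" by blast
  then show "\<exists>w \<in> carrier F. x N = N #>\<^bsub>\<Gamma>\<^esub> \<iota> w"
    using N by (auto simp: \<Gamma>.completion_map_level)
next
  assume x: "x \<in> carrier PC \<and> (\<forall>N \<in> FIN. \<exists>w \<in> carrier F. x N = N #>\<^bsub>\<Gamma>\<^esub> \<iota> w)"
  show "x \<in> P"
    unfolding hnn_base_closure_def in_closure_of
  proof (intro conjI allI impI)
    show "x \<in> topspace PT" using x by (simp add: \<Gamma>.topspace_completion)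
    fix V assume "x \<in> V \<and> openin PT V"
    then obtain N where N: "N \<in> FIN" "\<forall>y \<in> topspace PT. y N = x N \<longrightarrow> y \<in> V"
      using PT.level_base by blast
    then obtain w where w: "w \<in> carrier F" "x N = N #>\<^bsub>\<Gamma>\<^esub> \<iota> w" using x by blast
    then have "\<eta> w \<in> V"
      using N \<Gamma>.completion_map_closed[of "\<iota> w"] by (simp add: \<Gamma>.topspace_completion \<Gamma>.completion_map_level)
    then show "\<exists>y. y \<in> (\<lambda>w. \<eta> w) ` carrier F \<and> y \<in> V" using w(1) by blast
  qed
qed

lemma base_closure_closed: "closedin PT P"
  by (simp add: hnn_base_closure_def)

lemma base_closure_subset: "P \<subseteq> carrier PC"
  using base_closure_iff by blast

lemma topspace_base_closure: "topspace T\<^sub>P = P"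
  using base_closure_subset by (auto simp: \<Gamma>.topspace_completion)

lemma base_map_in_closure: "w \<in> carrier F \<Longrightarrow> \<eta> w \<in> P"
  unfolding base_closure_iff by (auto simp: \<Gamma>.completion_map_level intro!: \<Gamma>.completion_map_closed)

lemma base_closure_rep:
  assumes "x \<in> P" "N \<in> FIN"
  obtains w where "w \<in> carrier F" "x N = N #>\<^bsub>\<Gamma>\<^esub> \<iota> w"
  using assms base_closure_iff by blast

lemma quotient_FIN_hom: "N \<in> FIN \<Longrightarrow> (\<lambda>\<gamma>. N #>\<^bsub>\<Gamma>\<^esub> \<gamma>) \<in> hom \<Gamma> (\<Gamma> Mod N)"
  using normal.r_coset_hom_Mod \<Gamma>.FIN_normal by blast

text \<open>Conjugation by \<tau>^a in this direction would be f^(-a), which makes sense only for -a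
  natural. Modulo N the exponent -a may be replaced by its residue k modulo the order of the
  quotient, and f^k w is the required word.\<close>

lemma conj_in_base_image:
  assumes N: "N \<in> FIN" and w: "w \<in> carrier F"
  shows "\<exists>v \<in> carrier F. N #>\<^bsub>\<Gamma>\<^esub> (\<tau> [^]\<^bsub>\<Gamma>\<^esub> (a::int) \<otimes>\<^bsub>\<Gamma>\<^esub> \<iota> w \<otimes>\<^bsub>\<Gamma>\<^esub> inv\<^bsub>\<Gamma>\<^esub> (\<tau> [^]\<^bsub>\<Gamma>\<^esub> a)) = N #>\<^bsub>\<Gamma>\<^esub> \<iota> v"
proof -
  let ?Q = "\<Gamma> Mod N"
  define h where "h = (\<lambda>\<gamma>. N #>\<^bsub>\<Gamma>\<^esub> \<gamma>)"
  interpret Q: group ?Q by (rule \<Gamma>.group_FIN_quotient[OF N])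
  have h: "h \<in> hom \<Gamma> ?Q" unfolding h_def by (rule quotient_FIN_hom[OF N])
  interpret h: group_hom \<Gamma> ?Q h using h by unfold_locales
  have ord: "order ?Q > 0" using \<Gamma>.finite_FIN_quotient[OF N] Q.order_gt_0_iff_finite by simp
  define k where "k = nat ((- a) mod int (order ?Q))"
  have "int k = - a + int (order ?Q) * (- ((- a) div int (order ?Q)))"
  proof -
    have "int k = (- a) mod int (order ?Q)" using ord by (simp add: k_def)
    then show ?thesis using mult_div_mod_eq[of "int (order ?Q)" "- a"] by linarith
  qed
  moreover have "h \<tau> [^]\<^bsub>?Q\<^esub> (int (order ?Q) * z) = \<one>\<^bsub>?Q\<^esub>" for z :: int
    using Q.int_pow_pow[of "h \<tau>" "int (order ?Q)" z] Q.pow_order_eq_1[of "h \<tau>"]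
    by (simp add: int_pow_int Q.int_pow_one)
  ultimately have "h \<tau> [^]\<^bsub>?Q\<^esub> int k = h \<tau> [^]\<^bsub>?Q\<^esub> (- a) \<otimes>\<^bsub>?Q\<^esub> \<one>\<^bsub>?Q\<^esub>"
    using Q.int_pow_mult[of "h \<tau>" "- a"] by (metis h.hom_closed stable_closed)
  then have "h \<tau> [^]\<^bsub>?Q\<^esub> int k = h \<tau> [^]\<^bsub>?Q\<^esub> (- a)" by simp
  then have k: "h \<tau> [^]\<^bsub>?Q\<^esub> k = inv\<^bsub>?Q\<^esub> (h \<tau> [^]\<^bsub>?Q\<^esub> a)"
    by (simp add: int_pow_int Q.int_pow_neg)
  have "h (\<tau> [^]\<^bsub>\<Gamma>\<^esub> a \<otimes>\<^bsub>\<Gamma>\<^esub> \<iota> w \<otimes>\<^bsub>\<Gamma>\<^esub> inv\<^bsub>\<Gamma>\<^esub> (\<tau> [^]\<^bsub>\<Gamma>\<^esub> a)) = h \<tau> [^]\<^bsub>?Q\<^esub> a \<otimes>\<^bsub>?Q\<^esub> h (\<iota> w) \<otimes>\<^bsub>?Q\<^esub> inv\<^bsub>?Q\<^esub> (h \<tau> [^]\<^bsub>?Q\<^esub> a)"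
    using w by (simp add: h.hom_int_pow)
  also have "\<dots> = h (\<iota> ((f ^^ k) w))"
    unfolding conj_power[OF Q.is_group h w, symmetric] k by simp
  finally show ?thesis using funpow_closed[OF w] by (auto simp: h_def)
qed

section \<open>The retraction onto \<int> and the semidirect decomposition\<close>

abbreviation "\<Z> \<equiv> integer_group"

text \<open>\<open>hom_from_Gamma\<close> gives existence, hence the choice. On \<Gamma> the three
  properties determine the map: it counts the exponent of t.\<close>

definition retr :: "nat option word set \<Rightarrow> int" where
  "retr = (SOME h. h \<in> hom \<Gamma> \<Z> \<and> (\<forall>w \<in> carrier F. h (\<iota> w) = 0) \<and> h \<tau> = 1)"

lemma retr: "retr \<in> hom \<Gamma> \<Z>" "w \<in> carrier F \<Longrightarrow> retr (\<iota> w) = 0" "retr \<tau> = 1"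
proof -
  have "\<exists>h. h \<in> hom \<Gamma> \<Z> \<and> (\<forall>w \<in> carrier F. h (\<iota> w) = 0) \<and> h \<tau> = 1"
    by (rule hom_from_Gamma[OF group_integer_group, of "\<lambda>_. 0" 1]) (auto simp: hom_def)
  from someI_ex[OF this] show "retr \<in> hom \<Gamma> \<Z>" "w \<in> carrier F \<Longrightarrow> retr (\<iota> w) = 0" "retr \<tau> = 1"
    unfolding retr_def[symmetric] by auto
qed

sublocale Z: group \<Z> by (rule group_integer_group)
sublocale retr: group_hom \<Gamma> \<Z> retr using retr(1) by unfold_locales

lemma retr_power: "retr (\<tau> [^]\<^bsub>\<Gamma>\<^esub> (k::int)) = k"
  using retr.hom_int_pow[of \<tau> k] retr(3) by simp

text \<open>In \<Gamma> itself an element need not have the form w t^k. Modulo N a power of t can be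
  moved past a base word by \<open>conj_in_base_image\<close>, so the elements of this form make up
  a subgroup containing the generators. The exponent is tied to \<open>retr \<gamma>\<close>, for
  otherwise the kernel of the retraction could not be read off.\<close>

lemma mod_normal_form:
  assumes N: "N \<in> FIN" and \<gamma>: "\<gamma> \<in> carrier \<Gamma>"
  shows "\<exists>w \<in> carrier F. N #>\<^bsub>\<Gamma>\<^esub> \<gamma> = N #>\<^bsub>\<Gamma>\<^esub> (\<iota> w \<otimes>\<^bsub>\<Gamma>\<^esub> \<tau> [^]\<^bsub>\<Gamma>\<^esub> retr \<gamma>)"
proof -
  let ?Q = "\<Gamma> Mod N"
  define h where "h = (\<lambda>\<gamma>. N #>\<^bsub>\<Gamma>\<^esub> \<gamma>)"
  interpret Q: group ?Q by (rule \<Gamma>.group_FIN_quotient[OF N])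
  have h: "h \<in> hom \<Gamma> ?Q" unfolding h_def by (rule quotient_FIN_hom[OF N])
  interpret h: group_hom \<Gamma> ?Q h using h by unfold_locales
  define c where "c = h \<tau>"
  have c: "c \<in> carrier ?Q" by (simp add: c_def)
  have hp: "h (\<tau> [^]\<^bsub>\<Gamma>\<^esub> (a::int)) = c [^]\<^bsub>?Q\<^esub> a" for a by (simp add: c_def h.hom_int_pow)
  have conj: "\<exists>v \<in> carrier F. c [^]\<^bsub>?Q\<^esub> (a::int) \<otimes>\<^bsub>?Q\<^esub> h (\<iota> w) = h (\<iota> v) \<otimes>\<^bsub>?Q\<^esub> c [^]\<^bsub>?Q\<^esub> a"
    if w: "w \<in> carrier F" for a w
  proof -
    obtain v where v: "v \<in> carrier F" "h (\<tau> [^]\<^bsub>\<Gamma>\<^esub> a \<otimes>\<^bsub>\<Gamma>\<^esub> \<iota> w \<otimes>\<^bsub>\<Gamma>\<^esub> inv\<^bsub>\<Gamma>\<^esub> (\<tau> [^]\<^bsub>\<Gamma>\<^esub> a)) = h (\<iota> v)"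
      using conj_in_base_image[OF N w] unfolding h_def by blast
    have "c [^]\<^bsub>?Q\<^esub> a \<otimes>\<^bsub>?Q\<^esub> h (\<iota> w) \<otimes>\<^bsub>?Q\<^esub> inv\<^bsub>?Q\<^esub> (c [^]\<^bsub>?Q\<^esub> a) = h (\<iota> v)"
      using v(2) w by (simp add: hp)
    then have "h (\<iota> v) \<otimes>\<^bsub>?Q\<^esub> c [^]\<^bsub>?Q\<^esub> a = c [^]\<^bsub>?Q\<^esub> a \<otimes>\<^bsub>?Q\<^esub> h (\<iota> w) \<otimes>\<^bsub>?Q\<^esub> inv\<^bsub>?Q\<^esub> (c [^]\<^bsub>?Q\<^esub> a) \<otimes>\<^bsub>?Q\<^esub> c [^]\<^bsub>?Q\<^esub> a"
      by simp
    also have "\<dots> = c [^]\<^bsub>?Q\<^esub> a \<otimes>\<^bsub>?Q\<^esub> h (\<iota> w)"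
      using c w by (simp add: Q.m_assoc)
    finally show ?thesis using v(1) by metis
  qed
  define S where "S = {\<gamma> \<in> carrier \<Gamma>. \<exists>w \<in> carrier F. h \<gamma> = h (\<iota> w) \<otimes>\<^bsub>?Q\<^esub> c [^]\<^bsub>?Q\<^esub> retr \<gamma>}"
  have "subgroup S \<Gamma>"
  proof (rule \<Gamma>.subgroupI)
    have "\<one>\<^bsub>\<Gamma>\<^esub> \<in> S" unfolding S_def by (auto intro!: bexI[of _ "\<one>\<^bsub>F\<^esub>"])
    then show "S \<noteq> {}" by blast
  next
    fix a assume "a \<in> S"
    then obtain w where w: "a \<in> carrier \<Gamma>" "w \<in> carrier F" "h a = h (\<iota> w) \<otimes>\<^bsub>?Q\<^esub> c [^]\<^bsub>?Q\<^esub> retr a" by (auto simp: S_def)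
    obtain v where v: "v \<in> carrier F"
        "c [^]\<^bsub>?Q\<^esub> (- retr a) \<otimes>\<^bsub>?Q\<^esub> h (\<iota> (inv\<^bsub>F\<^esub> w)) = h (\<iota> v) \<otimes>\<^bsub>?Q\<^esub> c [^]\<^bsub>?Q\<^esub> (- retr a)"
      using conj[of "inv\<^bsub>F\<^esub> w" "- retr a"] w(2) by auto
    have "h (inv\<^bsub>\<Gamma>\<^esub> a) = c [^]\<^bsub>?Q\<^esub> (- retr a) \<otimes>\<^bsub>?Q\<^esub> h (\<iota> (inv\<^bsub>F\<^esub> w))"
      using w c by (simp add: Q.inv_mult_group Q.int_pow_neg)
    then show "inv\<^bsub>\<Gamma>\<^esub> a \<in> S" using v w(1) by (auto simp: S_def)
  next
    fix a b assume "a \<in> S" "b \<in> S"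
    then obtain u w where w: "a \<in> carrier \<Gamma>" "w \<in> carrier F" "h a = h (\<iota> w) \<otimes>\<^bsub>?Q\<^esub> c [^]\<^bsub>?Q\<^esub> retr a"
      and u: "b \<in> carrier \<Gamma>" "u \<in> carrier F" "h b = h (\<iota> u) \<otimes>\<^bsub>?Q\<^esub> c [^]\<^bsub>?Q\<^esub> retr b" by (auto simp: S_def)
    obtain v where v: "v \<in> carrier F"
        "c [^]\<^bsub>?Q\<^esub> retr a \<otimes>\<^bsub>?Q\<^esub> h (\<iota> u) = h (\<iota> v) \<otimes>\<^bsub>?Q\<^esub> c [^]\<^bsub>?Q\<^esub> retr a"
      using conj[of u "retr a"] u(2) by auto
    have "h (a \<otimes>\<^bsub>\<Gamma>\<^esub> b) = h (\<iota> w) \<otimes>\<^bsub>?Q\<^esub> (c [^]\<^bsub>?Q\<^esub> retr a \<otimes>\<^bsub>?Q\<^esub> h (\<iota> u)) \<otimes>\<^bsub>?Q\<^esub> c [^]\<^bsub>?Q\<^esub> retr b"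
      using w u c by (simp add: Q.m_assoc)
    also have "\<dots> = h (\<iota> (w \<otimes>\<^bsub>F\<^esub> v)) \<otimes>\<^bsub>?Q\<^esub> c [^]\<^bsub>?Q\<^esub> (retr a + retr b)"
      unfolding v(2) using w u v(1) c by (simp add: Q.m_assoc Q.int_pow_mult)
    finally show "a \<otimes>\<^bsub>\<Gamma>\<^esub> b \<in> S"
      using w u v(1) by (auto simp: S_def intro!: bexI[of _ "w \<otimes>\<^bsub>F\<^esub> v"])
  qed (auto simp: S_def)
  moreover have "\<tau> \<in> S"
    using c retr(3) by (auto simp: S_def c_def intro!: bexI[of _ "\<one>\<^bsub>F\<^esub>"])
  moreover have "\<iota> (free_gen i) \<in> S" if "i \<in> {1..n}" for i
    using c retr(2) free_gen_closed[OF that] by (auto simp: S_def intro!: bexI[of _ "free_gen i"])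
  ultimately have "\<gamma> \<in> S" using subgroup_eq_Gamma \<gamma> by blast
  then obtain w where w: "w \<in> carrier F" "h \<gamma> = h (\<iota> w) \<otimes>\<^bsub>?Q\<^esub> c [^]\<^bsub>?Q\<^esub> retr \<gamma>" by (auto simp: S_def)
  then have "h \<gamma> = h (\<iota> w \<otimes>\<^bsub>\<Gamma>\<^esub> \<tau> [^]\<^bsub>\<Gamma>\<^esub> retr \<gamma>)"
    using w(1) by (simp add: hp)
  then show ?thesis using w(1) unfolding h_def by blast
qed

abbreviation "ZC \<equiv> profinite_completion \<Z>"
abbreviation "ZT \<equiv> profinite_completion_topology \<Z>"
abbreviation "rhat \<equiv> completion_hom \<Gamma> \<Z> retr"
abbreviation "shat \<equiv> completion_hom \<Z> \<Gamma> (\<lambda>k. \<tau> [^]\<^bsub>\<Gamma>\<^esub> (k::int))"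

sublocale ZC: group ZC by (rule Z.group_completion)

lemma power_hom: "(\<lambda>k. \<tau> [^]\<^bsub>\<Gamma>\<^esub> (k::int)) \<in> hom \<Z> \<Gamma>"
  by (rule \<Gamma>.hom_integer_group_pow) simp

lemma r_hom: "rhat \<in> hom PC ZC"
  by (rule completion_hom_hom[OF \<Gamma>.is_group Z.is_group retr(1)])

lemma s_hom: "shat \<in> hom ZC PC"
  by (rule completion_hom_hom[OF Z.is_group \<Gamma>.is_group power_hom])

sublocale rhat: group_hom PC ZC rhat using r_hom by unfold_locales
sublocale shat: group_hom ZC PC shat using s_hom by unfold_locales

lemma r_s:
  assumes z: "z \<in> carrier ZC"
  shows "rhat (shat z) = z"
proof (rule Z.completion_eqI)
  fix M assume M: "M \<in> finite_index_normal \<Z>"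
  let ?K = "{\<gamma> \<in> carrier \<Gamma>. retr \<gamma> \<in> M}"
  have K: "?K \<in> FIN" by (rule \<Gamma>.vimage_FIN[OF Z.is_group retr(1) M])
  obtain k where k: "k \<in> carrier \<Z>" "z M = M #>\<^bsub>\<Z>\<^esub> k" by (rule Z.completion_rep[OF z M])
  have sub: "M \<subseteq> {k \<in> carrier \<Z>. \<tau> [^]\<^bsub>\<Gamma>\<^esub> k \<in> ?K}" by (auto simp: retr_power)
  have sz: "shat z ?K = ?K #>\<^bsub>\<Gamma>\<^esub> (\<tau> [^]\<^bsub>\<Gamma>\<^esub> k)"
    by (rule completion_hom_level[OF Z.is_group \<Gamma>.is_group power_hom z K M sub k])
  have "rhat (shat z) M = M #>\<^bsub>\<Z>\<^esub> retr (\<tau> [^]\<^bsub>\<Gamma>\<^esub> k)"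
    by (rule completion_hom_level[OF \<Gamma>.is_group Z.is_group retr(1) shat.hom_closed[OF z] M K order_refl _ sz]) simp
  then show "rhat (shat z) M = z M" using k(2) by (simp add: retr_power)
qed (use z in auto)

text \<open>This is how P is seen to be normal. In the harder inclusion a level N is refined so that
  the retraction detects whether a power of t lies in N; for x in the kernel the factor t^k of the
  normal form then disappears modulo N and a base word remains.\<close>

lemma base_closure_eq_kernel: "P = kernel PC ZC rhat"
proof (intro equalityI subsetI)
  fix x assume x: "x \<in> P"
  then have xc: "x \<in> carrier PC" using base_closure_subset by blast
  have "rhat x = \<one>\<^bsub>ZC\<^esub>"
  proof (rule Z.completion_eqI)
    fix M assume M: "M \<in> finite_index_normal \<Z>"
    let ?K = "{\<gamma> \<in> carrier \<Gamma>. retr \<gamma> \<in> M}"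
    have K: "?K \<in> FIN" by (rule \<Gamma>.vimage_FIN[OF Z.is_group retr(1) M])
    obtain w where w: "w \<in> carrier F" "x ?K = ?K #>\<^bsub>\<Gamma>\<^esub> \<iota> w" by (rule base_closure_rep[OF x K])
    have "rhat x M = M #>\<^bsub>\<Z>\<^esub> retr (\<iota> w)"
      using w by (intro completion_hom_level[OF \<Gamma>.is_group Z.is_group retr(1) xc M K order_refl]) auto
    then show "rhat x M = \<one>\<^bsub>ZC\<^esub> M"
      using retr(2)[OF w(1)] Z.coset_mult_one[of M] by (simp add: Z.completion_one[OF M])
  qed (use xc in auto)
  then show "x \<in> kernel PC ZC rhat" using xc by (simp add: kernel_def)
next
  fix x assume "x \<in> kernel PC ZC rhat"
  then have xc: "x \<in> carrier PC" and rx: "rhat x = \<one>\<^bsub>ZC\<^esub>" by (auto simp: kernel_def)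
  have "\<exists>w \<in> carrier F. x N = N #>\<^bsub>\<Gamma>\<^esub> \<iota> w" if N: "N \<in> FIN" for N
  proof -
    \<comment> \<open>The exponents of t that die modulo N. Representing x below both N and the
      preimage of this subgroup makes one \<gamma> serve for \<open>rhat x\<close> and for
      \<open>x N\<close>.\<close>
    let ?M = "{k \<in> carrier \<Z>. \<tau> [^]\<^bsub>\<Gamma>\<^esub> k \<in> N}"
    have M: "?M \<in> finite_index_normal \<Z>" by (rule Z.vimage_FIN[OF \<Gamma>.is_group power_hom N])
    let ?K = "{\<gamma> \<in> carrier \<Gamma>. retr \<gamma> \<in> ?M}"
    have K: "?K \<in> FIN" by (rule \<Gamma>.vimage_FIN[OF Z.is_group retr(1) M])
    have NK: "N \<inter> ?K \<in> FIN" by (rule \<Gamma>.FIN_Int[OF N K])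
    obtain \<gamma> where \<gamma>: "\<gamma> \<in> carrier \<Gamma>" "x (N \<inter> ?K) = (N \<inter> ?K) #>\<^bsub>\<Gamma>\<^esub> \<gamma>" by (rule \<Gamma>.completion_rep[OF xc NK])
    have "rhat x ?M = ?M #>\<^bsub>\<Z>\<^esub> retr \<gamma>"
      by (rule completion_hom_level[OF \<Gamma>.is_group Z.is_group retr(1) xc M NK _ \<gamma>]) blast
    then have "?M #>\<^bsub>\<Z>\<^esub> retr \<gamma> = ?M" using rx Z.completion_one[OF M] by simp
    then have "retr \<gamma> \<in> ?M" using Z.rcos_eq_self_iff[OF Z.FIN_subgroup[OF M]] by simp
    then have tN: "\<tau> [^]\<^bsub>\<Gamma>\<^esub> retr \<gamma> \<in> N" by simp
    have xN: "x N = N #>\<^bsub>\<Gamma>\<^esub> \<gamma>" by (rule \<Gamma>.completion_rep_mono[OF xc NK N _ \<gamma>]) blast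
    obtain w where w: "w \<in> carrier F" "N #>\<^bsub>\<Gamma>\<^esub> \<gamma> = N #>\<^bsub>\<Gamma>\<^esub> (\<iota> w \<otimes>\<^bsub>\<Gamma>\<^esub> \<tau> [^]\<^bsub>\<Gamma>\<^esub> retr \<gamma>)"
      using mod_normal_form[OF N \<gamma>(1)] by blast
    have "N #>\<^bsub>\<Gamma>\<^esub> (\<iota> w \<otimes>\<^bsub>\<Gamma>\<^esub> \<tau> [^]\<^bsub>\<Gamma>\<^esub> retr \<gamma>) = (N #>\<^bsub>\<Gamma>\<^esub> \<iota> w) <#>\<^bsub>\<Gamma>\<^esub> (N #>\<^bsub>\<Gamma>\<^esub> \<tau> [^]\<^bsub>\<Gamma>\<^esub> retr \<gamma>)"
      using w(1) by (simp add: \<Gamma>.rcos_mult[OF N])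
    also have "N #>\<^bsub>\<Gamma>\<^esub> \<tau> [^]\<^bsub>\<Gamma>\<^esub> retr \<gamma> = N #>\<^bsub>\<Gamma>\<^esub> \<one>\<^bsub>\<Gamma>\<^esub>"
      using tN \<Gamma>.rcos_eq_self_iff[OF \<Gamma>.FIN_subgroup[OF N]] \<Gamma>.coset_mult_one[of N] subgroup.subset[OF \<Gamma>.FIN_subgroup[OF N]] by simp
    also have "(N #>\<^bsub>\<Gamma>\<^esub> \<iota> w) <#>\<^bsub>\<Gamma>\<^esub> (N #>\<^bsub>\<Gamma>\<^esub> \<one>\<^bsub>\<Gamma>\<^esub>) = N #>\<^bsub>\<Gamma>\<^esub> \<iota> w"
      using w(1) by (simp add: \<Gamma>.rcos_mult[OF N])
    finally show ?thesis using w xN by auto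
  qed
  then show "x \<in> P" using xc base_closure_iff by blast
qed

lemma base_closure_normal: "P \<lhd> PC"
  unfolding base_closure_eq_kernel by (rule rhat.normal_kernel)

text \<open>The complement is the image of \<open>shat\<close>, closed as a compact set in a
  Hausdorff space. Since \<open>rhat\<close> is a left inverse of \<open>shat\<close>, it meets the
  kernel P trivially, x is \<open>shat (rhat x)\<close> up to a left factor in P, and
  \<open>rhat\<close> is the isomorphism from the complement to the completion of \<int>.\<close>

theorem base_closure_semidirect: "profinite_semidirect PC PT P ZC ZT"
proof -
  let ?C = "shat ` carrier ZC"
  have C: "subgroup ?C PC" by (rule shat.img_is_subgroup)
  have cs: "continuous_map ZT PT shat"
    by (rule continuous_completion_hom[OF Z.is_group \<Gamma>.is_group power_hom])
  have cr: "continuous_map PT ZT rhat"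
    by (rule continuous_completion_hom[OF \<Gamma>.is_group Z.is_group retr(1)])
  have "compactin PT ?C"
    using image_compactin[OF _ cs, of "carrier ZC"] Z.compact_space_completion
    by (simp add: compact_space_def Z.topspace_completion)
  then have Cc: "closedin PT ?C"
    by (rule compactin_imp_closedin[OF \<Gamma>.Hausdorff_space_completion])
  have "P \<inter> ?C = {\<one>\<^bsub>PC\<^esub>}"
  proof -
    have "x = \<one>\<^bsub>PC\<^esub>" if "x \<in> P" "z \<in> carrier ZC" "x = shat z" for x z
    proof -
      have "rhat x = \<one>\<^bsub>ZC\<^esub>" using that(1) by (simp add: base_closure_eq_kernel kernel_def)
      then show ?thesis using that r_s by simp
    qed
    moreover have "\<one>\<^bsub>PC\<^esub> \<in> P" "\<one>\<^bsub>PC\<^esub> \<in> ?C"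
      using subgroup.one_closed[OF C] subgroup.one_closed[OF normal_imp_subgroup[OF base_closure_normal]] by auto
    ultimately show ?thesis by blast
  qed
  moreover have "P <#>\<^bsub>PC\<^esub> ?C = carrier PC"
  proof
    show "P <#>\<^bsub>PC\<^esub> ?C \<subseteq> carrier PC"
      using base_closure_subset by (intro PC.setmult_subset_G) auto
    show "carrier PC \<subseteq> P <#>\<^bsub>PC\<^esub> ?C"
    proof
      fix x assume x: "x \<in> carrier PC"
      let ?y = "x \<otimes>\<^bsub>PC\<^esub> inv\<^bsub>PC\<^esub> shat (rhat x)"
      have "?y \<in> P" using x by (simp add: base_closure_eq_kernel kernel_def r_s)
      moreover have "x = ?y \<otimes>\<^bsub>PC\<^esub> shat (rhat x)" using x by (simp add: PC.m_assoc)
      moreover have "shat (rhat x) \<in> ?C" using x by simp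
      ultimately show "x \<in> P <#>\<^bsub>PC\<^esub> ?C" unfolding set_mult_def by blast
    qed
  qed
  moreover have "topologically_isomorphic (PC\<lparr>carrier := ?C\<rparr>) (subtopology PT ?C) ZC ZT"
    unfolding topologically_isomorphic_def
  proof (rule bexI[of _ rhat])
    have "homeomorphic_maps (subtopology PT ?C) ZT rhat shat"
      unfolding homeomorphic_maps_def
      using continuous_map_from_subtopology[OF cr] cs r_s
      by (auto simp: continuous_map_in_subtopology Z.topspace_completion)
    then show "homeomorphic_map (subtopology PT ?C) ZT rhat"
      unfolding homeomorphic_map_maps by blast
    have "bij_betw rhat ?C (carrier ZC)"
      by (rule bij_betw_byWitness[where f' = shat]) (auto simp: r_s)
    moreover have "rhat \<in> hom (PC\<lparr>carrier := ?C\<rparr>) ZC"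
      using subgroup.subset[OF C] by (auto simp: hom_def)
    ultimately show "rhat \<in> iso (PC\<lparr>carrier := ?C\<rparr>) ZC" by (simp add: iso_def)
  qed
  ultimately show ?thesis
    unfolding profinite_semidirect_def
    using \<Gamma>.profinite_group_completion base_closure_normal base_closure_closed C Cc by blast
qed

lemma profinite_group_base_closure: "profinite_group G\<^sub>P T\<^sub>P"
  by (rule profinite_group_closed_subgroup[OF \<Gamma>.profinite_group_completion
        normal_imp_subgroup[OF base_closure_normal] base_closure_closed])

sublocale TP: leveled_space T\<^sub>P FIN "\<lambda>N x. x N"
  using base_closure_subset by (intro PT.leveled_subspace) (simp add: \<Gamma>.topspace_completion)

end

section \<open>Homomorphisms into profinite groups\<close>

lemma topological_group_mult:
  assumes "topological_group G T" "continuous_map Z T p" "continuous_map Z T q"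
  shows "continuous_map Z T (\<lambda>z. p z \<otimes>\<^bsub>G\<^esub> q z)"
proof -
  have "continuous_map Z (prod_topology T T) (\<lambda>z. (p z, q z))"
    using assms(2,3) by (simp add: continuous_map_pairwise comp_def)
  moreover have "continuous_map (prod_topology T T) T (\<lambda>(x, y). x \<otimes>\<^bsub>G\<^esub> y)"
    using assms(1) by (simp add: topological_group_def)
  ultimately have "continuous_map Z T ((\<lambda>(x, y). x \<otimes>\<^bsub>G\<^esub> y) \<circ> (\<lambda>z. (p z, q z)))"
    by (rule continuous_map_compose)
  then show ?thesis by (simp add: comp_def)
qed

lemma topological_group_inv:
  assumes "topological_group G T" "continuous_map Z T p"
  shows "continuous_map Z T (\<lambda>z. inv\<^bsub>G\<^esub> p z)"
proof -
  have "continuous_map T T (\<lambda>x. inv\<^bsub>G\<^esub> x)"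
    using assms(1) by (simp add: topological_group_def)
  from continuous_map_compose[OF assms(2) this] show ?thesis by (simp add: comp_def)
qed

lemma openin_clopen_iff:
  assumes "continuous_map Z X p" "continuous_map Z X q" "openin X C" "closedin X C"
  shows "openin Z {z \<in> topspace Z. p z \<in> C \<longleftrightarrow> q z \<in> C}"
proof -
  define A where "A = {z \<in> topspace Z. p z \<in> C}"
  define B where "B = {z \<in> topspace Z. q z \<in> C}"
  have "openin Z A" "openin Z B" "closedin Z A" "closedin Z B"
    unfolding A_def B_def using assms
    by (auto intro: openin_continuous_map_preimage closedin_continuous_map_preimage)
  then have "openin Z ((A \<inter> B) \<union> ((topspace Z - A) \<inter> (topspace Z - B)))"
    by (intro openin_Un openin_Int) auto
  moreover have "(A \<inter> B) \<union> ((topspace Z - A) \<inter> (topspace Z - B)) = {z \<in> topspace Z. p z \<in> C \<longleftrightarrow> q z \<in> C}"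
    by (auto simp: A_def B_def)
  ultimately show ?thesis by simp
qed

text \<open>The complement is the projection of a closed set along a compact factor, and such
  projections are closed maps. It gives openness of a subgroup defined by a condition on all group
  elements.\<close>

lemma openin_all_compact:
  assumes "compact_space X" "openin (prod_topology X Y) {z \<in> topspace (prod_topology X Y). R (fst z) (snd z)}"
  shows "openin Y {y \<in> topspace Y. \<forall>x \<in> topspace X. R x y}"
proof -
  let ?W = "{z \<in> topspace (prod_topology X Y). R (fst z) (snd z)}"
  have "closedin (prod_topology X Y) (topspace (prod_topology X Y) - ?W)"
    using assms(2) by blast
  then have "closedin Y (snd ` (topspace (prod_topology X Y) - ?W))"
    using closed_map_snd[OF assms(1), of Y] unfolding closed_map_def by blast
  moreover have "{y \<in> topspace Y. \<forall>x \<in> topspace X. R x y} = topspace Y - snd ` (topspace (prod_topology X Y) - ?W)"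
    (is "?A = ?B")
  proof
    show "?A \<subseteq> ?B" by auto
    show "?B \<subseteq> ?A"
    proof
      fix y assume y: "y \<in> ?B"
      have "R x y" if "x \<in> topspace X" for x
      proof (rule ccontr)
        assume "\<not> R x y"
        then have "(x, y) \<in> topspace (prod_topology X Y) - ?W" using y that by simp
        then have "snd (x, y) \<in> snd ` (topspace (prod_topology X Y) - ?W)" by (rule imageI)
        then show False using y by simp
      qed
      then show "y \<in> ?A" using y by simp
    qed
  qed
  ultimately show ?thesis by auto
qed

text \<open>If \<open>C\<close> is a clopen neighbourhood of \<open>1\<close>, the elements \<open>g\<close> all of whose conjugates stabilise
  \<open>C\<close> under right multiplication form an open normal subgroup contained in \<open>C\<close>.\<close>

lemma profinite_open_normal_subgroup:
  assumes "profinite_group G T" "openin T V" "\<one>\<^bsub>G\<^esub> \<in> V"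
  shows "\<exists>U. U \<lhd> G \<and> openin T U \<and> U \<subseteq> V"
proof -
  have TG: "topological_group G T" and cpt: "compact_space T" and haus: "Hausdorff_space T"
    and td: "\<And>C x y. \<lbrakk>connectedin T C; x \<in> C; y \<in> C\<rbrakk> \<Longrightarrow> x = y"
    using assms(1) by (auto simp: profinite_group_def)
  have G: "group G" and ts: "topspace T = carrier G" using TG by (auto simp: topological_group_def)
  interpret G: group G by (rule G)
  \<comment> \<open>In a compact Hausdorff space, a set no connected subset of which meets two given
    closed sets can be cut by a clopen set; connected subsets are at most points here.\<close>
  have "separated_between T {\<one>\<^bsub>G\<^esub>} (topspace T - V)"
  proof (rule cut_wire_fence_theorem[OF cpt haus])
    show "closedin T {\<one>\<^bsub>G\<^esub>}" using haus ts by (simp add: closedin_Hausdorff_sing_eq)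
    show "closedin T (topspace T - V)" using assms(2) by blast
    fix C assume "connectedin T C"
    then show "disjnt C {\<one>\<^bsub>G\<^esub>} \<or> disjnt C (topspace T - V)"
      using td assms(3) by (auto simp: disjnt_def)
  qed
  then obtain C D where C: "openin T C" "openin T D" "C \<union> D = topspace T" "disjnt C D" "\<one>\<^bsub>G\<^esub> \<in> C" "topspace T - V \<subseteq> D"
    unfolding separated_between_def by auto
  have Ccl: "closedin T C"
  proof -
    have "C = topspace T - D" using C(3,4) by (auto simp: disjnt_def)
    then show ?thesis using C(2) by blast
  qed
  have CV: "C \<subseteq> V" using C(3,4,6) by (auto simp: disjnt_def)
  \<comment> \<open>An equivalence rather than an implication, so that U is closed under inverses;
    all conjugates are included to make U normal; x = h = 1 gives that U lies in C.\<close>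
  define U where "U = {g \<in> topspace T. \<forall>z \<in> topspace (prod_topology T T).
      fst z \<in> C \<longleftrightarrow> fst z \<otimes>\<^bsub>G\<^esub> (snd z \<otimes>\<^bsub>G\<^esub> g \<otimes>\<^bsub>G\<^esub> inv\<^bsub>G\<^esub> snd z) \<in> C}"
  have U_iff: "g \<in> U \<longleftrightarrow> g \<in> carrier G \<and> (\<forall>x \<in> carrier G. \<forall>h \<in> carrier G. x \<in> C \<longleftrightarrow> x \<otimes>\<^bsub>G\<^esub> (h \<otimes>\<^bsub>G\<^esub> g \<otimes>\<^bsub>G\<^esub> inv\<^bsub>G\<^esub> h) \<in> C)" for g
    by (auto simp: U_def ts)
  have "openin T U"
    unfolding U_def
  proof (rule openin_all_compact)
    show "compact_space (prod_topology T T)" using cpt by (simp add: compact_space_prod_topology)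
    let ?Z = "prod_topology (prod_topology T T) T"
    have x: "continuous_map ?Z T (\<lambda>z. fst (fst z))" and h: "continuous_map ?Z T (\<lambda>z. snd (fst z))"
      and g: "continuous_map ?Z T snd"
      using continuous_map_compose[OF continuous_map_fst continuous_map_fst]
        continuous_map_compose[OF continuous_map_fst continuous_map_snd] continuous_map_snd
      by (simp_all add: comp_def)
    have "continuous_map ?Z T (\<lambda>z. fst (fst z) \<otimes>\<^bsub>G\<^esub> (snd (fst z) \<otimes>\<^bsub>G\<^esub> snd z \<otimes>\<^bsub>G\<^esub> inv\<^bsub>G\<^esub> snd (fst z)))"
      by (rule topological_group_mult[OF TG x topological_group_mult[OF TG topological_group_mult[OF TG h g] topological_group_inv[OF TG h]]])
    then show "openin ?Z {z \<in> topspace ?Z. fst (fst z) \<in> C \<longleftrightarrow>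
        fst (fst z) \<otimes>\<^bsub>G\<^esub> (snd (fst z) \<otimes>\<^bsub>G\<^esub> snd z \<otimes>\<^bsub>G\<^esub> inv\<^bsub>G\<^esub> snd (fst z)) \<in> C}"
      by (rule openin_clopen_iff[OF x _ C(1) Ccl])
  qed
  moreover have "U \<subseteq> C"
  proof
    fix g assume "g \<in> U"
    then have "g \<in> carrier G" "\<one>\<^bsub>G\<^esub> \<in> C \<longleftrightarrow> \<one>\<^bsub>G\<^esub> \<otimes>\<^bsub>G\<^esub> (\<one>\<^bsub>G\<^esub> \<otimes>\<^bsub>G\<^esub> g \<otimes>\<^bsub>G\<^esub> inv\<^bsub>G\<^esub> \<one>\<^bsub>G\<^esub>) \<in> C"
      using U_iff[of g] by blast+
    then show "g \<in> C" using C(5) by simp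
  qed
  moreover have "U \<lhd> G"
  proof (rule G.normal_inv_iff[THEN iffD2], intro conjI ballI)
    show "subgroup U G"
    proof (rule G.subgroupI)
      show "U \<subseteq> carrier G" by (auto simp: U_iff)
      have "\<one>\<^bsub>G\<^esub> \<in> U" by (simp add: U_iff)
      then show "U \<noteq> {}" by blast
    next
      fix g assume g: "g \<in> U"
      then have gc: "g \<in> carrier G" by (simp add: U_iff)
      have "x \<in> C \<longleftrightarrow> x \<otimes>\<^bsub>G\<^esub> (h \<otimes>\<^bsub>G\<^esub> inv\<^bsub>G\<^esub> g \<otimes>\<^bsub>G\<^esub> inv\<^bsub>G\<^esub> h) \<in> C" if x: "x \<in> carrier G" and h: "h \<in> carrier G" for x h
      proof -
        let ?k = "h \<otimes>\<^bsub>G\<^esub> g \<otimes>\<^bsub>G\<^esub> inv\<^bsub>G\<^esub> h"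
        have k: "?k \<in> carrier G" using h gc by simp
        have e: "h \<otimes>\<^bsub>G\<^esub> inv\<^bsub>G\<^esub> g \<otimes>\<^bsub>G\<^esub> inv\<^bsub>G\<^esub> h = inv\<^bsub>G\<^esub> ?k"
          using h gc by (simp add: G.inv_mult_group G.m_assoc)
        have "x \<otimes>\<^bsub>G\<^esub> inv\<^bsub>G\<^esub> ?k \<in> C \<longleftrightarrow> x \<otimes>\<^bsub>G\<^esub> inv\<^bsub>G\<^esub> ?k \<otimes>\<^bsub>G\<^esub> ?k \<in> C"
          using g x h k unfolding U_iff by (meson G.inv_closed G.m_closed)
        moreover have "x \<otimes>\<^bsub>G\<^esub> inv\<^bsub>G\<^esub> ?k \<otimes>\<^bsub>G\<^esub> ?k = x" using x k by (simp only: G.m_assoc G.inv_closed G.l_inv G.r_one)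
        ultimately show ?thesis unfolding e by simp
      qed
      then show "inv\<^bsub>G\<^esub> g \<in> U" using gc unfolding U_iff by blast
    next
      fix a b assume a: "a \<in> U" and b: "b \<in> U"
      then have ac: "a \<in> carrier G" and bc: "b \<in> carrier G" by (simp_all add: U_iff)
      have "x \<in> C \<longleftrightarrow> x \<otimes>\<^bsub>G\<^esub> (h \<otimes>\<^bsub>G\<^esub> (a \<otimes>\<^bsub>G\<^esub> b) \<otimes>\<^bsub>G\<^esub> inv\<^bsub>G\<^esub> h) \<in> C" if x: "x \<in> carrier G" and h: "h \<in> carrier G" for x h
      proof -
        have "inv\<^bsub>G\<^esub> h \<otimes>\<^bsub>G\<^esub> (h \<otimes>\<^bsub>G\<^esub> (b \<otimes>\<^bsub>G\<^esub> inv\<^bsub>G\<^esub> h)) = b \<otimes>\<^bsub>G\<^esub> inv\<^bsub>G\<^esub> h"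
          using h bc by (simp add: G.m_assoc[symmetric])
        then have e: "x \<otimes>\<^bsub>G\<^esub> (h \<otimes>\<^bsub>G\<^esub> (a \<otimes>\<^bsub>G\<^esub> b) \<otimes>\<^bsub>G\<^esub> inv\<^bsub>G\<^esub> h)
            = x \<otimes>\<^bsub>G\<^esub> (h \<otimes>\<^bsub>G\<^esub> a \<otimes>\<^bsub>G\<^esub> inv\<^bsub>G\<^esub> h) \<otimes>\<^bsub>G\<^esub> (h \<otimes>\<^bsub>G\<^esub> b \<otimes>\<^bsub>G\<^esub> inv\<^bsub>G\<^esub> h)"
          using x h ac bc by (simp add: G.m_assoc)
        have "x \<in> C \<longleftrightarrow> x \<otimes>\<^bsub>G\<^esub> (h \<otimes>\<^bsub>G\<^esub> a \<otimes>\<^bsub>G\<^esub> inv\<^bsub>G\<^esub> h) \<in> C"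
          using a x h unfolding U_iff by blast
        also have "\<dots> \<longleftrightarrow> x \<otimes>\<^bsub>G\<^esub> (h \<otimes>\<^bsub>G\<^esub> a \<otimes>\<^bsub>G\<^esub> inv\<^bsub>G\<^esub> h) \<otimes>\<^bsub>G\<^esub> (h \<otimes>\<^bsub>G\<^esub> b \<otimes>\<^bsub>G\<^esub> inv\<^bsub>G\<^esub> h) \<in> C"
          using b x h ac unfolding U_iff by (meson G.inv_closed G.m_closed)
        finally show ?thesis unfolding e .
      qed
      then show "a \<otimes>\<^bsub>G\<^esub> b \<in> U" using ac bc unfolding U_iff by blast
    qed
  next
    fix a g assume a: "a \<in> carrier G" and g: "g \<in> U"
    then have gc: "g \<in> carrier G" by (simp add: U_iff)
    have "x \<in> C \<longleftrightarrow> x \<otimes>\<^bsub>G\<^esub> (h \<otimes>\<^bsub>G\<^esub> (a \<otimes>\<^bsub>G\<^esub> g \<otimes>\<^bsub>G\<^esub> inv\<^bsub>G\<^esub> a) \<otimes>\<^bsub>G\<^esub> inv\<^bsub>G\<^esub> h) \<in> C" if x: "x \<in> carrier G" and h: "h \<in> carrier G" for x h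
    proof -
      have e: "h \<otimes>\<^bsub>G\<^esub> (a \<otimes>\<^bsub>G\<^esub> g \<otimes>\<^bsub>G\<^esub> inv\<^bsub>G\<^esub> a) \<otimes>\<^bsub>G\<^esub> inv\<^bsub>G\<^esub> h = (h \<otimes>\<^bsub>G\<^esub> a) \<otimes>\<^bsub>G\<^esub> g \<otimes>\<^bsub>G\<^esub> inv\<^bsub>G\<^esub> (h \<otimes>\<^bsub>G\<^esub> a)"
        using a h gc by (simp add: G.inv_mult_group G.m_assoc)
      show ?thesis unfolding e using g x a h unfolding U_iff by (meson G.m_closed)
    qed
    then show "a \<otimes>\<^bsub>G\<^esub> g \<otimes>\<^bsub>G\<^esub> inv\<^bsub>G\<^esub> a \<in> U" using a gc unfolding U_iff by simp
  qed
  ultimately show ?thesis using CV by blast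
qed

lemma finite_profinite_group:
  assumes "group G" "finite (carrier G)"
  shows "profinite_group G (discrete_topology (carrier G))"
proof -
  interpret G: group G by fact
  show ?thesis
    using assms
    by (auto simp: profinite_group_def topological_group_def prod_topology_discrete_topology[symmetric]
        compact_space_discrete_topology Hausdorff_space_discrete_topology connectedin_discrete_topology)
qed

context hnn
begin

section \<open>Extending homomorphisms from F to P\<close>

lemma base_closure_rep_mono:
  assumes "p \<in> P" "N \<in> FIN" "M \<in> FIN" "N \<subseteq> M" "w \<in> carrier F" "p N = N #>\<^bsub>\<Gamma>\<^esub> \<iota> w"
  shows "p M = M #>\<^bsub>\<Gamma>\<^esub> \<iota> w"
  using assms base_closure_subset by (intro \<Gamma>.completion_rep_mono[of p N M]) auto

text \<open>\<open>\<psi> p\<close> is found by compactness as the common point of the cosets \<open>\<theta>(w) U\<close>, where the word \<open>w\<close>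
  approximates \<open>p\<close> at a level on which \<open>\<theta>\<close> is determined modulo \<open>U\<close>.\<close>

theorem base_closure_extend:
  fixes H (structure)
  assumes H: "profinite_group H S" and \<theta>: "\<theta> \<in> hom F H"
    and lev: "\<And>U. \<lbrakk>U \<lhd> H; openin S U\<rbrakk> \<Longrightarrow> \<exists>N \<in> FIN. \<forall>w \<in> carrier F. \<iota> w \<in> N \<longrightarrow> \<theta> w \<in> U"
  obtains \<psi> where "\<psi> \<in> hom G\<^sub>P H" "continuous_map T\<^sub>P S \<psi>" "\<And>w. w \<in> carrier F \<Longrightarrow> \<psi> (\<eta> w) = \<theta> w"
proof -
  have TG: "topological_group H S" and cpt: "compact_space S" and haus: "Hausdorff_space S"
    using H by (auto simp: profinite_group_def)
  have gH: "group H" and ts: "topspace S = carrier H" using TG by (auto simp: topological_group_def)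
  interpret H: group H by (rule gH)
  interpret \<theta>: group_hom F H \<theta> using \<theta> by unfold_locales
  define \<O> where "\<O> = {U. U \<lhd> H \<and> openin S U}"
  have Osub: "subgroup U H" if "U \<in> \<O>" for U using that by (simp add: \<O>_def normal_imp_subgroup)
  have conj: "inv a \<otimes> g \<otimes> a \<in> U" if "U \<in> \<O>" "a \<in> carrier H" "g \<in> U" for U a g
    using that normal.inv_op_closed1[of U H a g] by (simp add: \<O>_def)
  have trans: "continuous_map S S (\<lambda>x. a \<otimes> x)" if "a \<in> carrier H" for a
    using that topological_group_mult[OF TG, of S "\<lambda>_. a" "\<lambda>x. x"] ts by simp
  have coset_open: "openin S {x \<in> carrier H. a \<otimes> x \<in> U}" if "a \<in> carrier H" "U \<in> \<O>" for a U
    using openin_continuous_map_preimage[OF trans[OF that(1)]] that(2) by (simp add: \<O>_def ts)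
  have O_closed: "closedin S U" if U: "U \<in> \<O>" for U
  proof -
    have "openin S (topspace S - U)"
    proof (subst openin_subopen, intro ballI)
      fix x assume x: "x \<in> topspace S - U"
      then have xc: "x \<in> carrier H" using ts by simp
      let ?V = "{y \<in> carrier H. inv x \<otimes> y \<in> U}"
      have "y \<notin> U" if "y \<in> ?V" for y
      proof
        assume "y \<in> U"
        then have "y \<otimes> inv (inv x \<otimes> y) \<in> U"
          using that subgroup.m_closed[OF Osub[OF U]] subgroup.m_inv_closed[OF Osub[OF U]] by blast
        moreover have "y \<otimes> inv (inv x \<otimes> y) = x"
          using that xc by (simp add: H.inv_mult_group H.m_assoc[symmetric])
        ultimately show False using x by simp
      qed
      moreover have "x \<in> ?V" using xc subgroup.one_closed[OF Osub[OF U]] by simp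
      moreover have "openin S ?V" using coset_open[OF _ U] xc by simp
      ultimately show "\<exists>V. openin S V \<and> x \<in> V \<and> V \<subseteq> topspace S - U"
        by (intro exI[of _ ?V]) (auto simp: ts)
    qed
    moreover have "U \<subseteq> topspace S" using subgroup.subset[OF Osub[OF U]] ts by simp
    ultimately show ?thesis by (simp add: closedin_def)
  qed
  have coset_closed: "closedin S {x \<in> carrier H. a \<otimes> x \<in> U}" if "a \<in> carrier H" "U \<in> \<O>" for a U
    using closedin_continuous_map_preimage[OF trans[OF that(1)] O_closed[OF that(2)]] by (simp add: ts)
  have base: "\<exists>U \<in> \<O>. U \<subseteq> V" if "openin S V" "\<one> \<in> V" for V
    using profinite_open_normal_subgroup[OF H that] by (auto simp: \<O>_def)
  have sep: "x = \<one>" if x: "x \<in> carrier H" "\<And>U. U \<in> \<O> \<Longrightarrow> x \<in> U" for x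
  proof (rule ccontr)
    assume "x \<noteq> \<one>"
    then obtain V where "openin S V" "\<one> \<in> V" "x \<notin> V"
      using haus x(1) ts unfolding Hausdorff_space_def disjnt_def by (metis H.one_closed disjoint_iff)
    then show False using base x(2) by blast
  qed
  define N where "N U = (SOME N. N \<in> FIN \<and> (\<forall>w \<in> carrier F. \<iota> w \<in> N \<longrightarrow> \<theta> w \<in> U))" for U
  have N: "N U \<in> FIN" "\<And>w. \<lbrakk>w \<in> carrier F; \<iota> w \<in> N U\<rbrakk> \<Longrightarrow> \<theta> w \<in> U" if "U \<in> \<O>" for U
  proof -
    have "\<exists>N. N \<in> FIN \<and> (\<forall>w \<in> carrier F. \<iota> w \<in> N \<longrightarrow> \<theta> w \<in> U)"
      using lev that by (auto simp: \<O>_def)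
    from someI_ex[OF this]
    show "N U \<in> FIN" "\<And>w. \<lbrakk>w \<in> carrier F; \<iota> w \<in> N U\<rbrakk> \<Longrightarrow> \<theta> w \<in> U" by (auto simp: N_def)
  qed
  have same: "inv \<theta> u \<otimes> \<theta> w \<in> U"
    if U: "U \<in> \<O>" and uw: "u \<in> carrier F" "w \<in> carrier F" and eq: "N U #>\<^bsub>\<Gamma>\<^esub> \<iota> u = N U #>\<^bsub>\<Gamma>\<^esub> \<iota> w" for U u w
  proof -
    have "\<iota> w \<otimes>\<^bsub>\<Gamma>\<^esub> inv\<^bsub>\<Gamma>\<^esub> \<iota> u \<in> N U"
      using \<Gamma>.rcos_eq_iff_inv[OF \<Gamma>.FIN_subgroup[OF N(1)[OF U]], of "\<iota> w" "\<iota> u"] eq uw by simp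
    then have "\<theta> w \<otimes> inv \<theta> u \<in> U"
      using N(2)[OF U, of "w \<otimes>\<^bsub>F\<^esub> inv\<^bsub>F\<^esub> u"] uw by simp
    then have "inv \<theta> u \<otimes> (\<theta> w \<otimes> inv \<theta> u) \<otimes> \<theta> u \<in> U"
      by (rule conj[OF U \<theta>.hom_closed[OF uw(1)]])
    then show ?thesis using uw by (simp add: H.m_assoc)
  qed
  \<comment> \<open>Modulo each U, h agrees with \<theta> w for every word w close enough to p.
    Quantifying over all such words frees the later arguments to use whichever representative is
    convenient.\<close>
  define R where "R p h \<longleftrightarrow> h \<in> carrier H \<and>
    (\<forall>U \<in> \<O>. \<exists>M \<in> FIN. \<forall>w \<in> carrier F. p M = M #>\<^bsub>\<Gamma>\<^esub> \<iota> w \<longrightarrow> inv h \<otimes> \<theta> w \<in> U)" for p h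
  have ex: "\<exists>h. R p h" if p: "p \<in> P" for p
  proof -
    have "\<exists>w \<in> carrier F. p (N U) = N U #>\<^bsub>\<Gamma>\<^esub> \<iota> w" if "U \<in> \<O>" for U
      using base_closure_rep[OF p N(1)[OF that]] by blast
    then obtain v where v: "\<And>U. U \<in> \<O> \<Longrightarrow> v U \<in> carrier F" "\<And>U. U \<in> \<O> \<Longrightarrow> p (N U) = N U #>\<^bsub>\<Gamma>\<^esub> \<iota> (v U)"
      by metis
    define C where "C U = {x \<in> carrier H. inv \<theta> (v U) \<otimes> x \<in> U}" for U
    have "closedin S X" if "X \<in> C ` \<O>" for X
      using that v(1) coset_closed by (auto simp: C_def)
    \<comment> \<open>Finite intersection property: a word that represents p below all the levels in
      question has its image in every one of the cosets.\<close>
    moreover have "\<Inter>\<F> \<noteq> {}" if \<F>: "finite \<F>" "\<F> \<subseteq> C ` \<O>" for \<F>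
    proof -
      obtain J where J: "finite J" "J \<subseteq> \<O>" "\<F> = C ` J" using finite_subset_image[OF \<F>] by blast
      have "N ` J \<subseteq> FIN" using J(2) N(1) by blast
      then obtain M where M: "M \<in> FIN" "\<forall>U \<in> J. M \<subseteq> N U"
        using PT.lower_bound[of "N ` J"] J(1) by blast
      obtain w where w: "w \<in> carrier F" "p M = M #>\<^bsub>\<Gamma>\<^esub> \<iota> w" by (rule base_closure_rep[OF p M(1)])
      have "\<theta> w \<in> C U" if U: "U \<in> J" for U
      proof -
        have UO: "U \<in> \<O>" using U J(2) by blast
        have "p (N U) = N U #>\<^bsub>\<Gamma>\<^esub> \<iota> w"
          using base_closure_rep_mono[OF p M(1) N(1)[OF UO] _ w] M(2) U by blast
        then have "inv \<theta> (v U) \<otimes> \<theta> w \<in> U" using same[OF UO v(1)[OF UO] w(1)] v(2)[OF UO] by simp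
        then show ?thesis using w(1) by (simp add: C_def)
      qed
      then show ?thesis using J(3) by blast
    qed
    ultimately have "\<Inter>(C ` \<O>) \<noteq> {}"
      using cpt[unfolded compact_space_fip, rule_format, of "C ` \<O>"] by blast
    then obtain h where h: "\<And>U. U \<in> \<O> \<Longrightarrow> h \<in> C U" by blast
    have "carrier H \<in> \<O>"
      using H.carrier_FIN H.FIN_normal openin_topspace[of S] by (simp add: \<O>_def ts)
    then have hc: "h \<in> carrier H" using h by (auto simp: C_def)
    have "inv h \<otimes> \<theta> w \<in> U" if U: "U \<in> \<O>" and w: "w \<in> carrier F" "p (N U) = N U #>\<^bsub>\<Gamma>\<^esub> \<iota> w" for U w
    proof -
      have "inv \<theta> (v U) \<otimes> \<theta> w \<in> U" using same[OF U v(1)[OF U] w(1)] v(2)[OF U] w(2) by simp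
      moreover have "inv (inv \<theta> (v U) \<otimes> h) \<in> U"
        using h[OF U] subgroup.m_inv_closed[OF Osub[OF U]] by (simp add: C_def)
      ultimately have "inv (inv \<theta> (v U) \<otimes> h) \<otimes> (inv \<theta> (v U) \<otimes> \<theta> w) \<in> U"
        using subgroup.m_closed[OF Osub[OF U]] by blast
      moreover have "\<theta> (v U) \<otimes> (inv \<theta> (v U) \<otimes> \<theta> w) = \<theta> w" using v(1)[OF U] w(1) by (simp add: H.m_assoc[symmetric])
      ultimately show ?thesis using v(1)[OF U] w(1) hc by (simp add: H.inv_mult_group H.m_assoc)
    qed
    then have "R p h" unfolding R_def using hc N(1) by blast
    then show ?thesis by blast
  qed
  \<comment> \<open>Used twice: with p' = p it shows that h is unique, and with p' near p it shows
    that \<psi> is continuous.\<close>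
  have close: "\<exists>M \<in> FIN. \<forall>p' \<in> P. \<forall>h'. R p' h' \<longrightarrow> p' M = p M \<longrightarrow> inv h \<otimes> h' \<in> U"
    if R: "R p h" and p: "p \<in> P" and U: "U \<in> \<O>" for p h U
  proof -
    obtain M where M: "M \<in> FIN" "\<And>w. \<lbrakk>w \<in> carrier F; p M = M #>\<^bsub>\<Gamma>\<^esub> \<iota> w\<rbrakk> \<Longrightarrow> inv h \<otimes> \<theta> w \<in> U"
      using R U unfolding R_def by blast
    have hc: "h \<in> carrier H" using R by (simp add: R_def)
    have "inv h \<otimes> h' \<in> U" if p': "p' \<in> P" and R': "R p' h'" and eq: "p' M = p M" for p' h'
    proof -
      have h'c: "h' \<in> carrier H" using R' by (simp add: R_def)
      obtain M' where M': "M' \<in> FIN" "\<And>w. \<lbrakk>w \<in> carrier F; p' M' = M' #>\<^bsub>\<Gamma>\<^esub> \<iota> w\<rbrakk> \<Longrightarrow> inv h' \<otimes> \<theta> w \<in> U"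
        using R' U unfolding R_def by blast
      have MM: "M \<inter> M' \<in> FIN" by (rule \<Gamma>.FIN_Int[OF M(1) M'(1)])
      obtain w where w: "w \<in> carrier F" "p' (M \<inter> M') = (M \<inter> M') #>\<^bsub>\<Gamma>\<^esub> \<iota> w" by (rule base_closure_rep[OF p' MM])
      have "p' M = M #>\<^bsub>\<Gamma>\<^esub> \<iota> w" "p' M' = M' #>\<^bsub>\<Gamma>\<^esub> \<iota> w"
        using base_closure_rep_mono[OF p' MM M(1) _ w] base_closure_rep_mono[OF p' MM M'(1) _ w] by blast+
      then have a: "inv h \<otimes> \<theta> w \<in> U" "inv h' \<otimes> \<theta> w \<in> U" using M(2)[OF w(1)] M'(2)[OF w(1)] eq by simp_all
      then have "inv h \<otimes> \<theta> w \<otimes> inv (inv h' \<otimes> \<theta> w) \<in> U"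
        using subgroup.m_closed[OF Osub[OF U]] subgroup.m_inv_closed[OF Osub[OF U]] by blast
      moreover have "\<theta> w \<otimes> (inv \<theta> w \<otimes> h') = h'" using w(1) h'c by (simp add: H.m_assoc[symmetric])
      ultimately show ?thesis using hc h'c w(1) by (simp add: H.inv_mult_group H.m_assoc)
    qed
    then show ?thesis using M(1) by blast
  qed
  have uniq: "h = h'" if "R p h" "R p h'" "p \<in> P" for p h h'
  proof -
    have c: "h \<in> carrier H" "h' \<in> carrier H" using that by (simp_all add: R_def)
    have "inv h \<otimes> h' = \<one>"
      by (rule sep) (use c close[OF that(1,3)] that(2,3) in auto)
    then show ?thesis using c by (metis H.inv_equality H.inv_inv H.inv_closed)
  qed
  define \<psi> where "\<psi> p = (SOME h. R p h)" for p
  have \<psi>: "R p (\<psi> p)" if "p \<in> P" for p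
    unfolding \<psi>_def using ex[OF that] by (rule someI_ex)
  have \<psi>_eq: "\<psi> p = h" if "p \<in> P" "R p h" for p h
    using uniq[OF \<psi>[OF that(1)] that(2,1)] .
  have \<psi>c: "\<psi> p \<in> carrier H" if "p \<in> P" for p using \<psi>[OF that] by (simp add: R_def)
  have Psub: "subgroup P PC" using base_closure_normal by (rule normal_imp_subgroup)
  have mult: "\<psi> (p \<otimes>\<^bsub>PC\<^esub> p') = \<psi> p \<otimes> \<psi> p'" if p: "p \<in> P" and p': "p' \<in> P" for p p'
  proof (rule \<psi>_eq)
    show pp: "p \<otimes>\<^bsub>PC\<^esub> p' \<in> P" using p p' subgroup.m_closed[OF Psub] by blast
    have pc: "p \<in> carrier PC" "p' \<in> carrier PC" using p p' base_closure_subset by auto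
    show "R (p \<otimes>\<^bsub>PC\<^esub> p') (\<psi> p \<otimes> \<psi> p')"
      unfolding R_def
    proof (intro conjI ballI)
      show "\<psi> p \<otimes> \<psi> p' \<in> carrier H" using \<psi>c p p' by simp
      fix U assume U: "U \<in> \<O>"
      obtain M where M: "M \<in> FIN" "\<And>w. \<lbrakk>w \<in> carrier F; p M = M #>\<^bsub>\<Gamma>\<^esub> \<iota> w\<rbrakk> \<Longrightarrow> inv \<psi> p \<otimes> \<theta> w \<in> U"
        using \<psi>[OF p] U unfolding R_def by blast
      obtain M' where M': "M' \<in> FIN" "\<And>w. \<lbrakk>w \<in> carrier F; p' M' = M' #>\<^bsub>\<Gamma>\<^esub> \<iota> w\<rbrakk> \<Longrightarrow> inv \<psi> p' \<otimes> \<theta> w \<in> U"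
        using \<psi>[OF p'] U unfolding R_def by blast
      have MM: "M \<inter> M' \<in> FIN" by (rule \<Gamma>.FIN_Int[OF M(1) M'(1)])
      show "\<exists>M \<in> FIN. \<forall>w \<in> carrier F. (p \<otimes>\<^bsub>PC\<^esub> p') M = M #>\<^bsub>\<Gamma>\<^esub> \<iota> w \<longrightarrow> inv (\<psi> p \<otimes> \<psi> p') \<otimes> \<theta> w \<in> U"
      proof (rule bexI[OF _ MM], intro ballI impI)
        fix w assume w: "w \<in> carrier F" "(p \<otimes>\<^bsub>PC\<^esub> p') (M \<inter> M') = (M \<inter> M') #>\<^bsub>\<Gamma>\<^esub> \<iota> w"
        obtain u where u: "u \<in> carrier F" "p (M \<inter> M') = (M \<inter> M') #>\<^bsub>\<Gamma>\<^esub> \<iota> u" by (rule base_closure_rep[OF p MM])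
        \<comment> \<open>A word representing the product is split: u represents p, so the remaining
          factor v represents p'.\<close>
        define v where "v = inv\<^bsub>F\<^esub> u \<otimes>\<^bsub>F\<^esub> w"
        have v: "v \<in> carrier F" using u w by (simp add: v_def)
        have "p' = inv\<^bsub>PC\<^esub> p \<otimes>\<^bsub>PC\<^esub> (p \<otimes>\<^bsub>PC\<^esub> p')" using pc by (simp add: PC.m_assoc[symmetric])
        then have "p' (M \<inter> M') = (inv\<^bsub>PC\<^esub> p) (M \<inter> M') <#>\<^bsub>\<Gamma>\<^esub> ((p \<otimes>\<^bsub>PC\<^esub> p') (M \<inter> M'))"
          using \<Gamma>.completion_mult[OF MM] by metis
        also have "\<dots> = (M \<inter> M') #>\<^bsub>\<Gamma>\<^esub> \<iota> v"
          using \<Gamma>.completion_inv[OF MM pc(1) \<iota>.hom_closed[OF u(1)] u(2)] u(1) w \<Gamma>.rcos_mult[OF MM] by (simp add: v_def)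
        finally have vp: "p' (M \<inter> M') = (M \<inter> M') #>\<^bsub>\<Gamma>\<^esub> \<iota> v" .
        have "p M = M #>\<^bsub>\<Gamma>\<^esub> \<iota> u"
          using base_closure_rep_mono[OF p MM M(1) _ u] by blast
        then have a: "inv \<psi> p \<otimes> \<theta> u \<in> U" using M(2) u(1) by blast
        have "p' M' = M' #>\<^bsub>\<Gamma>\<^esub> \<iota> v"
          using base_closure_rep_mono[OF p' MM M'(1) _ v vp] by blast
        then have b: "inv \<psi> p' \<otimes> \<theta> v \<in> U" using M'(2) v by blast
        have tw: "\<theta> w = \<theta> u \<otimes> \<theta> v" using u(1) w(1) by (simp add: v_def H.m_assoc[symmetric])
        have c: "\<psi> p \<in> carrier H" "\<psi> p' \<in> carrier H" "\<theta> u \<in> carrier H" "\<theta> v \<in> carrier H"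
          using \<psi>c p p' u(1) v by auto
        \<comment> \<open>Normality of U lets the error at p be conjugated past \<psi> p', after
          which it can be multiplied with the error at p'.\<close>
        have "inv \<psi> p' \<otimes> (inv \<psi> p \<otimes> \<theta> u) \<otimes> \<psi> p' \<in> U"
          by (rule conj[OF U c(2) a])
        then have "inv \<psi> p' \<otimes> (inv \<psi> p \<otimes> \<theta> u) \<otimes> \<psi> p' \<otimes> (inv \<psi> p' \<otimes> \<theta> v) \<in> U"
          using b subgroup.m_closed[OF Osub[OF U]] by blast
        moreover have "\<psi> p' \<otimes> (inv \<psi> p' \<otimes> \<theta> v) = \<theta> v" using c by (simp add: H.m_assoc[symmetric])
        ultimately show "inv (\<psi> p \<otimes> \<psi> p') \<otimes> \<theta> w \<in> U"
          using c by (simp add: tw H.inv_mult_group H.m_assoc)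
      qed
    qed
  qed
  show ?thesis
  proof (rule that)
    show "\<psi> \<in> hom G\<^sub>P H" using \<psi>c mult by (auto simp: hom_def)
    have "openin T\<^sub>P {p \<in> topspace T\<^sub>P. \<psi> p \<in> V}" if V: "openin S V" for V
    proof (subst openin_subopen, intro ballI)
      fix p assume "p \<in> {p \<in> topspace T\<^sub>P. \<psi> p \<in> V}"
      then have p: "p \<in> P" "\<psi> p \<in> V" by (simp_all add: topspace_base_closure)
      let ?V = "{x \<in> carrier H. \<psi> p \<otimes> x \<in> V}"
      have "openin S ?V" using openin_continuous_map_preimage[OF trans[OF \<psi>c[OF p(1)]] V] by (simp add: ts)
      then obtain U where U: "U \<in> \<O>" "U \<subseteq> ?V" using base[of ?V] p \<psi>c[OF p(1)] by auto
      obtain M where M: "M \<in> FIN" "\<forall>p' \<in> P. \<forall>h'. R p' h' \<longrightarrow> p' M = p M \<longrightarrow> inv \<psi> p \<otimes> h' \<in> U"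
        using close[OF \<psi>[OF p(1)] p(1) U(1)] by blast
      have "\<psi> p' \<in> V" if p': "p' \<in> P" "p' M = p M" for p'
      proof -
        have "inv \<psi> p \<otimes> \<psi> p' \<in> ?V" using M(2) p' \<psi>[OF p'(1)] U(2) by blast
        moreover have "\<psi> p \<otimes> (inv \<psi> p \<otimes> \<psi> p') = \<psi> p'" using \<psi>c p(1) p'(1) by (simp add: H.m_assoc[symmetric])
        ultimately show ?thesis by simp
      qed
      then show "\<exists>W. openin T\<^sub>P W \<and> p \<in> W \<and> W \<subseteq> {p \<in> topspace T\<^sub>P. \<psi> p \<in> V}"
        using TP.level_open[OF M(1), of p] p(1)
        by (intro exI[of _ "{p' \<in> topspace T\<^sub>P. p' M = p M}"]) (auto simp: topspace_base_closure simp del: topspace_subtopology)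
    qed
    then show "continuous_map T\<^sub>P S \<psi>"
      using \<psi>c by (auto simp: continuous_map_def ts topspace_base_closure simp del: topspace_subtopology)
    fix w assume w: "w \<in> carrier F"
    show "\<psi> (\<eta> w) = \<theta> w"
    proof (rule \<psi>_eq[OF base_map_in_closure[OF w]])
      show "R (\<eta> w) (\<theta> w)"
        unfolding R_def
      proof (intro conjI ballI)
        fix U assume U: "U \<in> \<O>"
        then show "\<exists>M \<in> FIN. \<forall>v \<in> carrier F. \<eta> w M = M #>\<^bsub>\<Gamma>\<^esub> \<iota> v \<longrightarrow> inv \<theta> w \<otimes> \<theta> v \<in> U"
          using same[OF U w] N(1)[OF U] \<Gamma>.completion_map_level[OF N(1)[OF U]]
          by (intro bexI[of _ "N U"]) auto
      qed (use w in simp)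
    qed
  qed
qed

text \<open>The image of F is dense in P, and continuous maps to a Hausdorff space that agree on a
  dense set are equal.\<close>

lemma base_closure_hom_eq:
  assumes "Hausdorff_space S" "continuous_map T\<^sub>P S \<phi>" "continuous_map T\<^sub>P S \<psi>"
    "\<And>w. w \<in> carrier F \<Longrightarrow> \<phi> (\<eta> w) = \<psi> (\<eta> w)" "p \<in> P"
  shows "\<phi> p = \<psi> p"
proof (rule forall_in_closure_of_eq[OF _ assms(1-3)])
  have "(\<lambda>w. \<eta> w) ` carrier F \<subseteq> P" using base_map_in_closure by blast
  then have "T\<^sub>P closure_of ((\<lambda>w. \<eta> w) ` carrier F) = P"
    by (simp add: closure_of_subtopology Int_absorb1 hnn_base_closure_def[symmetric])
  then show "p \<in> T\<^sub>P closure_of ((\<lambda>w. \<eta> w) ` carrier F)" using assms(5) by simp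
qed (use assms(4) in auto)

end

section \<open>The alternating face sum\<close>

text \<open>On lists, the coboundary is \<open>(\<delta>\<phi>)(a l) = a \<phi>(l) - face_sum \<phi> (a l)\<close>.\<close>

fun face_sum :: "('a, 'b) monoid_scheme \<Rightarrow> ('m, 'c) monoid_scheme \<Rightarrow> ('a list \<Rightarrow> 'm) \<Rightarrow> 'a list \<Rightarrow> 'm" where
  "face_sum G A \<phi> [] = \<one>\<^bsub>A\<^esub>"
| "face_sum G A \<phi> [a] = \<phi> []"
| "face_sum G A \<phi> (a # b # l) = \<phi> ((a \<otimes>\<^bsub>G\<^esub> b) # l) \<otimes>\<^bsub>A\<^esub> inv\<^bsub>A\<^esub> face_sum G A (\<lambda>x. \<phi> (a # x)) (b # l)"

text \<open>Lists replace the functions on an initial segment used for cochains, so that the face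
  sum can be defined by recursion and its identities proved by induction on the length.\<close>

definition tuples :: "('a, 'b) monoid_scheme \<Rightarrow> nat \<Rightarrow> 'a list set" where
  "tuples G k = {l \<in> lists (carrier G). length l = k}"

lemma tuples_Cons [simp]: "a # l \<in> tuples G (Suc k) \<longleftrightarrow> a \<in> carrier G \<and> l \<in> tuples G k"
  by (auto simp: tuples_def)

lemma tuples_0 [simp]: "l \<in> tuples G 0 \<longleftrightarrow> l = []"
  by (auto simp: tuples_def)

lemma tuples_SucE:
  assumes "l \<in> tuples G (Suc k)"
  obtains a l' where "l = a # l'" "a \<in> carrier G" "l' \<in> tuples G k"
  using assms by (cases l) (auto simp: tuples_def)

lemma finite_tuples: "finite (carrier G) \<Longrightarrow> finite (tuples G k)"
  using finite_lists_length_eq[of "carrier G" k] by (simp add: tuples_def lists_eq_set Int_def conj_commute)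

locale coefficients = G: group G + A: comm_group A for G :: "('a, 'b) monoid_scheme" (structure) and A :: "'m monoid" (structure)
begin

abbreviation "fs \<equiv> face_sum G A"

text \<open>Stated for a subgroup B so that the extension attached to a cocycle can be built inside
  a finite submodule and stays finite.\<close>

lemma face_sum_in_subgroup:
  assumes "subgroup B A" "\<phi> \<in> tuples G k \<rightarrow> B" "l \<in> tuples G (Suc k)"
  shows "fs \<phi> l \<in> B"
  using assms(2,3)
proof (induction k arbitrary: \<phi> l)
  case 0
  then show ?case by (auto elim!: tuples_SucE)
next
  case (Suc k)
  obtain a b l' where l: "l = a # b # l'" "a \<in> carrier G" "b \<in> carrier G" "l' \<in> tuples G k"
    using Suc.prems(2) by (auto elim!: tuples_SucE)
  have "fs (\<lambda>x. \<phi> (a # x)) (b # l') \<in> B"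
    using Suc.prems(1) l by (intro Suc.IH) auto
  moreover have "\<phi> ((a \<otimes> b) # l') \<in> B" using Suc.prems(1) l by auto
  ultimately show ?case
    using l(1) subgroup.m_closed[OF assms(1)] subgroup.m_inv_closed[OF assms(1)] by simp
qed

lemma face_sum_closed: "\<lbrakk>\<phi> \<in> tuples G k \<rightarrow> carrier A; l \<in> tuples G (Suc k)\<rbrakk> \<Longrightarrow> fs \<phi> l \<in> carrier A"
  by (rule face_sum_in_subgroup[OF A.subgroup_self])

lemma face_sum_cong:
  assumes "\<And>x. x \<in> tuples G k \<Longrightarrow> \<phi> x = \<psi> x" "l \<in> tuples G (Suc k)"
  shows "fs \<phi> l = fs \<psi> l"
  using assms
proof (induction k arbitrary: \<phi> \<psi> l)
  case 0
  then show ?case by (auto elim!: tuples_SucE)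
next
  case (Suc k)
  obtain a b l' where l: "l = a # b # l'" "a \<in> carrier G" "b \<in> carrier G" "l' \<in> tuples G k"
    using Suc.prems(2) by (auto elim!: tuples_SucE)
  have "fs (\<lambda>x. \<phi> (a # x)) (b # l') = fs (\<lambda>x. \<psi> (a # x)) (b # l')"
    using Suc.prems(1) l by (intro Suc.IH) auto
  then show ?case using l Suc.prems(1)[of "(a \<otimes> b) # l'"] by simp
qed

lemma face_sum_mult:
  assumes "\<phi> \<in> tuples G k \<rightarrow> carrier A" "\<psi> \<in> tuples G k \<rightarrow> carrier A" "l \<in> tuples G (Suc k)"
  shows "fs (\<lambda>x. \<phi> x \<otimes>\<^bsub>A\<^esub> \<psi> x) l = fs \<phi> l \<otimes>\<^bsub>A\<^esub> fs \<psi> l"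
  using assms
proof (induction k arbitrary: \<phi> \<psi> l)
  case 0
  then show ?case by (auto elim!: tuples_SucE)
next
  case (Suc k)
  obtain a b l' where l: "l = a # b # l'" "a \<in> carrier G" "b \<in> carrier G" "l' \<in> tuples G k"
    using Suc.prems(3) by (auto elim!: tuples_SucE)
  have \<phi>: "(\<lambda>x. \<phi> (a # x)) \<in> tuples G k \<rightarrow> carrier A" and \<psi>: "(\<lambda>x. \<psi> (a # x)) \<in> tuples G k \<rightarrow> carrier A"
    using Suc.prems(1,2) l(2) by auto
  have bl: "b # l' \<in> tuples G (Suc k)" using l by simp
  have c: "\<phi> ((a \<otimes> b) # l') \<in> carrier A" "\<psi> ((a \<otimes> b) # l') \<in> carrier A"
    using Suc.prems(1,2) l by auto
  show ?case
    using Suc.IH[OF \<phi> \<psi> bl] face_sum_closed[OF \<phi> bl] face_sum_closed[OF \<psi> bl] c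
    by (simp add: l(1) A.inv_mult A.m_ac)
qed

text \<open>Applied to the action of a group element, it says that the left action on cochains
  commutes with the right action given by face sums.\<close>

lemma face_sum_hom:
  assumes "h \<in> hom A A" "\<phi> \<in> tuples G k \<rightarrow> carrier A" "l \<in> tuples G (Suc k)"
  shows "fs (\<lambda>x. h (\<phi> x)) l = h (fs \<phi> l)"
  using assms(2,3)
proof (induction k arbitrary: \<phi> l)
  case 0
  then show ?case by (auto elim!: tuples_SucE)
next
  case (Suc k)
  interpret h: group_hom A A h using assms(1) by unfold_locales
  obtain a b l' where l: "l = a # b # l'" "a \<in> carrier G" "b \<in> carrier G" "l' \<in> tuples G k"
    using Suc.prems(2) by (auto elim!: tuples_SucE)
  have \<phi>: "(\<lambda>x. \<phi> (a # x)) \<in> tuples G k \<rightarrow> carrier A" using Suc.prems(1) l(2) by auto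
  have bl: "b # l' \<in> tuples G (Suc k)" using l by simp
  have c: "\<phi> ((a \<otimes> b) # l') \<in> carrier A" using Suc.prems(1) l by auto
  show ?case
    using Suc.IH[OF \<phi> bl] face_sum_closed[OF \<phi> bl] c by (simp add: l(1))
qed

lemma face_sum_inv:
  assumes "\<phi> \<in> tuples G k \<rightarrow> carrier A" "l \<in> tuples G (Suc k)"
  shows "fs (\<lambda>x. inv\<^bsub>A\<^esub> \<phi> x) l = inv\<^bsub>A\<^esub> fs \<phi> l"
  by (rule face_sum_hom[OF _ assms]) (auto simp: hom_def A.inv_mult)

text \<open>Equivalent to the law (\<mu> h) k = \<mu> (h k) for the right action (\<mu> h)(l) = face
  sum of \<mu> at h l. Splitting off the first entry a leaves the face sum of
  \<open>\<phi>'\<close>, with a multiplied into the head, and a double face sum in one variable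
  less, which vanishes by induction.\<close>

lemma face_sum_face_sum:
  assumes "\<phi> \<in> tuples G k \<rightarrow> carrier A" "a \<in> carrier G" "b \<in> carrier G" "l \<in> tuples G k"
  shows "fs (fs \<phi>) (a # b # l) = \<one>\<^bsub>A\<^esub>"
  using assms
proof (induction k arbitrary: \<phi> a b l)
  case 0
  then have "\<phi> [] \<in> carrier A" by auto
  then show ?case using 0 by simp
next
  case (Suc k)
  obtain c l' where l: "l = c # l'" "c \<in> carrier G" "l' \<in> tuples G k"
    using Suc.prems(4) by (auto elim!: tuples_SucE)
  note abc = Suc.prems(2,3) l(2)
  define \<phi>' where "\<phi>' x = \<phi> ((a \<otimes> hd x) # tl x)" for x
  have \<phi>a: "(\<lambda>x. \<phi> (a # x)) \<in> tuples G k \<rightarrow> carrier A" using Suc.prems(1) abc by auto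
  have fa: "fs (\<lambda>x. \<phi> (a # x)) \<in> tuples G (Suc k) \<rightarrow> carrier A"
    using face_sum_closed[OF \<phi>a] by auto
  have \<phi>'c: "\<phi>' \<in> tuples G (Suc k) \<rightarrow> carrier A"
    using Suc.prems(1) abc by (auto simp: \<phi>'_def elim!: tuples_SucE)
  have bcl: "b # c # l' \<in> tuples G (Suc (Suc k))" using abc l by simp
  have "fs (\<lambda>x. fs \<phi> (a # x)) (b # c # l') = fs (\<lambda>x. \<phi>' x \<otimes>\<^bsub>A\<^esub> inv\<^bsub>A\<^esub> fs (\<lambda>x. \<phi> (a # x)) x) (b # c # l')"
    by (rule face_sum_cong[OF _ bcl]) (auto simp: \<phi>'_def elim!: tuples_SucE)
  also have "\<dots> = fs \<phi>' (b # c # l') \<otimes>\<^bsub>A\<^esub> inv\<^bsub>A\<^esub> fs (fs (\<lambda>x. \<phi> (a # x))) (b # c # l')"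
  proof -
    have "(\<lambda>x. inv\<^bsub>A\<^esub> fs (\<lambda>x. \<phi> (a # x)) x) \<in> tuples G (Suc k) \<rightarrow> carrier A" using fa by auto
    then show ?thesis by (simp only: face_sum_mult[OF \<phi>'c _ bcl] face_sum_inv[OF fa bcl])
  qed
  also have "fs (fs (\<lambda>x. \<phi> (a # x))) (b # c # l') = \<one>\<^bsub>A\<^esub>"
    by (rule Suc.IH[OF \<phi>a abc(2,3) l(3)])
  also have "fs \<phi>' (b # c # l') = fs \<phi> ((a \<otimes> b) # c # l')"
    using abc by (simp add: \<phi>'_def G.m_assoc)
  finally have "fs (\<lambda>x. fs \<phi> (a # x)) (b # c # l') = fs \<phi> ((a \<otimes> b) # c # l')"
    using face_sum_closed[OF Suc.prems(1), of "(a \<otimes> b) # c # l'"] abc l by simp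
  then show ?case
    using face_sum_closed[OF Suc.prems(1), of "(a \<otimes> b) # c # l'"] abc l
    by (simp only: l(1) face_sum.simps(3)[of G A "fs \<phi>"]) simp
qed

end

text \<open>Inflation along \<pi> commutes with faces because \<pi> respects the products formed in
  them. It carries the cocycle identity down to a finite quotient and the coboundary back
  up.\<close>

lemma face_sum_map:
  assumes "coefficients G A" "\<pi> \<in> hom G H" "l \<in> tuples G (Suc k)"
  shows "face_sum H A \<phi> (map \<pi> l) = face_sum G A (\<lambda>x. \<phi> (map \<pi> x)) l"
  using assms(3)
proof (induction k arbitrary: \<phi> l)
  case 0
  then show ?case by (auto elim!: tuples_SucE)
next
  case (Suc k)
  obtain a b l' where l: "l = a # b # l'" "a \<in> carrier G" "b \<in> carrier G" "l' \<in> tuples G k"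
    using Suc.prems by (auto elim!: tuples_SucE)
  have "face_sum H A (\<lambda>x. \<phi> (\<pi> a # x)) (map \<pi> (b # l')) = face_sum G A (\<lambda>x. \<phi> (\<pi> a # map \<pi> x)) (b # l')"
    using l by (intro Suc.IH) simp
  then show ?case using l hom_mult[OF assms(2) l(2,3)] by simp
qed

section \<open>A finite group attached to a cocycle\<close>

text \<open>Every idempotent of the semigroup is a left unit.\<close>

lemma left_cancellative_group:
  assumes fin: "finite S" "S \<noteq> {}"
    and closed: "\<And>x y. \<lbrakk>x \<in> S; y \<in> S\<rbrakk> \<Longrightarrow> m x y \<in> S"
    and assoc: "\<And>x y z. \<lbrakk>x \<in> S; y \<in> S; z \<in> S\<rbrakk> \<Longrightarrow> m (m x y) z = m x (m y z)"
    and cancel: "\<And>x y z. \<lbrakk>x \<in> S; y \<in> S; z \<in> S; m x y = m x z\<rbrakk> \<Longrightarrow> y = z"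
  obtains e where "e \<in> S" "m e e = e" "group \<lparr>carrier = {x \<in> S. m x e = x}, monoid.mult = m, one = e\<rparr>"
proof -
  have surj: "\<exists>y \<in> S. m x y = z" if x: "x \<in> S" and z: "z \<in> S" for x z
  proof -
    have "inj_on (m x) S" using cancel x by (auto simp: inj_on_def)
    then have "m x ` S = S" using fin(1) closed x by (intro endo_inj_surj) auto
    then have "z \<in> m x ` S" using z by simp
    then show ?thesis by blast
  qed
  obtain x where x: "x \<in> S" using fin(2) by blast
  \<comment> \<open>Left multiplication by x is onto the finite set S, so x has a right unit e;
    cancelling x in x (e e) = x e shows e to be idempotent.\<close>
  obtain e where e: "e \<in> S" "m x e = x" using surj[OF x x] by blast
  have ee: "m e e = e" using cancel[OF x closed[OF e(1,1)] e(1)] assoc[OF x e(1,1)] e by simp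
  have left: "m e y = y" if "y \<in> S" for y
    using cancel[OF e(1) closed[OF e(1) that] that] assoc[OF e(1,1) that] ee by simp
  have "group \<lparr>carrier = {x \<in> S. m x e = x}, monoid.mult = m, one = e\<rparr>"
  proof (rule groupI)
    fix y assume "y \<in> carrier \<lparr>carrier = {x \<in> S. m x e = x}, monoid.mult = m, one = e\<rparr>"
    then have y: "y \<in> S" "m y e = y" by auto
    obtain z where z: "z \<in> S" "m y z = e" using surj[OF y(1) e(1)] by blast
    \<comment> \<open>Multiplying by e on the right moves the right inverse z into the group S e,
      where it becomes a two-sided inverse.\<close>
    define z' where "z' = m z e"
    have z': "z' \<in> S" "m z' e = z'" using closed[OF z(1) e(1)] assoc[OF z(1) e(1,1)] ee by (auto simp: z'_def)
    have "m y z' = e" using assoc[OF y(1) z(1) e(1)] z ee by (simp add: z'_def)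
    then have "m y (m z' y) = m y e" using assoc[OF y(1) z'(1) y(1)] left[OF y(1)] y(2) by simp
    then have "m z' y = e" using cancel[OF y(1) closed[OF z'(1) y(1)] e(1)] by simp
    then show "\<exists>z \<in> carrier \<lparr>carrier = {x \<in> S. m x e = x}, monoid.mult = m, one = e\<rparr>.
        z \<otimes>\<^bsub>\<lparr>carrier = {x \<in> S. m x e = x}, monoid.mult = m, one = e\<rparr>\<^esub> y = \<one>\<^bsub>\<lparr>carrier = {x \<in> S. m x e = x}, monoid.mult = m, one = e\<rparr>\<^esub>"
      using z' by auto
  qed (use closed assoc left e(1) ee in auto)
  then show ?thesis using that e(1) ee by blast
qed

text \<open>The semigroup of pairs \<open>(\<mu>, g)\<close>, where \<open>\<mu>\<close> is an \<open>r\<close>-cochain, is the extension that a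
  \<open>2\<close>-cocycle with values in the bimodule of \<open>r\<close>-cochains would define; the right action
  \<open>(\<mu> h)(l) = face_sum \<mu> (h l)\<close> is not unital, so that it is not a group in general.\<close>

lemma cocycle_group:
  fixes Q :: "('q, 'b) monoid_scheme" and A :: "'m monoid"
  assumes QA: "coefficients Q A" and fin: "finite (carrier Q)" and B: "subgroup B A" "finite B"
    and act: "\<And>g. g \<in> carrier Q \<Longrightarrow> act g \<in> hom A A" "\<And>g a. \<lbrakk>g \<in> carrier Q; a \<in> B\<rbrakk> \<Longrightarrow> act g a \<in> B"
      "\<And>a. a \<in> B \<Longrightarrow> act \<one>\<^bsub>Q\<^esub> a = a"
      "\<And>g h a. \<lbrakk>g \<in> carrier Q; h \<in> carrier Q; a \<in> B\<rbrakk> \<Longrightarrow> act (g \<otimes>\<^bsub>Q\<^esub> h) a = act g (act h a)"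
    and c: "c \<in> tuples Q (Suc (Suc r)) \<rightarrow> B"
    and cocycle: "\<And>g l. \<lbrakk>g \<in> carrier Q; l \<in> tuples Q (Suc (Suc r))\<rbrakk> \<Longrightarrow> act g (c l) = face_sum Q A c (g # l)"
  obtains W :: "(('q list \<Rightarrow> 'm) \<times> 'q) monoid" where "group W" "finite (carrier W)"
    "snd \<in> hom W Q" "snd ` carrier W = carrier Q" "\<And>x. x \<in> carrier W \<Longrightarrow> fst x \<in> tuples Q r \<rightarrow> B"
    "\<And>x y l. \<lbrakk>x \<in> carrier W; y \<in> carrier W; l \<in> tuples Q r\<rbrakk> \<Longrightarrow> fst (x \<otimes>\<^bsub>W\<^esub> y) l =
       act (snd x) (fst y l) \<otimes>\<^bsub>A\<^esub> face_sum Q A (fst x) (snd y # l) \<otimes>\<^bsub>A\<^esub> inv\<^bsub>A\<^esub> c (snd x # snd y # l)"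
proof -
  interpret coefficients Q A by (rule QA)
  have Bc: "B \<subseteq> carrier A" using B(1) by (rule subgroup.subset)
  note [simp] = subgroup.m_closed[OF B(1)] subgroup.m_inv_closed[OF B(1)]
  define S where "S = (tuples Q r \<rightarrow>\<^sub>E B) \<times> carrier Q"
  \<comment> \<open>Additively, (\<mu>, g)(\<nu>, h) = (g \<nu> + \<mu> h - c(g, h, _), g h). The
    minus sign makes the cochain read off from a lift have coboundary c itself.\<close>
  define m where "m x y = (\<lambda>l \<in> tuples Q r. act (snd x) (fst y l) \<otimes>\<^bsub>A\<^esub> face_sum Q A (fst x) (snd y # l)
      \<otimes>\<^bsub>A\<^esub> inv\<^bsub>A\<^esub> c (snd x # snd y # l), snd x \<otimes>\<^bsub>Q\<^esub> snd y)" for x y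
  have S: "fst x \<in> tuples Q r \<rightarrow> B" "snd x \<in> carrier Q" "fst x \<in> extensional (tuples Q r)" if "x \<in> S" for x
    using that by (auto simp: S_def PiE_iff)
  have inB: "act g a \<otimes>\<^bsub>A\<^esub> face_sum Q A \<mu> (h # l) \<otimes>\<^bsub>A\<^esub> inv\<^bsub>A\<^esub> c (g # h # l) \<in> B"
    if "g \<in> carrier Q" "h \<in> carrier Q" "l \<in> tuples Q r" "\<mu> \<in> tuples Q r \<rightarrow> B" "a \<in> B" for g h l \<mu> a
  proof -
    have "face_sum Q A \<mu> (h # l) \<in> B" using that by (intro face_sum_in_subgroup[OF B(1) that(4)]) simp
    moreover have "c (g # h # l) \<in> B" using c that by auto
    ultimately show ?thesis using act(2) that by simp
  qed
  have finS: "finite S"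
    unfolding S_def using fin B(2) finite_tuples[OF fin] by (intro finite_cartesian_product finite_PiE) auto
  have neS: "S \<noteq> {}"
    using subgroup.one_closed[OF B(1)] G.one_closed by (auto simp: S_def PiE_eq_empty_iff)
  have closed: "m x y \<in> S" if "x \<in> S" "y \<in> S" for x y
  proof -
    note sx = S[OF that(1)] and sy = S[OF that(2)]
    have "fst (m x y) \<in> tuples Q r \<rightarrow>\<^sub>E B"
      using inB[OF sx(2) sy(2) _ sx(1)] sy(1) by (auto simp: m_def)
    then show ?thesis using sx(2) sy(2) by (auto simp: S_def m_def)
  qed
  have assoc: "m (m x y) z = m x (m y z)" if xyz: "x \<in> S" "y \<in> S" "z \<in> S" for x y z
  proof -
    define g where "g = snd x" define h where "h = snd y" define k where "k = snd z"
    define \<mu> where "\<mu> = fst x" define \<nu> where "\<nu> = fst y" define \<rho> where "\<rho> = fst z"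
    have ghk: "g \<in> carrier Q" "h \<in> carrier Q" "k \<in> carrier Q" using S xyz by (auto simp: g_def h_def k_def)
    have \<mu>: "\<mu> \<in> tuples Q r \<rightarrow> B" and \<nu>: "\<nu> \<in> tuples Q r \<rightarrow> B" and \<rho>: "\<rho> \<in> tuples Q r \<rightarrow> B"
      using S xyz by (auto simp: \<mu>_def \<nu>_def \<rho>_def)
    then have \<mu>A: "\<mu> \<in> tuples Q r \<rightarrow> carrier A" and \<nu>A: "\<nu> \<in> tuples Q r \<rightarrow> carrier A" using Bc by auto
    have eq: "act (g \<otimes>\<^bsub>Q\<^esub> h) (\<rho> l) \<otimes>\<^bsub>A\<^esub> face_sum Q A (fst (m x y)) (k # l) \<otimes>\<^bsub>A\<^esub> inv\<^bsub>A\<^esub> c ((g \<otimes>\<^bsub>Q\<^esub> h) # k # l)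
       = act g (act h (\<rho> l) \<otimes>\<^bsub>A\<^esub> face_sum Q A \<nu> (k # l) \<otimes>\<^bsub>A\<^esub> inv\<^bsub>A\<^esub> c (h # k # l))
          \<otimes>\<^bsub>A\<^esub> face_sum Q A \<mu> ((h \<otimes>\<^bsub>Q\<^esub> k) # l) \<otimes>\<^bsub>A\<^esub> inv\<^bsub>A\<^esub> c (g # (h \<otimes>\<^bsub>Q\<^esub> k) # l)"
      if l: "l \<in> tuples Q r" for l
    proof -
      interpret g: group_hom A A "act g" using act(1)[OF ghk(1)] by unfold_locales
      have kl: "k # l \<in> tuples Q (Suc r)" using ghk l by simp
      define U where "U = act (g \<otimes>\<^bsub>Q\<^esub> h) (\<rho> l)"
      define V where "V = act g (face_sum Q A \<nu> (k # l))"
      define M where "M = face_sum Q A \<mu> ((h \<otimes>\<^bsub>Q\<^esub> k) # l)"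
      define X where "X = act g (c (h # k # l))"
      define Y where "Y = c ((g \<otimes>\<^bsub>Q\<^esub> h) # k # l)"
      define Z where "Z = c (g # (h \<otimes>\<^bsub>Q\<^esub> k) # l)"
      define D where "D = face_sum Q A (\<lambda>x. c (g # h # x)) (k # l)"
      have \<rho>l: "\<rho> l \<in> B" using \<rho> l by auto
      have cgh: "(\<lambda>x. c (g # h # x)) \<in> tuples Q r \<rightarrow> carrier A" using c ghk Bc by auto
      have \<mu>h: "(\<lambda>x. face_sum Q A \<mu> (h # x)) \<in> tuples Q r \<rightarrow> carrier A"
        using ghk face_sum_closed[OF \<mu>A] by auto
      have g\<nu>: "(\<lambda>x. act g (\<nu> x)) \<in> tuples Q r \<rightarrow> carrier A" using \<nu>A by (auto intro!: g.hom_closed)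
      have ckl: "c (h # k # l) \<in> B" using c ghk l by auto
      have cl: "U \<in> carrier A" "V \<in> carrier A" "M \<in> carrier A" "X \<in> carrier A" "Y \<in> carrier A"
          "Z \<in> carrier A" "D \<in> carrier A" "face_sum Q A \<nu> (k # l) \<in> carrier A" "c (h # k # l) \<in> carrier A"
          "act h (\<rho> l) \<in> carrier A"
        unfolding U_def V_def M_def X_def Y_def Z_def D_def
        using act(2) \<rho>l ghk l Bc face_sum_closed[OF \<mu>A] face_sum_closed[OF \<nu>A kl] face_sum_closed[OF cgh kl] c ckl
          subsetD[OF Bc act(2)[OF ghk(1) ckl]]
        by auto
      \<comment> \<open>The cocycle identity at (g, h, k, l): Y and Z are its first two faces, and D
        collects those in which g and h stay separate entries.\<close>
      have "X = face_sum Q A c (g # h # k # l)"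
        unfolding X_def using ghk l by (intro cocycle) auto
      then have XYZD: "X = Y \<otimes>\<^bsub>A\<^esub> inv\<^bsub>A\<^esub> (Z \<otimes>\<^bsub>A\<^esub> inv\<^bsub>A\<^esub> D)"
        by (simp add: Y_def Z_def D_def)
      \<comment> \<open>Acting on \<mu> by h and then by k equals acting by h k, although the right
        action is not unital.\<close>
      have "face_sum Q A (face_sum Q A \<mu>) (h # k # l) = \<one>\<^bsub>A\<^esub>"
        by (rule face_sum_face_sum[OF \<mu>A ghk(2,3) l])
      then have "M \<otimes>\<^bsub>A\<^esub> inv\<^bsub>A\<^esub> face_sum Q A (\<lambda>x. face_sum Q A \<mu> (h # x)) (k # l) = \<one>\<^bsub>A\<^esub>"
        by (simp add: M_def)
      then have MM: "face_sum Q A (\<lambda>x. face_sum Q A \<mu> (h # x)) (k # l) = M"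
        using cl face_sum_closed[OF \<mu>h kl] by (metis A.inv_equality A.inv_inv A.inv_closed)
      have "face_sum Q A (fst (m x y)) (k # l)
          = face_sum Q A (\<lambda>l. act g (\<nu> l) \<otimes>\<^bsub>A\<^esub> face_sum Q A \<mu> (h # l) \<otimes>\<^bsub>A\<^esub> inv\<^bsub>A\<^esub> c (g # h # l)) (k # l)"
        by (rule face_sum_cong[OF _ kl]) (simp add: m_def g_def h_def \<mu>_def \<nu>_def)
      also have "\<dots> = face_sum Q A (\<lambda>l. act g (\<nu> l) \<otimes>\<^bsub>A\<^esub> face_sum Q A \<mu> (h # l)) (k # l) \<otimes>\<^bsub>A\<^esub> inv\<^bsub>A\<^esub> D"
        unfolding D_def face_sum_inv[OF cgh kl, symmetric]
        by (rule face_sum_mult[OF _ _ kl]) (use g\<nu> \<mu>h cgh in auto)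
      also have "face_sum Q A (\<lambda>l. act g (\<nu> l) \<otimes>\<^bsub>A\<^esub> face_sum Q A \<mu> (h # l)) (k # l) = V \<otimes>\<^bsub>A\<^esub> M"
        unfolding face_sum_mult[OF g\<nu> \<mu>h kl] MM V_def face_sum_hom[OF act(1)[OF ghk(1)] \<nu>A kl] ..
      finally have fs: "face_sum Q A (fst (m x y)) (k # l) = V \<otimes>\<^bsub>A\<^esub> M \<otimes>\<^bsub>A\<^esub> inv\<^bsub>A\<^esub> D" .
      have "act g (act h (\<rho> l) \<otimes>\<^bsub>A\<^esub> face_sum Q A \<nu> (k # l) \<otimes>\<^bsub>A\<^esub> inv\<^bsub>A\<^esub> c (h # k # l)) = U \<otimes>\<^bsub>A\<^esub> V \<otimes>\<^bsub>A\<^esub> inv\<^bsub>A\<^esub> X"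
        using cl act(4)[OF ghk(1,2) \<rho>l] by (simp add: U_def V_def X_def)
      moreover have "inv\<^bsub>A\<^esub> X \<otimes>\<^bsub>A\<^esub> inv\<^bsub>A\<^esub> Z = inv\<^bsub>A\<^esub> D \<otimes>\<^bsub>A\<^esub> inv\<^bsub>A\<^esub> Y"
      proof -
        have "X \<otimes>\<^bsub>A\<^esub> Z = Y \<otimes>\<^bsub>A\<^esub> D"
          using cl(5-7) by (simp add: XYZD A.inv_mult_group A.m_assoc)
        then have "inv\<^bsub>A\<^esub> (X \<otimes>\<^bsub>A\<^esub> Z) = inv\<^bsub>A\<^esub> (Y \<otimes>\<^bsub>A\<^esub> D)" by simp
        then show ?thesis using cl(4-7) by (simp add: A.inv_mult A.m_comm)
      qed
      ultimately show ?thesis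
        unfolding fs U_def[symmetric] M_def[symmetric] Y_def[symmetric] Z_def[symmetric]
        using cl by (simp add: A.m_ac)
    qed
    have "fst (m (m x y) z) = fst (m x (m y z))"
      by (auto simp: m_def[of "m x y" z] m_def[of x "m y z"] g_def[symmetric] h_def[symmetric] k_def[symmetric]
          \<mu>_def[symmetric] \<rho>_def[symmetric] intro!: restrict_ext)
         (use eq in \<open>simp add: m_def[of y z] m_def[of x y] g_def h_def k_def \<mu>_def \<nu>_def \<rho>_def\<close>)
    moreover have "snd (m (m x y) z) = snd (m x (m y z))"
      using ghk by (simp add: m_def g_def h_def k_def G.m_assoc)
    ultimately show ?thesis by (rule prod_eqI)
  qed
  \<comment> \<open>Once the second components agree, the terms involving x and c cancel, and the
    action of \<open>snd x\<close> on B is injective because the inverse element undoes it.\<close>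
  have cancel: "y = z" if xyz: "x \<in> S" "y \<in> S" "z \<in> S" and eq: "m x y = m x z" for x y z
  proof -
    note sx = S[OF xyz(1)] and sy = S[OF xyz(2)] and sz = S[OF xyz(3)]
    have snd: "snd y = snd z" using eq sx(2) sy(2) sz(2) by (simp add: m_def)
    have "fst y l = fst z l" if l: "l \<in> tuples Q r" for l
    proof -
      have yz: "fst y l \<in> B" "fst z l \<in> B" using sy(1) sz(1) l by auto
      have cl: "act (snd x) (fst y l) \<in> carrier A" "act (snd x) (fst z l) \<in> carrier A"
          "face_sum Q A (fst x) (snd z # l) \<in> carrier A" "c (snd x # snd z # l) \<in> carrier A"
        using act(2)[OF sx(2)] yz Bc face_sum_in_subgroup[OF B(1) sx(1), of "snd z # l"] c sx(2) sz(2) l by auto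
      have "fst (m x y) l = fst (m x z) l" using eq by simp
      then have "act (snd x) (fst y l) = act (snd x) (fst z l)"
        using l snd cl by (simp add: m_def)
      then have "act (inv\<^bsub>Q\<^esub> snd x) (act (snd x) (fst y l)) = act (inv\<^bsub>Q\<^esub> snd x) (act (snd x) (fst z l))" by simp
      then show ?thesis
        using act(3,4) sx(2) yz by (metis G.inv_closed G.l_inv)
    qed
    then have "fst y = fst z" using sy(3) sz(3) by (intro extensionalityI[of _ "tuples Q r"]) auto
    then show ?thesis using snd by (rule prod_eqI)
  qed
  obtain e where e: "e \<in> S" "m e e = e"
      "group \<lparr>carrier = {x \<in> S. m x e = x}, monoid.mult = m, one = e\<rparr>" (is "group ?W")
    by (rule left_cancellative_group[of S m, OF finS neS closed assoc cancel])
  have snd_m: "snd (m x y) = snd x \<otimes>\<^bsub>Q\<^esub> snd y" for x y by (simp add: m_def)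
  have "snd e = \<one>\<^bsub>Q\<^esub>"
    using snd_m[of e e] e(2) S(2)[OF e(1)] by (simp add: G.l_cancel_one')
  then have snd_e: "snd (m x e) = snd x" if "x \<in> S" for x using snd_m S(2)[OF that] by simp
  \<comment> \<open>Right multiplication by e maps S onto the group S e without changing the second
    component, so the group still surjects onto Q.\<close>
  have me: "m x e \<in> carrier ?W" if "x \<in> S" for x
    using closed[OF that e(1)] assoc[OF that e(1,1)] e(2) by simp
  obtain \<mu> where \<mu>: "\<mu> \<in> tuples Q r \<rightarrow>\<^sub>E B" using e(1) by (auto simp: S_def)
  have "carrier Q \<subseteq> snd ` carrier ?W"
  proof
    fix g assume "g \<in> carrier Q"
    then have "(\<mu>, g) \<in> S" using \<mu> by (simp add: S_def)
    then show "g \<in> snd ` carrier ?W" using me snd_e by (intro image_eqI[of _ _ "m (\<mu>, g) e"]) simp_all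
  qed
  then have Wim: "snd ` carrier ?W = carrier Q" using S(2) by auto
  have Whom: "snd \<in> hom ?W Q" using S(2) snd_m by (auto simp: hom_def)
  have Wfin: "finite (carrier ?W)" using finS by simp
  show ?thesis
  proof (rule that[of ?W, OF e(3) Wfin Whom Wim])
    fix x y l assume "x \<in> carrier ?W" "y \<in> carrier ?W" and l: "l \<in> tuples Q r"
    show "fst (x \<otimes>\<^bsub>?W\<^esub> y) l = act (snd x) (fst y l) \<otimes>\<^bsub>A\<^esub> face_sum Q A (fst x) (snd y # l)
        \<otimes>\<^bsub>A\<^esub> inv\<^bsub>A\<^esub> c (snd x # snd y # l)"
      by (simp only: monoid.simps m_def fst_conv restrict_apply'[OF l])
  next
    fix x assume "x \<in> carrier ?W"
    then have "x \<in> S" by simp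
    then show "fst x \<in> tuples Q r \<rightarrow> B" by (rule S(1))
  qed
qed

section \<open>Coboundaries on lists\<close>

text \<open>Passes from a list to the extensional tuple that a cochain takes as argument; the way
  back is \<open>map g [0..<k]\<close>.\<close>

definition tuple_of :: "'a list \<Rightarrow> nat \<Rightarrow> 'a" where
  "tuple_of l = (\<lambda>i \<in> {..<length l}. l ! i)"

lemma tuple_of_closed: "l \<in> tuples G k \<Longrightarrow> tuple_of l \<in> (\<Pi>\<^sub>E i \<in> {..<k}. carrier G)"
  by (auto simp: tuples_def tuple_of_def in_lists_conv_set)

lemma map_upt_tuples: "g \<in> (\<Pi>\<^sub>E i \<in> {..<k}. carrier G) \<Longrightarrow> map g [0..<k] \<in> tuples G k"
  unfolding tuples_def in_lists_conv_set by (simp add: PiE_iff)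

lemma tuple_of_map_upt: "g \<in> (\<Pi>\<^sub>E i \<in> {..<k}. carrier G) \<Longrightarrow> tuple_of (map g [0..<k]) = g"
  by (auto simp: tuple_of_def PiE_iff extensional_def restrict_def fun_eq_iff)

text \<open>Inner faces only. Of the two outer ones, dropping the last entry is
  \<open>butlast\<close>, and dropping the first goes with the action.\<close>

definition face :: "('a, 'b) monoid_scheme \<Rightarrow> nat \<Rightarrow> 'a list \<Rightarrow> 'a list" where
  "face G i l = take i l @ (l ! i \<otimes>\<^bsub>G\<^esub> l ! Suc i) # drop (Suc (Suc i)) l"

context coefficients
begin

lemma finprod_lessThan_Suc:
  assumes "h \<in> {..<Suc k} \<rightarrow> carrier A"
  shows "finprod A h {..<Suc k} = h 0 \<otimes>\<^bsub>A\<^esub> finprod A (\<lambda>i. h (Suc i)) {..<k}"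
proof -
  have "finprod A h (insert 0 (Suc ` {..<k})) = h 0 \<otimes>\<^bsub>A\<^esub> finprod A h (Suc ` {..<k})"
    using assms by (intro A.finprod_insert) auto
  also have "finprod A h (Suc ` {..<k}) = finprod A (\<lambda>i. h (Suc i)) {..<k}"
    using assms by (intro A.finprod_reindex) auto
  finally show ?thesis by (simp add: lessThan_Suc_eq_insert_0)
qed

lemma face_closed:
  assumes "l \<in> tuples G (Suc k)" "i < k"
  shows "face G i l \<in> tuples G k"
proof -
  have "l ! i \<in> carrier G" "l ! Suc i \<in> carrier G"
    using assms by (auto simp: tuples_def in_lists_conv_set)
  moreover have "set (take i l) \<subseteq> carrier G" "set (drop (Suc (Suc i)) l) \<subseteq> carrier G"
    using assms(1) set_take_subset[of i l] set_drop_subset[of "Suc (Suc i)" l]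
    by (auto simp: tuples_def in_lists_conv_set)
  ultimately show ?thesis
    using assms by (auto simp: tuples_def face_def in_lists_conv_set)
qed

text \<open>The recursion of the face sum inverts the tail, which turns the exponent e into -e; the
  induction therefore runs over all integers e, and the alternating signs come out of these
  changes.\<close>

lemma face_sum_eq_finprod:
  assumes "\<phi> \<in> tuples G k \<rightarrow> carrier A" "l \<in> tuples G (Suc k)"
  shows "fs \<phi> l [^]\<^bsub>A\<^esub> (e::int) =
    (\<Otimes>\<^bsub>A\<^esub> i \<in> {..<k}. \<phi> (face G i l) [^]\<^bsub>A\<^esub> (e * (- 1) ^ i)) \<otimes>\<^bsub>A\<^esub> \<phi> (butlast l) [^]\<^bsub>A\<^esub> (e * (- 1) ^ k)"
  using assms
proof (induction k arbitrary: \<phi> l e)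
  case 0
  then have "\<phi> [] \<in> carrier A" by auto
  then show ?case using 0 by (auto elim!: tuples_SucE)
next
  case (Suc k)
  obtain a b l' where l: "l = a # b # l'" "a \<in> carrier G" "b \<in> carrier G" "l' \<in> tuples G k"
    using Suc.prems(2) by (auto elim!: tuples_SucE)
  have \<phi>a: "(\<lambda>x. \<phi> (a # x)) \<in> tuples G k \<rightarrow> carrier A" using Suc.prems(1) l(2) by auto
  have bl: "b # l' \<in> tuples G (Suc k)" using l by simp
  define y where "y = fs (\<lambda>x. \<phi> (a # x)) (b # l')"
  have y: "y \<in> carrier A" unfolding y_def by (rule face_sum_closed[OF \<phi>a bl])
  have x: "\<phi> ((a \<otimes> b) # l') \<in> carrier A" using Suc.prems(1) l by auto
  have fcl: "\<phi> (face G i l) \<in> carrier A" if "i < Suc k" for i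
    using Suc.prems(1) face_closed[OF Suc.prems(2) that] by auto
  have fS: "face G (Suc i) l = a # face G i (b # l')" for i
    by (simp add: face_def l(1))
  have fcl': "\<phi> (a # face G i (b # l')) \<in> carrier A" if "i < k" for i
    using fcl[of "Suc i"] that by (simp add: fS)
  have "butlast (b # l') \<in> tuples G k"
    using bl in_set_butlastD[of _ "b # l'"]
    by (auto simp: tuples_def in_lists_conv_set simp del: butlast.simps)
  then have bcl: "\<phi> (a # butlast (b # l')) \<in> carrier A"
    using funcset_mem[OF \<phi>a] by blast
  have "fs \<phi> l [^]\<^bsub>A\<^esub> e = \<phi> ((a \<otimes> b) # l') [^]\<^bsub>A\<^esub> e \<otimes>\<^bsub>A\<^esub> y [^]\<^bsub>A\<^esub> (- e)"
    using x y by (simp add: l(1) y_def[symmetric] A.int_pow_distrib A.int_pow_neg A.int_pow_inv)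
  also have "y [^]\<^bsub>A\<^esub> (- e) = (\<Otimes>\<^bsub>A\<^esub> i \<in> {..<k}. \<phi> (a # face G i (b # l')) [^]\<^bsub>A\<^esub> (- e * (- 1) ^ i))
      \<otimes>\<^bsub>A\<^esub> \<phi> (a # butlast (b # l')) [^]\<^bsub>A\<^esub> (- e * (- 1) ^ k)"
    unfolding y_def by (rule Suc.IH[OF \<phi>a bl])
  also have "(\<Otimes>\<^bsub>A\<^esub> i \<in> {..<k}. \<phi> (a # face G i (b # l')) [^]\<^bsub>A\<^esub> (- e * (- 1) ^ i))
      = (\<Otimes>\<^bsub>A\<^esub> i \<in> {..<k}. \<phi> (face G (Suc i) l) [^]\<^bsub>A\<^esub> (e * (- 1) ^ Suc i))"
    by (intro A.finprod_cong') (auto simp: fS intro!: A.int_pow_closed fcl')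
  finally have "fs \<phi> l [^]\<^bsub>A\<^esub> e = \<phi> ((a \<otimes> b) # l') [^]\<^bsub>A\<^esub> e \<otimes>\<^bsub>A\<^esub>
      ((\<Otimes>\<^bsub>A\<^esub> i \<in> {..<k}. \<phi> (face G (Suc i) l) [^]\<^bsub>A\<^esub> (e * (- 1) ^ Suc i)) \<otimes>\<^bsub>A\<^esub> \<phi> (a # butlast (b # l')) [^]\<^bsub>A\<^esub> (- e * (- 1) ^ k))" .
  also have "\<dots> = (\<phi> (face G 0 l) [^]\<^bsub>A\<^esub> (e * (- 1) ^ 0) \<otimes>\<^bsub>A\<^esub>
      (\<Otimes>\<^bsub>A\<^esub> i \<in> {..<k}. \<phi> (face G (Suc i) l) [^]\<^bsub>A\<^esub> (e * (- 1) ^ Suc i))) \<otimes>\<^bsub>A\<^esub> \<phi> (butlast l) [^]\<^bsub>A\<^esub> (e * (- 1) ^ Suc k)"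
  proof -
    have "(\<Otimes>\<^bsub>A\<^esub> i \<in> {..<k}. \<phi> (face G (Suc i) l) [^]\<^bsub>A\<^esub> (e * (- 1) ^ Suc i)) \<in> carrier A"
      by (intro A.finprod_closed) (auto simp: fS intro!: A.int_pow_closed fcl')
    moreover have "face G 0 l = (a \<otimes> b) # l'" "butlast l = a # butlast (b # l')" by (simp_all add: face_def l(1))
    ultimately show ?thesis using x bcl by (simp only: A.m_assoc A.int_pow_closed) simp
  qed
  also have "\<phi> (face G 0 l) [^]\<^bsub>A\<^esub> (e * (- 1) ^ 0) \<otimes>\<^bsub>A\<^esub>
      (\<Otimes>\<^bsub>A\<^esub> i \<in> {..<k}. \<phi> (face G (Suc i) l) [^]\<^bsub>A\<^esub> (e * (- 1) ^ Suc i))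
      = (\<Otimes>\<^bsub>A\<^esub> i \<in> {..<Suc k}. \<phi> (face G i l) [^]\<^bsub>A\<^esub> (e * (- 1) ^ i))"
    by (rule finprod_lessThan_Suc[symmetric]) (use fcl in auto)
  finally show ?case .
qed

text \<open>The expansion of the face sum with exponent -1 has exactly the signs that the definition
  of \<open>cobdry\<close> attaches to all faces except the first.\<close>

lemma cobdry_eq_face_sum:
  assumes \<phi>: "\<phi> \<in> (\<Pi>\<^sub>E i \<in> {..<k}. carrier G) \<rightarrow> carrier A" and g: "g \<in> (\<Pi>\<^sub>E i \<in> {..<Suc k}. carrier G)"
    and act: "act (g 0) \<in> carrier A \<rightarrow> carrier A"
  shows "cobdry G A act k \<phi> g = act (g 0) (\<phi> (tuple_of (tl (map g [0..<Suc k]))))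
    \<otimes>\<^bsub>A\<^esub> inv\<^bsub>A\<^esub> fs (\<lambda>l. \<phi> (tuple_of l)) (map g [0..<Suc k])"
proof -
  define L where "L = map g [0..<Suc k]"
  have L: "L \<in> tuples G (Suc k)" unfolding L_def by (rule map_upt_tuples[OF g])
  have len: "length L = Suc k" by (simp add: L_def)
  have nth: "L ! i = g i" if "i < Suc k" for i using that by (simp add: L_def del: upt_Suc)
  have \<phi>': "(\<lambda>l. \<phi> (tuple_of l)) \<in> tuples G k \<rightarrow> carrier A"
    using \<phi> tuple_of_closed[of _ G k] by auto
  have face: "tuple_of (face G i L) = (\<lambda>j \<in> {..<k}. if j < i then g j else if j = i then g j \<otimes> g (Suc j) else g (Suc j))"
    if "i < k" for i
  proof
    fix j
    have "length (face G i L) = k" using that len by (simp add: face_def)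
    moreover have "face G i L ! j = (if j < i then g j else if j = i then g j \<otimes> g (Suc j) else g (Suc j))" if "j < k"
      using that \<open>i < k\<close> len by (auto simp: face_def nth_append nth nth_Cons')
    ultimately show "tuple_of (face G i L) j = (\<lambda>j \<in> {..<k}. if j < i then g j else if j = i then g j \<otimes> g (Suc j) else g (Suc j)) j"
      by (auto simp: tuple_of_def)
  qed
  have fcl: "\<phi> (tuple_of (face G i L)) \<in> carrier A" if "i < k" for i
    using funcset_mem[OF \<phi>' face_closed[OF L that]] .
  have but: "tuple_of (butlast L) = (\<lambda>j \<in> {..<k}. g j)"
    using len by (auto simp: tuple_of_def nth_butlast nth restrict_def fun_eq_iff)
  have tl: "tuple_of (tl L) = (\<lambda>j \<in> {..<k}. g (Suc j))"
    using len by (auto simp: tuple_of_def nth_tl nth restrict_def fun_eq_iff)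
  have cl: "fs (\<lambda>l. \<phi> (tuple_of l)) L \<in> carrier A" by (rule face_sum_closed[OF \<phi>' L])
  have "inv\<^bsub>A\<^esub> fs (\<lambda>l. \<phi> (tuple_of l)) L = fs (\<lambda>l. \<phi> (tuple_of l)) L [^]\<^bsub>A\<^esub> (- 1 :: int)"
    using cl A.int_pow_neg[OF cl, of 1] A.int_pow_1[OF cl] by simp
  also have "\<dots> = (\<Otimes>\<^bsub>A\<^esub> i \<in> {..<k}. \<phi> (tuple_of (face G i L)) [^]\<^bsub>A\<^esub> ((- 1) * (- 1) ^ i :: int))
      \<otimes>\<^bsub>A\<^esub> \<phi> (tuple_of (butlast L)) [^]\<^bsub>A\<^esub> ((- 1) * (- 1) ^ k :: int)"
    by (rule face_sum_eq_finprod[OF \<phi>' L])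
  also have "(\<Otimes>\<^bsub>A\<^esub> i \<in> {..<k}. \<phi> (tuple_of (face G i L)) [^]\<^bsub>A\<^esub> ((- 1) * (- 1) ^ i :: int))
      = (\<Otimes>\<^bsub>A\<^esub> i \<in> {..<k}. \<phi> (\<lambda>j \<in> {..<k}. if j < i then g j else if j = i then g j \<otimes> g (Suc j) else g (Suc j))
            [^]\<^bsub>A\<^esub> ((- 1) ^ Suc i :: int))"
    by (intro A.finprod_cong') (auto simp: face[symmetric] intro!: A.int_pow_closed fcl)
  finally have *: "inv\<^bsub>A\<^esub> fs (\<lambda>l. \<phi> (tuple_of l)) L = (\<Otimes>\<^bsub>A\<^esub> i \<in> {..<k}. \<phi> (\<lambda>j \<in> {..<k}. if j < i then g j else if j = i then g j \<otimes> g (Suc j) else g (Suc j))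
            [^]\<^bsub>A\<^esub> ((- 1) ^ Suc i :: int)) \<otimes>\<^bsub>A\<^esub> \<phi> (\<lambda>j \<in> {..<k}. g j) [^]\<^bsub>A\<^esub> ((- 1) ^ Suc k :: int)"
    by (simp only: but power_Suc)
  have tlL: "tl L \<in> tuples G k" using L by (auto elim!: tuples_SucE)
  have "act (g 0) (\<phi> (tuple_of (tl L))) \<in> carrier A"
    using act \<phi>' tlL by auto
  moreover have "(\<Otimes>\<^bsub>A\<^esub> i \<in> {..<k}. \<phi> (\<lambda>j \<in> {..<k}. if j < i then g j else if j = i then g j \<otimes> g (Suc j) else g (Suc j))
            [^]\<^bsub>A\<^esub> ((- 1) ^ Suc i :: int)) \<in> carrier A"
    by (intro A.finprod_closed) (auto simp: face[symmetric] intro!: A.int_pow_closed fcl)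
  moreover have "\<phi> (\<lambda>j \<in> {..<k}. g j) [^]\<^bsub>A\<^esub> ((- 1) ^ Suc k :: int) \<in> carrier A"
  proof -
    have "(\<lambda>j \<in> {..<k}. g j) \<in> (\<Pi>\<^sub>E i \<in> {..<k}. carrier G)"
      by (rule restrict_PiE_iff[THEN iffD2]) (use PiE_mem[OF g] in simp)
    then show ?thesis by (rule A.int_pow_closed[OF funcset_mem[OF \<phi>]])
  qed
  moreover have "cobdry G A act k \<phi> g = act (g 0) (\<phi> (tuple_of (tl L)))
      \<otimes>\<^bsub>A\<^esub> (\<Otimes>\<^bsub>A\<^esub> i \<in> {..<k}. \<phi> (\<lambda>j \<in> {..<k}. if j < i then g j else if j = i then g j \<otimes> g (Suc j) else g (Suc j))
            [^]\<^bsub>A\<^esub> ((- 1) ^ Suc i :: int))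
      \<otimes>\<^bsub>A\<^esub> \<phi> (\<lambda>j \<in> {..<k}. g j) [^]\<^bsub>A\<^esub> ((- 1) ^ Suc k :: int)"
    unfolding tl by (simp only: cobdry_def restrict_apply'[OF g])
  ultimately show ?thesis
    unfolding L_def[symmetric] * by (simp only: A.m_assoc)
qed

end

section \<open>Projectivity\<close>

text \<open>Adjoining a torsion element a to a finite subgroup B of an abelian group yields the
  products a^k b, in which k matters only modulo an exponent m of a.\<close>

lemma (in comm_group) finite_generate_torsion:
  assumes "finite S" "S \<subseteq> carrier G" "\<And>a. a \<in> S \<Longrightarrow> \<exists>m::nat. m > 0 \<and> a [^] m = \<one>"
  shows "finite (generate G S)"
  using assms
proof (induction S)
  case empty
  then show ?case by (simp add: generate_empty)
next
  case (insert a S)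
  define B where "B = generate G S"
  have B: "subgroup B G" unfolding B_def using insert.prems(1) by (intro generate_is_subgroup) auto
  have finB: "finite B" unfolding B_def using insert by auto
  have a: "a \<in> carrier G" using insert.prems(1) by simp
  obtain m :: nat where m: "m > 0" "a [^] m = \<one>" using insert.prems(2) by blast
  have mod: "a [^] k = a [^] (k mod int m)" for k :: int
  proof -
    have "a [^] k = a [^] (int m * (k div int m) + k mod int m)" by simp
    also have "\<dots> = (a [^] int m) [^] (k div int m) \<otimes> a [^] (k mod int m)"
      using a by (simp only: int_pow_mult int_pow_pow)
    finally show ?thesis using m(2) a by (simp add: int_pow_int int_pow_one)
  qed
  define T where "T = {a [^] (k::int) \<otimes> b | k b. b \<in> B}"
  have "T \<subseteq> (\<lambda>(k, b). a [^] (k::int) \<otimes> b) ` ({0..<int m} \<times> B)"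
  proof
    fix x assume "x \<in> T"
    then obtain k b where x: "x = a [^] (k::int) \<otimes> b" "b \<in> B" by (auto simp: T_def)
    then show "x \<in> (\<lambda>(k, b). a [^] (k::int) \<otimes> b) ` ({0..<int m} \<times> B)"
      using m(1) mod[of k] by (intro image_eqI[of _ _ "(k mod int m, b)"]) auto
  qed
  then have finT: "finite T" by (rule finite_subset) (use finB in auto)
  have "subgroup T G"
  proof (rule subgroupI)
    show "T \<subseteq> carrier G" using a subgroup.mem_carrier[OF B] by (auto simp: T_def)
    show "T \<noteq> {}" using subgroup.one_closed[OF B] by (auto simp: T_def)
  next
    fix x assume "x \<in> T"
    then obtain k b where x: "x = a [^] (k::int) \<otimes> b" "b \<in> B" by (auto simp: T_def)
    then have "inv x = a [^] (- k) \<otimes> inv b" using a subgroup.mem_carrier[OF B] by (simp add: inv_mult int_pow_neg)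
    then show "inv x \<in> T" using subgroup.m_inv_closed[OF B x(2)] unfolding T_def by blast
  next
    fix x y assume "x \<in> T" "y \<in> T"
    then obtain k b j d where xy: "x = a [^] (k::int) \<otimes> b" "b \<in> B" "y = a [^] (j::int) \<otimes> d" "d \<in> B" by (auto simp: T_def)
    have "x \<otimes> y = a [^] (k + j) \<otimes> (b \<otimes> d)"
      using a xy subgroup.mem_carrier[OF B] by (simp add: int_pow_mult m_ac)
    then show "x \<otimes> y \<in> T" using subgroup.m_closed[OF B xy(2,4)] unfolding T_def by blast
  qed
  moreover have "insert a S \<subseteq> T"
  proof
    fix x assume "x \<in> insert a S"
    then consider "x = a" | "x \<in> S" by blast
    then show "x \<in> T"
    proof cases
      case 1
      then have "x = a [^] (1::int) \<otimes> \<one>" using a by (simp add: int_pow_1)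
      then show ?thesis using subgroup.one_closed[OF B] unfolding T_def by blast
    next
      case 2
      then have "x = a [^] (0::int) \<otimes> x" "x \<in> B" using insert.prems(1) by (auto simp: B_def intro: generate.incl)
      then show ?thesis unfolding T_def by blast
    qed
  qed
  ultimately have "generate G (insert a S) \<subseteq> T" using generate_subgroup_incl by blast
  then show ?case using finT finite_subset by blast
qed

section \<open>From cocycles that are coboundaries to vanishing cohomology\<close>

lemma map_tuple_of: "map (tuple_of l) [0..<length l] = l"
  by (rule nth_equalityI) (auto simp: tuple_of_def)

lemma cochains_closed:
  assumes "topspace T = carrier G" "\<phi> \<in> carrier (cochains G T A k)"
  shows "\<phi> \<in> (\<Pi>\<^sub>E i \<in> {..<k}. carrier G) \<rightarrow> carrier A"
  using assms by (auto simp: cochains_def continuous_map_def)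

text \<open>With cocycles among the coboundaries H, every coset that occurs is a translate of H by
  one of its own elements, hence H itself. So it suffices that H absorbs its elements, which follows
  from the coboundary being multiplicative on cochains.\<close>

lemma trivial_cohomology:
  fixes A :: "'m monoid"
  assumes ts: "topspace T = carrier G" and GA: "coefficients G A"
    and act: "\<And>g. g \<in> carrier G \<Longrightarrow> act g \<in> hom A A"
    and sub: "cocycles G T A act (Suc k) \<subseteq> coboundaries G T A act (Suc k)"
  shows "primary_component p (cohomology_group G T A act (Suc k)) = {\<one>\<^bsub>cohomology_group G T A act (Suc k)\<^esub>}"
proof -
  interpret coefficients G A by (rule GA)
  let ?C = "cochains G T A"
  let ?X = "\<lambda>k. \<Pi>\<^sub>E i \<in> {..<k::nat}. carrier G"
  define H where "H = cobdry G A act k ` carrier (?C k)"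
  have cb: "coboundaries G T A act (Suc k) = H" by (simp add: coboundaries_def H_def)
  have tsX: "topspace (product_topology (\<lambda>_. T) {..<j}) = ?X j" for j by (simp add: ts)
  note cl = cochains_closed[OF ts]
  have mult_ap: "(\<phi> \<otimes>\<^bsub>?C j\<^esub> \<psi>) x = \<phi> x \<otimes>\<^bsub>A\<^esub> \<psi> x" if "x \<in> ?X j" for \<phi> \<psi> x j
    using that by (simp add: cochains_def)
  have ccont: "(\<lambda>x \<in> ?X j. F (\<phi> x) (\<psi> x)) \<in> carrier (?C j)"
    if \<phi>: "\<phi> \<in> carrier (?C j)" and \<psi>: "\<psi> \<in> carrier (?C j)"
      and F: "\<And>a b. \<lbrakk>a \<in> carrier A; b \<in> carrier A\<rbrakk> \<Longrightarrow> F a b \<in> carrier A" for \<phi> \<psi> F j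
  proof -
    have c: "continuous_map (product_topology (\<lambda>_. T) {..<j}) (discrete_topology (carrier A)) \<phi>"
        "continuous_map (product_topology (\<lambda>_. T) {..<j}) (discrete_topology (carrier A)) \<psi>"
      using \<phi> \<psi> by (auto simp: cochains_def)
    have "continuous_map (product_topology (\<lambda>_. T) {..<j}) (discrete_topology (carrier A)) (\<lambda>x \<in> ?X j. F (\<phi> x) (\<psi> x))"
    proof (rule continuous_map_into_discreteI)
      fix x assume x: "x \<in> topspace (product_topology (\<lambda>_. T) {..<j})"
      then show "(\<lambda>x \<in> ?X j. F (\<phi> x) (\<psi> x)) x \<in> carrier A"
        unfolding tsX using F[OF funcset_mem[OF cl[OF \<phi>], of x] funcset_mem[OF cl[OF \<psi>], of x]] by simp
      let ?U = "{y \<in> topspace (product_topology (\<lambda>_. T) {..<j}). \<phi> y = \<phi> x} \<inter> {y \<in> topspace (product_topology (\<lambda>_. T) {..<j}). \<psi> y = \<psi> x}"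
      have "openin (product_topology (\<lambda>_. T) {..<j}) ?U"
        by (intro openin_Int openin_discrete_fiber[OF c(1) x] openin_discrete_fiber[OF c(2) x])
      moreover have "x \<in> ?U" using x by blast
      moreover have "\<forall>y \<in> ?U. (\<lambda>x \<in> ?X j. F (\<phi> x) (\<psi> x)) y = (\<lambda>x \<in> ?X j. F (\<phi> x) (\<psi> x)) x"
        using x unfolding tsX by simp
      ultimately show "\<exists>U. openin (product_topology (\<lambda>_. T) {..<j}) U \<and> x \<in> U \<and>
          (\<forall>y \<in> U. (\<lambda>x \<in> ?X j. F (\<phi> x) (\<psi> x)) y = (\<lambda>x \<in> ?X j. F (\<phi> x) (\<psi> x)) x)" by blast
    qed
    then show ?thesis by (simp add: cochains_def)
  qed
  have one: "\<one>\<^bsub>?C j\<^esub> \<in> carrier (?C j)" for j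
  proof -
    have "continuous_map (product_topology (\<lambda>_. T) {..<j}) (discrete_topology (carrier A)) (\<lambda>x \<in> ?X j. \<one>\<^bsub>A\<^esub>)"
      by (rule continuous_map_eq[of _ _ "\<lambda>_. \<one>\<^bsub>A\<^esub>"]) (auto simp: tsX ts)
    then show ?thesis by (simp add: cochains_def)
  qed
  have multC: "\<phi> \<otimes>\<^bsub>?C j\<^esub> \<psi> \<in> carrier (?C j)" if "\<phi> \<in> carrier (?C j)" "\<psi> \<in> carrier (?C j)" for \<phi> \<psi> j
    using ccont[OF that, of "\<lambda>a b. a \<otimes>\<^bsub>A\<^esub> b"] by (simp add: cochains_def)
  have d_mult: "cobdry G A act k (\<phi> \<otimes>\<^bsub>?C k\<^esub> \<psi>) = cobdry G A act k \<phi> \<otimes>\<^bsub>?C (Suc k)\<^esub> cobdry G A act k \<psi>"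
    if \<phi>: "\<phi> \<in> carrier (?C k)" and \<psi>: "\<psi> \<in> carrier (?C k)" for \<phi> \<psi>
  proof (rule extensionalityI[of _ "?X (Suc k)"])
    show "cobdry G A act k (\<phi> \<otimes>\<^bsub>?C k\<^esub> \<psi>) \<in> extensional (?X (Suc k))" by (simp add: cobdry_def)
    show "cobdry G A act k \<phi> \<otimes>\<^bsub>?C (Suc k)\<^esub> cobdry G A act k \<psi> \<in> extensional (?X (Suc k))" by (simp add: cochains_def)
    fix g assume g: "g \<in> ?X (Suc k)"
    let ?L = "map g [0..<Suc k]"
    have g0: "g 0 \<in> carrier G" using g by auto
    have L: "?L \<in> tuples G (Suc k)" by (rule map_upt_tuples[OF g])
    have tlL: "tuple_of (tl ?L) \<in> ?X k"
      by (rule tuple_of_closed) (use L in \<open>auto elim!: tuples_SucE simp del: upt_Suc\<close>)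
    have actc: "act (g 0) \<in> carrier A \<rightarrow> carrier A" using act[OF g0] by (auto simp: hom_def)
    have l\<phi>: "(\<lambda>l. \<phi> (tuple_of l)) \<in> tuples G k \<rightarrow> carrier A" and l\<psi>: "(\<lambda>l. \<psi> (tuple_of l)) \<in> tuples G k \<rightarrow> carrier A"
      using funcset_mem[OF cl[OF \<phi>] tuple_of_closed] funcset_mem[OF cl[OF \<psi>] tuple_of_closed] by blast+
    have "face_sum G A (\<lambda>l. (\<phi> \<otimes>\<^bsub>?C k\<^esub> \<psi>) (tuple_of l)) ?L = face_sum G A (\<lambda>l. \<phi> (tuple_of l) \<otimes>\<^bsub>A\<^esub> \<psi> (tuple_of l)) ?L"
      by (rule face_sum_cong[OF _ L]) (rule mult_ap[OF tuple_of_closed])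
    also have "\<dots> = face_sum G A (\<lambda>l. \<phi> (tuple_of l)) ?L \<otimes>\<^bsub>A\<^esub> face_sum G A (\<lambda>l. \<psi> (tuple_of l)) ?L"
      by (rule face_sum_mult[OF l\<phi> l\<psi> L])
    finally have fs: "face_sum G A (\<lambda>l. (\<phi> \<otimes>\<^bsub>?C k\<^esub> \<psi>) (tuple_of l)) ?L
        = face_sum G A (\<lambda>l. \<phi> (tuple_of l)) ?L \<otimes>\<^bsub>A\<^esub> face_sum G A (\<lambda>l. \<psi> (tuple_of l)) ?L" .
    have c: "\<phi> (tuple_of (tl ?L)) \<in> carrier A" "\<psi> (tuple_of (tl ?L)) \<in> carrier A"
      using funcset_mem[OF cl[OF \<phi>] tlL] funcset_mem[OF cl[OF \<psi>] tlL] by blast+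
    have fc: "face_sum G A (\<lambda>l. \<phi> (tuple_of l)) ?L \<in> carrier A" "face_sum G A (\<lambda>l. \<psi> (tuple_of l)) ?L \<in> carrier A"
      by (rule face_sum_closed[OF l\<phi> L], rule face_sum_closed[OF l\<psi> L])
    have am: "act (g 0) (\<phi> (tuple_of (tl ?L)) \<otimes>\<^bsub>A\<^esub> \<psi> (tuple_of (tl ?L)))
        = act (g 0) (\<phi> (tuple_of (tl ?L))) \<otimes>\<^bsub>A\<^esub> act (g 0) (\<psi> (tuple_of (tl ?L)))"
      by (rule hom_mult[OF act[OF g0] c])
    have ac: "act (g 0) (\<phi> (tuple_of (tl ?L))) \<in> carrier A" "act (g 0) (\<psi> (tuple_of (tl ?L))) \<in> carrier A"
      using funcset_mem[OF actc] c by blast+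
    have "cobdry G A act k (\<phi> \<otimes>\<^bsub>?C k\<^esub> \<psi>) g = (act (g 0) (\<phi> (tuple_of (tl ?L))) \<otimes>\<^bsub>A\<^esub> act (g 0) (\<psi> (tuple_of (tl ?L))))
        \<otimes>\<^bsub>A\<^esub> inv\<^bsub>A\<^esub> (face_sum G A (\<lambda>l. \<phi> (tuple_of l)) ?L \<otimes>\<^bsub>A\<^esub> face_sum G A (\<lambda>l. \<psi> (tuple_of l)) ?L)"
      using cobdry_eq_face_sum[of "\<phi> \<otimes>\<^bsub>?C k\<^esub> \<psi>" k g act, OF cl[OF multC[OF \<phi> \<psi>]] g actc]
      by (simp only: fs mult_ap[OF tlL] am)
    also have "\<dots> = cobdry G A act k \<phi> g \<otimes>\<^bsub>A\<^esub> cobdry G A act k \<psi> g"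
      using cobdry_eq_face_sum[of \<phi> k g act, OF cl[OF \<phi>] g actc] cobdry_eq_face_sum[of \<psi> k g act, OF cl[OF \<psi>] g actc] ac fc
      by (simp add: A.inv_mult A.m_ac del: upt_Suc)
    finally show "cobdry G A act k (\<phi> \<otimes>\<^bsub>?C k\<^esub> \<psi>) g = (cobdry G A act k \<phi> \<otimes>\<^bsub>?C (Suc k)\<^esub> cobdry G A act k \<psi>) g"
      by (simp only: mult_ap[OF g])
  qed
  have absorb: "(\<lambda>h. h \<otimes>\<^bsub>?C (Suc k)\<^esub> a) ` H = H" if a: "a \<in> H" for a
  proof -
    obtain \<beta> where \<beta>: "\<beta> \<in> carrier (?C k)" "a = cobdry G A act k \<beta>" using a by (auto simp: H_def)
    have "h \<otimes>\<^bsub>?C (Suc k)\<^esub> a \<in> H" if h: "h \<in> H" for h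
    proof -
      obtain \<gamma> where \<gamma>: "\<gamma> \<in> carrier (?C k)" "h = cobdry G A act k \<gamma>" using h by (auto simp: H_def)
      show ?thesis
        unfolding \<gamma>(2) \<beta>(2) d_mult[OF \<gamma>(1) \<beta>(1), symmetric] H_def
        by (rule imageI[OF multC[OF \<gamma>(1) \<beta>(1)]])
    qed
    moreover have "h \<in> (\<lambda>h. h \<otimes>\<^bsub>?C (Suc k)\<^esub> a) ` H" if h: "h \<in> H" for h
    proof -
      obtain \<gamma> where \<gamma>: "\<gamma> \<in> carrier (?C k)" "h = cobdry G A act k \<gamma>" using h by (auto simp: H_def)
      \<comment> \<open>The quotient of the two cochains: its coboundary times a is h, so
        translation by a is onto H.\<close>
      define \<delta> where "\<delta> = (\<lambda>x \<in> ?X k. \<gamma> x \<otimes>\<^bsub>A\<^esub> inv\<^bsub>A\<^esub> \<beta> x)"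
      have \<delta>: "\<delta> \<in> carrier (?C k)" unfolding \<delta>_def by (rule ccont[OF \<gamma>(1) \<beta>(1)]) simp
      have "\<delta> \<otimes>\<^bsub>?C k\<^esub> \<beta> = \<gamma>"
      proof (rule extensionalityI[of _ "?X k"])
        show "\<gamma> \<in> extensional (?X k)" using \<gamma>(1) by (simp add: cochains_def)
        fix x assume x: "x \<in> ?X k"
        then have "\<gamma> x \<in> carrier A" "\<beta> x \<in> carrier A" using cl[OF \<gamma>(1)] cl[OF \<beta>(1)] by auto
        then show "(\<delta> \<otimes>\<^bsub>?C k\<^esub> \<beta>) x = \<gamma> x" unfolding mult_ap[OF x] using x by (simp add: \<delta>_def A.m_assoc)
      qed (simp add: cochains_def)
      then have "h = cobdry G A act k \<delta> \<otimes>\<^bsub>?C (Suc k)\<^esub> a" using d_mult[OF \<delta> \<beta>(1)] \<gamma>(2) \<beta>(2) by simp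
      then show ?thesis using \<delta> unfolding H_def by blast
    qed
    ultimately show ?thesis by blast
  qed
  have d_one: "cobdry G A act j \<one>\<^bsub>?C j\<^esub> = \<one>\<^bsub>?C (Suc j)\<^esub>" for j
  proof (rule extensionalityI[of _ "?X (Suc j)"])
    fix g assume g: "g \<in> ?X (Suc j)"
    let ?L = "map g [0..<Suc j]"
    have g0: "g 0 \<in> carrier G" using g by auto
    interpret a: group_hom A A "act (g 0)" using act[OF g0] by unfold_locales
    have actc: "act (g 0) \<in> carrier A \<rightarrow> carrier A" using act[OF g0] by (auto simp: hom_def)
    have L: "?L \<in> tuples G (Suc j)" by (rule map_upt_tuples[OF g])
    have tlL: "tuple_of (tl ?L) \<in> ?X j"
      by (rule tuple_of_closed) (use L in \<open>auto elim!: tuples_SucE simp del: upt_Suc\<close>)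
    have o: "(\<lambda>_. \<one>\<^bsub>A\<^esub>) \<in> tuples G j \<rightarrow> carrier A" by simp
    have "face_sum G A (\<lambda>l. \<one>\<^bsub>?C j\<^esub> (tuple_of l)) ?L = face_sum G A (\<lambda>_. \<one>\<^bsub>A\<^esub>) ?L"
      by (rule face_sum_cong[OF _ L]) (use tuple_of_closed[of _ G j] in \<open>simp add: cochains_def\<close>)
    also have "\<dots> = \<one>\<^bsub>A\<^esub>"
      using face_sum_mult[OF o o L] face_sum_closed[OF o L] by (simp del: upt_Suc)
    finally have "cobdry G A act j \<one>\<^bsub>?C j\<^esub> g = act (g 0) (\<one>\<^bsub>?C j\<^esub> (tuple_of (tl ?L))) \<otimes>\<^bsub>A\<^esub> inv\<^bsub>A\<^esub> \<one>\<^bsub>A\<^esub>"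
      using cobdry_eq_face_sum[of "\<one>\<^bsub>?C j\<^esub>" j g act, OF cl[OF one] g actc] by (simp only:)
    moreover have "\<one>\<^bsub>?C j\<^esub> (tuple_of (tl ?L)) = \<one>\<^bsub>A\<^esub>" using tlL by (simp add: cochains_def del: upt_Suc)
    ultimately show "cobdry G A act j \<one>\<^bsub>?C j\<^esub> g = \<one>\<^bsub>?C (Suc j)\<^esub> g" using g by (simp add: cochains_def)
  qed (simp_all add: cobdry_def cochains_def)
  have oneH: "\<one>\<^bsub>?C (Suc k)\<^esub> \<in> H" unfolding d_one[symmetric] H_def using one by (rule imageI)
  have HH: "H <#>\<^bsub>?C (Suc k)\<^esub> H = H"
    using absorb oneH unfolding set_mult_def by fastforce
  \<comment> \<open>The trivial cochain is a cocycle, so the set of cosets is not empty and is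
    exactly the singleton of H.\<close>
  have "\<one>\<^bsub>?C (Suc k)\<^esub> \<in> cocycles G T A act (Suc k)"
    using one d_one by (simp add: cocycles_def kernel_def)
  then have ne: "cocycles G T A act (Suc k) \<noteq> {}" by blast
  let ?M = "cohomology_group G T A act (Suc k)"
  have M: "?M = (?C (Suc k))\<lparr>carrier := cocycles G T A act (Suc k)\<rparr> Mod H"
    by (simp add: cohomology_group_def cb)
  have "carrier ?M = (\<lambda>a. (\<lambda>h. h \<otimes>\<^bsub>?C (Suc k)\<^esub> a) ` H) ` cocycles G T A act (Suc k)"
    unfolding M carrier_FactGroup by (auto simp: r_coset_def image_def)
  also have "\<dots> = {H}" using absorb sub ne unfolding cb by blast
  finally have car: "carrier ?M = {H}" .
  have oneM: "\<one>\<^bsub>?M\<^esub> = H" unfolding M by (rule one_FactGroup)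
  \<comment> \<open>The only class is already the identity, so the exponent p^0 = 1 places it in the
    primary component.\<close>
  have "H [^]\<^bsub>?M\<^esub> (p ^ 0) = H"
    using HH oneM by (simp add: nat_pow_def M mult_FactGroup One_nat_def)
  then show ?thesis unfolding primary_component_def car oneM by blast
qed

section \<open>Periodic lifts and cocycles on P\<close>

context hnn
begin

text \<open>A homomorphism from F is a point of the finite set of n-tuples in W, so two of the
  iterates coincide. Steps of length m keep them lifts of a map with period m; for automorphisms m =
  1 is taken.\<close>

lemma finitely_many_iterates:
  assumes W: "group W" "finite (carrier W)" and g: "g \<in> hom F W"
  obtains a b where "a < b" "\<And>w. w \<in> carrier F \<Longrightarrow> g ((f ^^ (m * b)) w) = g ((f ^^ (m * a)) w)"
proof -
  have gj: "(\<lambda>w. g ((f ^^ j) w)) \<in> hom F W" for j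
    using Group.hom_compose[OF funpow_hom g] by (simp add: comp_def)
  define v where "v j = (\<lambda>i \<in> {1..n}. g ((f ^^ (m * j)) (free_gen i)))" for j
  have "v j \<in> {1..n} \<rightarrow>\<^sub>E carrier W" for j
    using hom_in_carrier[OF gj] free_gen_F by (auto simp: v_def)
  then have "finite (range v)"
    using W(2) by (intro finite_subset[OF _ finite_PiE[of "{1..n}" "\<lambda>_. carrier W"]]) auto
  then have "\<not> inj v" using finite_imageD infinite_UNIV_nat by blast
  then obtain a b where "a < b" "v a = v b"
    unfolding inj_def by (metis linorder_neqE_nat)
  have "g ((f ^^ (m * b)) w) = g ((f ^^ (m * a)) w)" if "w \<in> carrier F" for w
  proof (rule free_group_hom_eq[OF W(1) gj gj _ that])
    fix i assume "i \<in> {1..n}"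
    then show "g ((f ^^ (m * b)) (free_gen i)) = g ((f ^^ (m * a)) (free_gen i))"
      using fun_cong[OF \<open>v a = v b\<close>, of i] by (simp add: v_def)
  qed
  then show ?thesis using that \<open>a < b\<close> by blast
qed

text \<open>Among the lifts \<open>g \<circ> f\<^sup>m\<^sup>j\<close> of \<open>\<beta> = \<beta> \<circ> f\<^sup>m\<close> only finitely many are different, so some lift is
  periodic under \<open>f\<close>.\<close>

lemma periodic_lift:
  assumes W: "group W" "finite (carrier W)" and Q: "group Q" and \<pi>: "\<pi> \<in> hom W Q"
    and \<beta>: "\<beta> \<in> hom F Q" "\<beta> ` carrier F \<subseteq> \<pi> ` carrier W"
    and m: "m > 0" "\<And>w. w \<in> carrier F \<Longrightarrow> \<beta> ((f ^^ m) w) = \<beta> w"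
  obtains g k where "g \<in> hom F W" "\<And>w. w \<in> carrier F \<Longrightarrow> \<pi> (g w) = \<beta> w"
    "k > 0" "\<And>w. w \<in> carrier F \<Longrightarrow> g ((f ^^ k) w) = g w"
proof -
  have "\<exists>x \<in> carrier W. \<pi> x = \<beta> (free_gen i)" if "i \<in> {1..n}" for i
  proof -
    have "\<beta> (free_gen i) \<in> \<pi> ` carrier W" using \<beta>(2) free_gen_F[OF that] by blast
    then show ?thesis by (auto simp: image_iff)
  qed
  then obtain s where s: "\<And>i. i \<in> {1..n} \<Longrightarrow> s i \<in> carrier W" "\<And>i. i \<in> {1..n} \<Longrightarrow> \<pi> (s i) = \<beta> (free_gen i)"
    by metis
  have sf: "s \<in> {1..n} \<rightarrow> carrier W" using s(1) by blast
  define g0 where "g0 = word_eval W s"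
  have g0: "g0 \<in> hom F W" unfolding g0_def by (rule word_eval_hom[OF W(1) sf])
  have \<pi>g0: "\<pi> (g0 w) = \<beta> w" if "w \<in> carrier F" for w
  proof (rule free_group_hom_eq[OF Q _ \<beta>(1) _ that, of "\<lambda>w. \<pi> (g0 w)"])
    show "(\<lambda>w. \<pi> (g0 w)) \<in> hom F Q" using Group.hom_compose[OF g0 \<pi>] by (simp add: comp_def)
    fix i assume i: "i \<in> {1..n}"
    then show "\<pi> (g0 (free_gen i)) = \<beta> (free_gen i)"
      using s(2)[OF i] word_eval_free_gen[OF W(1) sf i] by (simp add: g0_def)
  qed
  have gj: "(\<lambda>w. g0 ((f ^^ j) w)) \<in> hom F W" for j
    using Group.hom_compose[OF funpow_hom g0] by (simp add: comp_def)
  obtain a b where "a < b" and ab: "\<And>w. w \<in> carrier F \<Longrightarrow> g0 ((f ^^ (m * b)) w) = g0 ((f ^^ (m * a)) w)"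
    using finitely_many_iterates[where m = m, OF W g0] by metis
  have \<beta>j: "\<beta> ((f ^^ (m * j)) w) = \<beta> w" if "w \<in> carrier F" for j w
  proof (induction j)
    case (Suc j)
    have "(f ^^ (m * Suc j)) w = (f ^^ m) ((f ^^ (m * j)) w)" by (simp add: funpow_add)
    then show ?case using m(2) funpow_closed[OF that] Suc by simp
  qed simp
  \<comment> \<open>The sequence of lifts repeats from index a on with period b - a; composing with
    f^(m a) discards the pre-period.\<close>
  show ?thesis
  proof (rule that[of "\<lambda>w. g0 ((f ^^ (m * a)) w)" "m * (b - a)"])
    show "(\<lambda>w. g0 ((f ^^ (m * a)) w)) \<in> hom F W" by (rule gj)
    show "m * (b - a) > 0" using m(1) \<open>a < b\<close> by simp
    fix w assume w: "w \<in> carrier F"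
    show "\<pi> (g0 ((f ^^ (m * a)) w)) = \<beta> w" using \<pi>g0[OF funpow_closed[OF w]] \<beta>j[OF w] by simp
    have "m * a + m * (b - a) = m * b" using \<open>a < b\<close> by (metis add_mult_distrib2 le_add_diff_inverse less_imp_le)
    then have "(f ^^ (m * a)) ((f ^^ (m * (b - a))) w) = (f ^^ (m * b)) w" by (metis comp_apply funpow_add)
    then show "g0 ((f ^^ (m * a)) ((f ^^ (m * (b - a))) w)) = g0 ((f ^^ (m * a)) w)" using ab[OF w] by simp
  qed
qed

lemma compact_base_closure: "compact_space T\<^sub>P"
  using profinite_group_base_closure by (simp add: profinite_group_def)

sublocale GP: group G\<^sub>P
  using profinite_group_base_closure by (simp add: profinite_group_def topological_group_def)

lemma eta_hom: "(\<lambda>w. \<eta> w) \<in> hom F G\<^sub>P"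
  using hom_mult[OF Group.hom_compose[OF base_map_hom \<Gamma>.completion_map_hom]] base_map_in_closure
  by (auto simp: hom_def)

lemma continuous_act:
  assumes "discrete_torsion_module G\<^sub>P T\<^sub>P A act" "a \<in> carrier A"
  shows "continuous_map T\<^sub>P (discrete_topology (carrier A)) (\<lambda>g. act g a)"
proof -
  have "continuous_map (prod_topology T\<^sub>P (discrete_topology (carrier A))) (discrete_topology (carrier A)) (\<lambda>(g, a). act g a)"
    using assms(1) by (simp add: discrete_torsion_module_def)
  moreover have "continuous_map T\<^sub>P (prod_topology T\<^sub>P (discrete_topology (carrier A))) (\<lambda>g. (g, a))"
    using assms(2) by (simp add: continuous_map_pairwise comp_def)
  ultimately show ?thesis
    using continuous_map_compose[of T\<^sub>P _ "\<lambda>g. (g, a)" _ "\<lambda>(g, a). act g a"] by (simp add: comp_def)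
qed

text \<open>Each orbit is the continuous image of the compact P in a discrete space, hence finite.
  The orbits of S0 are permuted into themselves, so the subgroup they generate is stable, and it is
  finite by torsion.\<close>

lemma finite_stable_subgroup:
  assumes M: "discrete_torsion_module G\<^sub>P T\<^sub>P A act" and S0: "finite S0" "S0 \<subseteq> carrier A"
  obtains B where "subgroup B A" "finite B" "S0 \<subseteq> B" "\<And>g a. \<lbrakk>g \<in> P; a \<in> B\<rbrakk> \<Longrightarrow> act g a \<in> B"
proof -
  interpret A: comm_group A using M by (simp add: discrete_torsion_module_def)
  have act: "act g \<in> hom A A" if "g \<in> P" for g using M that by (simp add: discrete_torsion_module_def)
  have acth: "act (g \<otimes>\<^bsub>PC\<^esub> h) a = act g (act h a)" if "g \<in> P" "h \<in> P" "a \<in> carrier A" for g h a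
    using M that by (simp add: discrete_torsion_module_def)
  have act1: "act \<one>\<^bsub>PC\<^esub> a = a" if "a \<in> carrier A" for a using M that by (simp add: discrete_torsion_module_def)
  have Psub: "subgroup P PC" using base_closure_normal by (rule normal_imp_subgroup)
  define S where "S = (\<Union>a \<in> S0. (\<lambda>g. act g a) ` P)"
  have "finite ((\<lambda>g. act g a) ` P)" if "a \<in> S0" for a
  proof -
    have "compactin (discrete_topology (carrier A)) ((\<lambda>g. act g a) ` P)"
      using that S0(2) compact_base_closure
      by (intro image_compactin[OF _ continuous_act[OF M]]) (auto simp: compact_space_def topspace_base_closure simp del: topspace_subtopology)
    then show ?thesis by (simp add: compactin_discrete_topology)
  qed
  then have finS: "finite S" using S0(1) by (simp add: S_def)
  have SA: "S \<subseteq> carrier A" using S0(2) act by (auto simp: S_def hom_def)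
  define B where "B = generate A S"
  have B: "subgroup B A" unfolding B_def by (rule A.generate_is_subgroup[OF SA])
  have "finite B" unfolding B_def
    using M SA by (intro A.finite_generate_torsion[OF finS SA]) (auto simp: discrete_torsion_module_def)
  moreover have "S0 \<subseteq> B"
  proof
    fix a assume "a \<in> S0"
    then have "act \<one>\<^bsub>PC\<^esub> a \<in> S" using subgroup.one_closed[OF Psub] by (auto simp: S_def)
    moreover have "act \<one>\<^bsub>PC\<^esub> a = a" using act1 \<open>a \<in> S0\<close> S0(2) by blast
    ultimately show "a \<in> B" unfolding B_def by (intro generate.incl) simp
  qed
  moreover have "act g a \<in> B" if g: "g \<in> P" and a: "a \<in> B" for g a
  proof -
    interpret g: group_hom A A "act g" using act[OF g] by unfold_locales
    have "act g ` S \<subseteq> S"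
    proof
      fix y assume "y \<in> act g ` S"
      then obtain h b where "b \<in> S0" "h \<in> P" "y = act g (act h b)" by (auto simp: S_def)
      then show "y \<in> S" using acth[OF g, of h b] S0(2) subgroup.m_closed[OF Psub g, of h]
        unfolding S_def by (intro UN_I[of b]) (auto intro!: image_eqI[of _ _ "g \<otimes>\<^bsub>PC\<^esub> h"])
    qed
    then have "act g ` B \<subseteq> B"
      unfolding B_def using g.generate_img[OF SA] A.mono_generate[of "act g ` S" S] by simp
    then show ?thesis using a by blast
  qed
  ultimately show ?thesis using that B by blast
qed

text \<open>A cocycle takes its values in a finite submodule and factors through a finite level; a
  continuous lift of \<open>P \<rightarrow> Q\<close> to the finite group attached to it by \<open>cocycle_group\<close> exhibits it as a
  coboundary.\<close>

theorem cocycle_imp_coboundary: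
  fixes A :: "'m monoid" and r :: nat
  assumes M: "discrete_torsion_module G\<^sub>P T\<^sub>P A act" and c: "c \<in> cocycles G\<^sub>P T\<^sub>P A act (Suc (Suc r))"
  shows "c \<in> coboundaries G\<^sub>P T\<^sub>P A act (Suc (Suc r))"
proof -
  interpret A: comm_group A using M by (simp add: discrete_torsion_module_def)
  interpret coefficients G\<^sub>P A by unfold_locales
  have ts: "topspace T\<^sub>P = carrier G\<^sub>P" using topspace_base_closure by simp
  have act: "act g \<in> hom A A" if "g \<in> P" for g using M that by (simp add: discrete_torsion_module_def)
  have acth: "act (g \<otimes>\<^bsub>PC\<^esub> h) a = act g (act h a)" if "g \<in> P" "h \<in> P" "a \<in> carrier A" for g h a
    using M that by (simp add: discrete_torsion_module_def)
  have act1: "act \<one>\<^bsub>PC\<^esub> a = a" if "a \<in> carrier A" for a using M that by (simp add: discrete_torsion_module_def)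
  have Psub: "subgroup P PC" using base_closure_normal by (rule normal_imp_subgroup)
  define X where "X k = (\<Pi>\<^sub>E i \<in> {..<k::nat}. P)" for k
  have tsX: "topspace (product_topology (\<lambda>_. T\<^sub>P) {..<k}) = X k" for k
    unfolding X_def topspace_product_topology topspace_base_closure ..
  have cC: "c \<in> carrier (cochains G\<^sub>P T\<^sub>P A (Suc (Suc r)))"
      and cker: "cobdry G\<^sub>P A act (Suc (Suc r)) c = \<one>\<^bsub>cochains G\<^sub>P T\<^sub>P A (Suc (Suc (Suc r)))\<^esub>"
    using c by (auto simp: cocycles_def kernel_def)
  have cext: "c \<in> extensional (X (Suc (Suc r)))"
    and ccont: "continuous_map (product_topology (\<lambda>_. T\<^sub>P) {..<Suc (Suc r)}) (discrete_topology (carrier A)) c"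
    using cC by (simp_all add: cochains_def X_def)
  have cA: "c \<in> X (Suc (Suc r)) \<rightarrow> carrier A"
    using cochains_closed[OF ts cC] by (simp add: X_def)
  have compX: "compact_space (product_topology (\<lambda>_. T\<^sub>P) {..<k})" for k :: nat
    using compact_base_closure by (simp add: compact_space_product_topology)
  have "compactin (discrete_topology (carrier A)) (c ` X (Suc (Suc r)))"
    using image_compactin[OF _ ccont] compX[of "Suc (Suc r)"] unfolding compact_space_def tsX by blast
  then have "finite (c ` X (Suc (Suc r)))" "c ` X (Suc (Suc r)) \<subseteq> carrier A"
    by (simp_all add: compactin_discrete_topology)
  then obtain B where B: "subgroup B A" "finite B" "c ` X (Suc (Suc r)) \<subseteq> B"
      "\<And>g a. \<lbrakk>g \<in> P; a \<in> B\<rbrakk> \<Longrightarrow> act g a \<in> B"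
    using finite_stable_subgroup[OF M] by metis
  have BA: "B \<subseteq> carrier A" using B(1) by (rule subgroup.subset)
  interpret XL: leveled_space "product_topology (\<lambda>_. T\<^sub>P) {..<k}" FIN "\<lambda>N x. \<lambda>i \<in> {..<k}. x i N" for k :: nat
    by (rule TP.leveled_power)
  obtain N0 where N0: "N0 \<in> FIN" "\<And>x y. \<lbrakk>x \<in> X (Suc (Suc r)); y \<in> X (Suc (Suc r));
      (\<lambda>i \<in> {..<Suc (Suc r)}. x i N0) = (\<lambda>i \<in> {..<Suc (Suc r)}. y i N0)\<rbrakk> \<Longrightarrow> c x = c y"
    using XL.discrete_factors_through_level[OF compX ccont] unfolding tsX by blast
  have "\<exists>N \<in> FIN. \<forall>g \<in> P. \<forall>h \<in> P. g N = h N \<longrightarrow> act g a = act h a" if "a \<in> B" for a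
    using TP.discrete_factors_through_level[OF compact_base_closure continuous_act[OF M, of a]] that BA
    unfolding topspace_base_closure by blast
  then obtain Na where Na: "\<And>a. a \<in> B \<Longrightarrow> Na a \<in> FIN"
      "\<And>a g h. \<lbrakk>a \<in> B; g \<in> P; h \<in> P; g (Na a) = h (Na a)\<rbrakk> \<Longrightarrow> act g a = act h a"
    by metis
  \<comment> \<open>One level has to serve the cocycle and the action on each of the finitely many
    elements of B.\<close>
  have "insert N0 (Na ` B) \<subseteq> FIN" using N0(1) Na(1) by blast
  then obtain N where N: "N \<in> FIN" "N \<subseteq> N0" "\<And>a. a \<in> B \<Longrightarrow> N \<subseteq> Na a"
    using PT.lower_bound[of "insert N0 (Na ` B)"] B(2) by blast
  have lvl: "g M = h M" if "g \<in> P" "h \<in> P" "g N = h N" "M \<in> FIN" "N \<subseteq> M" for g h M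
    using TP.mono[OF N(1) that(4,5)] that(1-3) unfolding topspace_base_closure by blast
  have act_lvl: "act g a = act h a" if "g \<in> P" "h \<in> P" "g N = h N" "a \<in> B" for g h a
    by (rule Na(2)[OF that(4,1,2) lvl[OF that(1-3) Na(1)[OF that(4)] N(3)[OF that(4)]]])
  define \<pi> where "\<pi> = (\<lambda>p :: nat option word set set \<Rightarrow> nat option word set set. p N)"
  \<comment> \<open>Only the image of P in the finite quotient: elements outside P do not act on
    A.\<close>
  define Q where "Q = (\<Gamma> Mod N)\<lparr>carrier := \<pi> ` P\<rparr>"
  interpret Q0: group "\<Gamma> Mod N" by (rule \<Gamma>.group_FIN_quotient[OF N(1)])
  have Pc: "p \<in> carrier PC" if "p \<in> P" for p using that base_closure_subset by blast
  have \<pi>0: "\<pi> \<in> hom G\<^sub>P (\<Gamma> Mod N)"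
    using \<Gamma>.completion_level_closed[OF Pc N(1)] \<Gamma>.completion_mult[OF N(1)] by (auto simp: hom_def \<pi>_def mult_FactGroup)
  interpret \<pi>0: group_hom G\<^sub>P "\<Gamma> Mod N" \<pi> using \<pi>0 by unfold_locales
  have Qsub: "subgroup (\<pi> ` P) (\<Gamma> Mod N)" using \<pi>0.img_is_subgroup by simp
  interpret Q: group Q unfolding Q_def by (rule Q0.subgroup_imp_group[OF Qsub])
  have Qc: "carrier Q = \<pi> ` P" by (simp add: Q_def)
  have finQ: "finite (carrier Q)"
    using finite_subset[OF subgroup.subset[OF Qsub] \<Gamma>.finite_FIN_quotient[OF N(1)]] by (simp add: Qc)
  have \<pi>: "\<pi> \<in> hom G\<^sub>P Q" using \<pi>0 by (auto simp: hom_def Q_def)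
  interpret \<pi>: group_hom G\<^sub>P Q \<pi> using \<pi> by unfold_locales
  have \<pi>m: "\<pi> (p \<otimes>\<^bsub>PC\<^esub> q) = \<pi> p \<otimes>\<^bsub>Q\<^esub> \<pi> q" if "p \<in> P" "q \<in> P" for p q using \<pi>.hom_mult[of p q] that by simp
  \<comment> \<open>A section of sets, not a homomorphism. Since the action on B and the cocycle
    depend only on the level N, transporting them along \<sigma> still gives an action of Q on B and
    a cocycle on Q.\<close>
  define \<sigma> where "\<sigma> = inv_into P \<pi>"
  have \<sigma>P: "\<sigma> y \<in> P" and \<pi>\<sigma>: "\<pi> (\<sigma> y) = y" if "y \<in> carrier Q" for y
    using that by (auto simp: \<sigma>_def Qc inv_into_into f_inv_into_f)
  have \<pi>P: "\<pi> p \<in> carrier Q" if "p \<in> P" for p using that by (simp add: Qc)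
  have act_\<sigma>: "act (\<sigma> (\<pi> p)) a = act p a" if "p \<in> P" "a \<in> B" for p a
    using act_lvl[OF \<sigma>P[OF \<pi>P[OF that(1)]] that(1) _ that(2)] \<pi>\<sigma>[OF \<pi>P[OF that(1)]] by (simp add: \<pi>_def)
  define cQ where "cQ l = c (tuple_of (map \<sigma> l))" for l
  have tup: "tuple_of l \<in> X k" if "l \<in> tuples G\<^sub>P k" for l k
    using tuple_of_closed[OF that] by (simp add: X_def)
  have map\<sigma>: "map \<sigma> l \<in> tuples G\<^sub>P k" if "l \<in> tuples Q k" for l k
    using that \<sigma>P by (auto simp: tuples_def in_lists_conv_set)
  have map\<pi>: "map \<pi> l \<in> tuples Q k" if "l \<in> tuples G\<^sub>P k" for l k
    using that \<pi>P by (auto simp: tuples_def in_lists_conv_set)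
  have map\<pi>\<sigma>: "map \<pi> (map \<sigma> l) = l" if "l \<in> tuples Q k" for l k
    using that \<pi>\<sigma> by (auto simp: tuples_def in_lists_conv_set intro!: map_idI)
  have cQ_map: "cQ (map \<pi> l) = c (tuple_of l)" if l: "l \<in> tuples G\<^sub>P (Suc (Suc r))" for l
    unfolding cQ_def
  proof (rule N0(2)[OF tup[OF map\<sigma>[OF map\<pi>[OF l]]] tup[OF l]], rule restrict_ext)
    fix i assume i: "i \<in> {..<Suc (Suc r)}"
    have len: "length l = Suc (Suc r)" and li: "l ! i \<in> P"
      using l i by (auto simp: tuples_def in_lists_conv_set)
    have "\<sigma> (\<pi> (l ! i)) N0 = (l ! i) N0"
      using \<pi>\<sigma>[OF \<pi>P[OF li]] by (intro lvl[OF \<sigma>P[OF \<pi>P[OF li]] li _ N0(1) N(2)]) (simp add: \<pi>_def)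
    then show "tuple_of (map \<sigma> (map \<pi> l)) i N0 = tuple_of l i N0"
      using i len by (simp add: tuple_of_def)
  qed
  have QA: "coefficients Q A" by unfold_locales
  have cQB: "cQ \<in> tuples Q (Suc (Suc r)) \<rightarrow> B"
    using B(3) tup[OF map\<sigma>] by (auto simp: cQ_def)
  have cl: "(\<lambda>l. c (tuple_of l)) \<in> tuples G\<^sub>P (Suc (Suc r)) \<rightarrow> carrier A"
    using funcset_mem[OF cA tup] by blast
  have ccoc: "act g (c (tuple_of l)) = face_sum G\<^sub>P A (\<lambda>l. c (tuple_of l)) (g # l)"
    if g: "g \<in> P" and l: "l \<in> tuples G\<^sub>P (Suc (Suc r))" for g l
  proof -
    have gl: "g # l \<in> tuples G\<^sub>P (Suc (Suc (Suc r)))" using g l by simp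
    then have len: "length (g # l) = Suc (Suc (Suc r))" by (simp add: tuples_def)
    have x: "tuple_of (g # l) \<in> (\<Pi>\<^sub>E i \<in> {..<Suc (Suc (Suc r))}. carrier G\<^sub>P)" by (rule tuple_of_closed[OF gl])
    have m: "map (tuple_of (g # l)) [0..<Suc (Suc (Suc r))] = g # l"
      using map_tuple_of[of "g # l"] unfolding len .
    have x0: "tuple_of (g # l) 0 = g" by (simp add: tuple_of_def)
    have "cobdry G\<^sub>P A act (Suc (Suc r)) c (tuple_of (g # l))
        = act g (c (tuple_of l)) \<otimes>\<^bsub>A\<^esub> inv\<^bsub>A\<^esub> face_sum G\<^sub>P A (\<lambda>l. c (tuple_of l)) (g # l)"
      using cobdry_eq_face_sum[of c "Suc (Suc r)" "tuple_of (g # l)" act, OF cochains_closed[OF ts cC] x]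
        act[OF g] unfolding m x0 by (simp add: hom_def)
    moreover have "cobdry G\<^sub>P A act (Suc (Suc r)) c (tuple_of (g # l)) = \<one>\<^bsub>A\<^esub>"
      unfolding cker using x by (simp add: cochains_def)
    ultimately show ?thesis
      using face_sum_closed[OF cl gl] hom_in_carrier[OF act[OF g] funcset_mem[OF cl l]]
      by (metis A.inv_equality A.inv_inv A.inv_closed)
  qed
  have p1: "act (\<sigma> g) \<in> hom A A" if "g \<in> carrier Q" for g using act[OF \<sigma>P[OF that]] .
  have p2: "act (\<sigma> g) a \<in> B" if "g \<in> carrier Q" "a \<in> B" for g a using B(4)[OF \<sigma>P[OF that(1)] that(2)] .
  have p3: "act (\<sigma> \<one>\<^bsub>Q\<^esub>) a = a" if a: "a \<in> B" for a
  proof -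
    have "\<pi> \<one>\<^bsub>PC\<^esub> = \<one>\<^bsub>Q\<^esub>" using \<pi>.hom_one by simp
    then show ?thesis
      using act_\<sigma>[OF subgroup.one_closed[OF Psub] a] act1 a BA by auto
  qed
  have p4: "act (\<sigma> (g \<otimes>\<^bsub>Q\<^esub> h)) a = act (\<sigma> g) (act (\<sigma> h) a)"
    if gh: "g \<in> carrier Q" "h \<in> carrier Q" and a: "a \<in> B" for g h a
  proof -
    have "\<pi> (\<sigma> g \<otimes>\<^bsub>PC\<^esub> \<sigma> h) = g \<otimes>\<^bsub>Q\<^esub> h" using \<pi>m[OF \<sigma>P[OF gh(1)] \<sigma>P[OF gh(2)]] \<pi>\<sigma> gh by simp
    then have "act (\<sigma> (g \<otimes>\<^bsub>Q\<^esub> h)) a = act (\<sigma> g \<otimes>\<^bsub>PC\<^esub> \<sigma> h) a"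
      using act_\<sigma>[OF subgroup.m_closed[OF Psub \<sigma>P[OF gh(1)] \<sigma>P[OF gh(2)]] a] by simp
    then show ?thesis
      using acth[OF \<sigma>P[OF gh(1)] \<sigma>P[OF gh(2)]] a BA by auto
  qed
  have p5: "act (\<sigma> g) (cQ l) = face_sum Q A cQ (g # l)"
    if g: "g \<in> carrier Q" and l: "l \<in> tuples Q (Suc (Suc r))" for g l
  proof -
    let ?L = "map \<sigma> l"
    have L: "?L \<in> tuples G\<^sub>P (Suc (Suc r))" by (rule map\<sigma>[OF l])
    have gL: "\<sigma> g # ?L \<in> tuples G\<^sub>P (Suc (Suc (Suc r)))" using L \<sigma>P[OF g] by simp
    have mg: "map \<pi> (\<sigma> g # ?L) = g # l" using map\<pi>\<sigma>[OF l] \<pi>\<sigma>[OF g] by simp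
    have "act (\<sigma> g) (cQ l) = face_sum G\<^sub>P A (\<lambda>l. c (tuple_of l)) (\<sigma> g # ?L)"
      unfolding cQ_def by (rule ccoc[OF \<sigma>P[OF g] L])
    also have "\<dots> = face_sum G\<^sub>P A (\<lambda>l. cQ (map \<pi> l)) (\<sigma> g # ?L)"
      by (rule face_sum_cong[OF _ gL]) (simp add: cQ_map)
    also have "\<dots> = face_sum Q A cQ (map \<pi> (\<sigma> g # ?L))"
      by (rule face_sum_map[OF coefficients_axioms \<pi> gL, symmetric])
    finally show ?thesis unfolding mg .
  qed
  obtain W :: "((nat option word set set list \<Rightarrow> 'm) \<times> nat option word set set) monoid" where W: "group W" "finite (carrier W)"
    "snd \<in> hom W Q" "snd ` carrier W = carrier Q" "\<And>x. x \<in> carrier W \<Longrightarrow> fst x \<in> tuples Q r \<rightarrow> B"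
    "\<And>x y l. \<lbrakk>x \<in> carrier W; y \<in> carrier W; l \<in> tuples Q r\<rbrakk> \<Longrightarrow> fst (x \<otimes>\<^bsub>W\<^esub> y) l =
       act (\<sigma> (snd x)) (fst y l) \<otimes>\<^bsub>A\<^esub> face_sum Q A (fst x) (snd y # l) \<otimes>\<^bsub>A\<^esub> inv\<^bsub>A\<^esub> cQ (snd x # snd y # l)"
  proof (rule cocycle_group[of Q A B "\<lambda>y. act (\<sigma> y)" cQ r, OF QA finQ B(1,2) p1 p2 p3 p4 cQB p5])
    fix W :: "((nat option word set set list \<Rightarrow> 'm) \<times> nat option word set set) monoid"
    assume W: "group W" "finite (carrier W)"
    "snd \<in> hom W Q" "snd ` carrier W = carrier Q" "\<And>x. x \<in> carrier W \<Longrightarrow> fst x \<in> tuples Q r \<rightarrow> B"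
    "\<And>x y l. \<lbrakk>x \<in> carrier W; y \<in> carrier W; l \<in> tuples Q r\<rbrakk> \<Longrightarrow> fst (x \<otimes>\<^bsub>W\<^esub> y) l =
       act (\<sigma> (snd x)) (fst y l) \<otimes>\<^bsub>A\<^esub> face_sum Q A (fst x) (snd y # l) \<otimes>\<^bsub>A\<^esub> inv\<^bsub>A\<^esub> cQ (snd x # snd y # l)"
    show thesis by (rule that[OF W])
  qed
  interpret W: group W by (rule W(1))
  define \<beta> where "\<beta> w = \<pi> (\<eta> w)" for w
  have \<beta>: "\<beta> \<in> hom F Q" using Group.hom_compose[OF eta_hom \<pi>] by (simp add: \<beta>_def[abs_def] comp_def)
  have \<beta>\<iota>: "\<beta> w = N #>\<^bsub>\<Gamma>\<^esub> \<iota> w" for w by (simp add: \<beta>_def \<pi>_def \<Gamma>.completion_map_level[OF N(1)])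
  obtain m where m: "m > 0" "\<And>w. w \<in> carrier F \<Longrightarrow> \<beta> ((f ^^ m) w) = \<beta> w"
    using finite_quotient_hom_periodic[OF Q0.is_group \<Gamma>.finite_FIN_quotient[OF N(1)] quotient_FIN_hom[OF N(1)]]
    unfolding \<beta>\<iota> by metis
  have "\<beta> ` carrier F \<subseteq> snd ` carrier W" unfolding W(4) using \<beta> by (auto simp: hom_def)
  then obtain g k where g: "g \<in> hom F W" "\<And>w. w \<in> carrier F \<Longrightarrow> snd (g w) = \<beta> w"
    "k > 0" "\<And>w. w \<in> carrier F \<Longrightarrow> g ((f ^^ k) w) = g w"
    using periodic_lift[OF W(1,2) Q.is_group W(3) \<beta> _ m] by metis
  obtain N1 where N1: "N1 \<in> FIN" "\<And>w. \<lbrakk>w \<in> carrier F; \<iota> w \<in> N1\<rbrakk> \<Longrightarrow> g w = \<one>\<^bsub>W\<^esub>"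
    using periodic_hom_factors[OF W(1,2) g(1,3,4)] by metis
  have lev: "\<exists>N \<in> FIN. \<forall>w \<in> carrier F. \<iota> w \<in> N \<longrightarrow> g w \<in> U" if "U \<lhd> W" for U
    using N1 subgroup.one_closed[OF normal_imp_subgroup[OF that]] by (intro bexI[OF _ N1(1)]) simp
  obtain \<psi> where \<psi>: "\<psi> \<in> hom G\<^sub>P W" "continuous_map T\<^sub>P (discrete_topology (carrier W)) \<psi>"
      "\<And>w. w \<in> carrier F \<Longrightarrow> \<psi> (\<eta> w) = g w"
    using base_closure_extend[OF finite_profinite_group[OF W(1,2)] g(1) lev] by metis
  obtain N2 where N2: "N2 \<in> FIN" "\<And>p q. \<lbrakk>p \<in> P; q \<in> P; p N2 = q N2\<rbrakk> \<Longrightarrow> \<psi> p = \<psi> q"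
    using TP.discrete_factors_through_level[OF compact_base_closure \<psi>(2)] unfolding topspace_base_closure by blast
  have \<psi>W: "\<psi> p \<in> carrier W" if "p \<in> P" for p using hom_in_carrier[OF \<psi>(1), of p] that by simp
  have \<psi>m: "\<psi> (p \<otimes>\<^bsub>PC\<^esub> q) = \<psi> p \<otimes>\<^bsub>W\<^esub> \<psi> q" if "p \<in> P" "q \<in> P" for p q using hom_mult[OF \<psi>(1), of p q] that by simp
  \<comment> \<open>Both sides are continuous and agree on the dense image of F, where \<psi>
    extends the periodic lift of \<beta>.\<close>
  have snd\<psi>: "snd (\<psi> p) = \<pi> p" if "p \<in> P" for p
  proof (rule base_closure_hom_eq[of "discrete_topology (carrier Q)", OF Hausdorff_space_discrete_topology _ _ _ that])
    show "continuous_map T\<^sub>P (discrete_topology (carrier Q)) (\<lambda>p. snd (\<psi> p))"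
      by (rule TP.continuous_map_discrete_level[OF N2(1)])
         (unfold topspace_base_closure, rule hom_in_carrier[OF W(3) \<psi>W], assumption, metis N2(2))
    show "continuous_map T\<^sub>P (discrete_topology (carrier Q)) \<pi>"
      by (rule TP.continuous_map_discrete_level[OF N(1)])
         (unfold topspace_base_closure, rule \<pi>P, assumption, simp add: \<pi>_def)
    fix w assume "w \<in> carrier F"
    then show "snd (\<psi> (\<eta> w)) = \<pi> (\<eta> w)" using \<psi>(3) g(2) by (simp add: \<beta>_def)
  qed
  \<comment> \<open>The first variable selects an element of W through \<psi>, and its cochain
    component is evaluated at the remaining variables. The product rule of W for \<psi> (p q) then
    says that c is the coboundary of this cochain.\<close>
  define b' where "b' l = fst (\<psi> (hd l)) (map \<pi> (tl l))" for l
  define b where "b = (\<lambda>x \<in> X (Suc r). b' (map x [0..<Suc r]))"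
  have b': "b' l \<in> B" if "l \<in> tuples G\<^sub>P (Suc r)" for l
    using that W(5)[OF \<psi>W] map\<pi> unfolding b'_def by (elim tuples_SucE) auto
  have b_tup: "b (tuple_of l) = b' l" if l: "l \<in> tuples G\<^sub>P (Suc r)" for l
  proof -
    have "length l = Suc r" using l by (simp add: tuples_def)
    then show ?thesis using map_tuple_of[of l] tup[OF l] by (simp add: b_def del: upt_Suc)
  qed
  have bC: "b \<in> carrier (cochains G\<^sub>P T\<^sub>P A (Suc r))"
  proof -
    \<comment> \<open>N controls the entries that enter through \<pi>, and N2 the first entry, which
      enters through \<psi>.\<close>
    have NN: "N \<inter> N2 \<in> FIN" by (rule \<Gamma>.FIN_Int[OF N(1) N2(1)])
    have "continuous_map (product_topology (\<lambda>_. T\<^sub>P) {..<Suc r}) (discrete_topology (carrier A)) b"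
    proof (rule XL.continuous_map_discrete_level[OF NN], unfold tsX)
      fix x assume x: "x \<in> X (Suc r)"
      then show "b x \<in> carrier A"
        using b'[OF map_upt_tuples[of x "Suc r" G\<^sub>P]] BA by (auto simp: b_def X_def simp del: upt_Suc)
    next
      fix x y assume x: "x \<in> X (Suc r)" and y: "y \<in> X (Suc r)"
        and eq: "(\<lambda>i \<in> {..<Suc r}. x i (N \<inter> N2)) = (\<lambda>i \<in> {..<Suc r}. y i (N \<inter> N2))"
      have xy: "x i \<in> P" "y i \<in> P" "x i (N \<inter> N2) = y i (N \<inter> N2)" if "i < Suc r" for i
        using x y that fun_cong[OF eq, of i] by (auto simp: X_def)
      have "x i N = y i N" "x i N2 = y i N2" if "i < Suc r" for i
        using TP.mono[OF NN N(1)] TP.mono[OF NN N2(1)] xy[OF that] unfolding topspace_base_closure by blast+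
      then have "\<psi> (x 0) = \<psi> (y 0)" "\<And>i. i < Suc r \<Longrightarrow> \<pi> (x i) = \<pi> (y i)"
        using N2(2) xy by (auto simp: \<pi>_def)
      moreover have "b z = fst (\<psi> (z 0)) (map (\<lambda>i. \<pi> (z i)) [Suc 0..<Suc r])" if "z \<in> X (Suc r)" for z
        using that by (simp add: b_def b'_def upt_conv_Cons comp_def del: upt_Suc)
      moreover have "map (\<lambda>i. \<pi> (x i)) [Suc 0..<Suc r] = map (\<lambda>i. \<pi> (y i)) [Suc 0..<Suc r]"
        by (intro map_cong refl calculation(2)) auto
      ultimately show "b x = b y"
        using x y by (simp only:)
    qed
    then show ?thesis by (simp add: cochains_def b_def X_def)
  qed
  have "cobdry G\<^sub>P A act (Suc r) b = c"
  proof (rule extensionalityI[of _ "X (Suc (Suc r))"])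
    show "cobdry G\<^sub>P A act (Suc r) b \<in> extensional (X (Suc (Suc r)))" by (simp add: cobdry_def X_def)
    fix x assume x: "x \<in> X (Suc (Suc r))"
    define L where "L = map x [0..<Suc (Suc r)]"
    have x': "x \<in> (\<Pi>\<^sub>E i \<in> {..<Suc (Suc r)}. carrier G\<^sub>P)" using x by (simp add: X_def)
    have L: "L \<in> tuples G\<^sub>P (Suc (Suc r))" unfolding L_def by (rule map_upt_tuples[OF x'])
    obtain p q l where l: "L = p # q # l" "p \<in> P" "q \<in> P" "l \<in> tuples G\<^sub>P r"
      using L by (auto elim!: tuples_SucE)
    have x0: "x 0 = p" using l(1) by (simp add: L_def upt_conv_Cons del: upt_Suc)
    have ql: "q # l \<in> tuples G\<^sub>P (Suc r)" using l by simp
    have \<pi>l: "map \<pi> l \<in> tuples Q r" by (rule map\<pi>[OF l(4)])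
    have cx: "c x = cQ (\<pi> p # \<pi> q # map \<pi> l)"
      using cQ_map[OF L] tuple_of_map_upt[OF x'] unfolding L_def[symmetric] by (simp add: l(1))
    define a0 where "a0 = act p (fst (\<psi> q) (map \<pi> l))"
    define f0 where "f0 = face_sum Q A (fst (\<psi> p)) (\<pi> q # map \<pi> l)"
    have q0: "fst (\<psi> q) (map \<pi> l) \<in> B" using W(5)[OF \<psi>W[OF l(3)]] \<pi>l by auto
    have a0: "a0 \<in> carrier A" unfolding a0_def using B(4)[OF l(2) q0] BA by auto
    have qQ: "\<pi> q # map \<pi> l \<in> tuples Q (Suc r)" using \<pi>l \<pi>P[OF l(3)] by simp
    have f0: "f0 \<in> carrier A"
      unfolding f0_def using coefficients.face_sum_in_subgroup[OF QA B(1) W(5)[OF \<psi>W[OF l(2)]] qQ] BA by auto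
    have c0: "c x \<in> carrier A" using cA x by auto
    have "fst (\<psi> (p \<otimes>\<^bsub>PC\<^esub> q)) (map \<pi> l) = act (\<sigma> (\<pi> p)) (fst (\<psi> q) (map \<pi> l)) \<otimes>\<^bsub>A\<^esub> f0 \<otimes>\<^bsub>A\<^esub> inv\<^bsub>A\<^esub> c x"
      using W(6)[OF \<psi>W[OF l(2)] \<psi>W[OF l(3)] \<pi>l] \<psi>m[OF l(2,3)] by (simp add: snd\<psi> l(2,3) f0_def cx)
    then have pq: "fst (\<psi> (p \<otimes>\<^bsub>PC\<^esub> q)) (map \<pi> l) = a0 \<otimes>\<^bsub>A\<^esub> f0 \<otimes>\<^bsub>A\<^esub> inv\<^bsub>A\<^esub> c x"
      unfolding a0_def act_\<sigma>[OF l(2) q0] .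
    have "face_sum G\<^sub>P A (\<lambda>l. b (tuple_of l)) L = face_sum G\<^sub>P A b' L"
      by (rule face_sum_cong[OF b_tup L])
    also have "\<dots> = fst (\<psi> (p \<otimes>\<^bsub>PC\<^esub> q)) (map \<pi> l) \<otimes>\<^bsub>A\<^esub> inv\<^bsub>A\<^esub> face_sum G\<^sub>P A (\<lambda>x. fst (\<psi> p) (map \<pi> x)) (q # l)"
      by (simp add: l(1) b'_def)
    also have "face_sum G\<^sub>P A (\<lambda>x. fst (\<psi> p) (map \<pi> x)) (q # l) = f0"
      using face_sum_map[OF coefficients_axioms \<pi> ql, of "fst (\<psi> p)"] by (simp add: f0_def)
    finally have fs: "face_sum G\<^sub>P A (\<lambda>l. b (tuple_of l)) L = a0 \<otimes>\<^bsub>A\<^esub> f0 \<otimes>\<^bsub>A\<^esub> inv\<^bsub>A\<^esub> c x \<otimes>\<^bsub>A\<^esub> inv\<^bsub>A\<^esub> f0" unfolding pq .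
    have "cobdry G\<^sub>P A act (Suc r) b x = act p (b (tuple_of (q # l))) \<otimes>\<^bsub>A\<^esub> inv\<^bsub>A\<^esub> (a0 \<otimes>\<^bsub>A\<^esub> f0 \<otimes>\<^bsub>A\<^esub> inv\<^bsub>A\<^esub> c x \<otimes>\<^bsub>A\<^esub> inv\<^bsub>A\<^esub> f0)"
      using cobdry_eq_face_sum[of b "Suc r" x act, OF cochains_closed[OF ts bC] x'] act[OF l(2)]
      unfolding L_def[symmetric] fs x0 by (simp add: l(1) hom_def)
    also have "b (tuple_of (q # l)) = fst (\<psi> q) (map \<pi> l)" using b_tup[OF ql] by (simp add: b'_def)
    also have "act p (fst (\<psi> q) (map \<pi> l)) = a0" by (simp add: a0_def)
    also have "a0 \<otimes>\<^bsub>A\<^esub> inv\<^bsub>A\<^esub> (a0 \<otimes>\<^bsub>A\<^esub> f0 \<otimes>\<^bsub>A\<^esub> inv\<^bsub>A\<^esub> c x \<otimes>\<^bsub>A\<^esub> inv\<^bsub>A\<^esub> f0) = c x"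
    proof -
      have "a0 \<otimes>\<^bsub>A\<^esub> f0 \<otimes>\<^bsub>A\<^esub> inv\<^bsub>A\<^esub> c x \<otimes>\<^bsub>A\<^esub> inv\<^bsub>A\<^esub> f0 = a0 \<otimes>\<^bsub>A\<^esub> inv\<^bsub>A\<^esub> c x \<otimes>\<^bsub>A\<^esub> (f0 \<otimes>\<^bsub>A\<^esub> inv\<^bsub>A\<^esub> f0)"
        using a0 f0 c0 by (simp only: A.m_ac A.m_closed A.inv_closed)
      also have "\<dots> = a0 \<otimes>\<^bsub>A\<^esub> inv\<^bsub>A\<^esub> c x" using a0 f0 c0 by simp
      finally have "a0 \<otimes>\<^bsub>A\<^esub> inv\<^bsub>A\<^esub> (a0 \<otimes>\<^bsub>A\<^esub> f0 \<otimes>\<^bsub>A\<^esub> inv\<^bsub>A\<^esub> c x \<otimes>\<^bsub>A\<^esub> inv\<^bsub>A\<^esub> f0) = a0 \<otimes>\<^bsub>A\<^esub> (inv\<^bsub>A\<^esub> a0 \<otimes>\<^bsub>A\<^esub> c x)"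
        using a0 c0 by (simp add: A.inv_mult)
      also have "\<dots> = c x" using a0 c0 by (simp add: A.m_assoc[symmetric])
      finally show ?thesis .
    qed
    finally show "cobdry G\<^sub>P A act (Suc r) b x = c x" .
  qed (rule cext)
  then show ?thesis using bC by (auto simp: coboundaries_def)
qed

text \<open>A degree q > 1 has the form r + 2, where every cocycle is a coboundary; so d = 1 lies in
  the set whose infimum is taken, for each p.\<close>

theorem base_closure_projective: "projective_profinite TYPE('m) G\<^sub>P T\<^sub>P"
proof -
  have "cohomological_p_dimension TYPE('m) p G\<^sub>P T\<^sub>P \<le> 1" for p
    unfolding cohomological_p_dimension_def
  proof (rule Inf_lower, intro CollectI exI[of _ "1::nat"] conjI allI impI)
    show "(1::enat) = enat 1" by (simp add: one_enat_def)
    fix A :: "'m monoid" and act and q :: nat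
    assume M: "discrete_torsion_module G\<^sub>P T\<^sub>P A act" and q: "1 < q"
    obtain r where r: "q = Suc (Suc r)" using q less_imp_Suc_add[OF q] by auto
    interpret A: comm_group A using M by (simp add: discrete_torsion_module_def)
    have "coefficients G\<^sub>P A" by unfold_locales
    then show "primary_component p (cohomology_group G\<^sub>P T\<^sub>P A act q) = {\<one>\<^bsub>cohomology_group G\<^sub>P T\<^sub>P A act q\<^esub>}"
      unfolding r using M cocycle_imp_coboundary[OF M] topspace_base_closure
      by (intro trivial_cohomology) (auto simp: discrete_torsion_module_def)
  qed
  then show ?thesis
    unfolding projective_profinite_def cohomological_dimension_def
    using profinite_group_base_closure by (auto intro: SUP_least)
qed

end

section \<open>Freeness\<close>

text \<open>The separation theorem applied to the trivial subgroup, generated by the empty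
  set.\<close>

lemma free_group_residually_finite:
  assumes "w \<in> carrier (free_group X)" "w \<noteq> \<one>\<^bsub>free_group X\<^esub>" "infinite (UNIV :: 'c set)"
  obtains W :: "'c monoid" and \<theta> where "group W" "finite (carrier W)" "\<theta> \<in> hom (free_group X) W" "\<theta> w \<noteq> \<one>\<^bsub>W\<^esub>"
proof -
  interpret F: group "free_group X" by (rule group_free_group)
  have gen: "generate (free_group X) {} = {\<one>\<^bsub>free_group X\<^esub>}" by (rule F.generate_empty)
  obtain W :: "'c monoid" and \<theta> where W: "group W" "finite (carrier W)" "\<theta> \<in> hom (free_group X) W"
      "\<theta> w \<notin> \<theta> ` generate (free_group X) {}"
    using free_group_separate[of "{}" X w] assms unfolding gen by blast
  then have "\<theta> w \<noteq> \<one>\<^bsub>W\<^esub>"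
    unfolding gen using hom_one[OF W(3) F.is_group W(1)] by simp
  then show ?thesis using that W(1-3) by blast
qed

text \<open>The cosets of U form a partition of a compact space into open sets, so there are
  finitely many.\<close>

lemma open_normal_finite_index:
  assumes H: "profinite_group H S" and U: "U \<lhd> H" "openin S U"
  shows "finite (carrier (H Mod U))"
proof -
  have TG: "topological_group H S" and cpt: "compact_space S"
    using H by (auto simp: profinite_group_def)
  have gH: "group H" and ts: "topspace S = carrier H" using TG by (auto simp: topological_group_def)
  interpret H: group H by (rule gH)
  have Us: "subgroup U H" using U(1) by (rule normal_imp_subgroup)
  let ?C = "\<lambda>x. U #>\<^bsub>H\<^esub> x"
  have "openin S (?C x)" if x: "x \<in> carrier H" for x
  proof -
    have "continuous_map S S (\<lambda>y. y \<otimes>\<^bsub>H\<^esub> inv\<^bsub>H\<^esub> x)"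
      using topological_group_mult[OF TG, of S "\<lambda>y. y" "\<lambda>_. inv\<^bsub>H\<^esub> x"] x ts by simp
    then have "openin S {y \<in> topspace S. y \<otimes>\<^bsub>H\<^esub> inv\<^bsub>H\<^esub> x \<in> U}"
      using U(2) by (rule openin_continuous_map_preimage)
    moreover have "{y \<in> topspace S. y \<otimes>\<^bsub>H\<^esub> inv\<^bsub>H\<^esub> x \<in> U} = ?C x"
      using subgroup.rcos_module[OF Us gH x] H.r_coset_subset_G[OF subgroup.subset[OF Us] x] ts by auto
    ultimately show ?thesis by simp
  qed
  then have "\<forall>V \<in> ?C ` carrier H. openin S V" by blast
  moreover have "topspace S \<subseteq> \<Union>(?C ` carrier H)"
    using H.rcos_self[OF _ Us] ts by blast
  ultimately have "\<exists>\<F>. finite \<F> \<and> \<F> \<subseteq> ?C ` carrier H \<and> topspace S \<subseteq> \<Union>\<F>"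
    using cpt[unfolded compact_space_alt, rule_format, of "?C ` carrier H"] by blast
  then obtain \<F> where \<F>: "finite \<F>" "\<F> \<subseteq> ?C ` carrier H" "topspace S \<subseteq> \<Union>\<F>" by blast
  have "carrier (H Mod U) \<subseteq> \<F>"
  proof
    fix c assume "c \<in> carrier (H Mod U)"
    then obtain x where x: "x \<in> carrier H" "c = ?C x" by (auto simp: carrier_FactGroup)
    have "x \<in> \<Union>\<F>" using \<F>(3) ts x(1) by (simp add: subset_iff)
    then obtain V where V: "V \<in> \<F>" "x \<in> V" by blast
    then obtain d where d: "d \<in> carrier H" "V = ?C d" using \<F>(2) by blast
    then show "c \<in> \<F>" using H.rcos_eq_iff[OF Us x(1) d(1)] x(2) V by simp
  qed
  then show ?thesis using \<F>(1) finite_subset by blast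
qed

context hnn
begin

text \<open>By pigeonhole the sequence \<theta> \<circ> f^j is eventually periodic. As f^a is onto,
  it can be cancelled on the right, and the sequence is periodic from the start.\<close>

lemma finite_hom_factors_if_iso:
  assumes iso: "f \<in> iso F F" and W: "group W" "finite (carrier W)" and \<theta>: "\<theta> \<in> hom F W"
  obtains N where "N \<in> FIN" "\<And>w. \<lbrakk>w \<in> carrier F; \<iota> w \<in> N\<rbrakk> \<Longrightarrow> \<theta> w = \<one>\<^bsub>W\<^esub>"
proof -
  obtain a b where ab: "a < b" "\<And>w. w \<in> carrier F \<Longrightarrow> \<theta> ((f ^^ (1 * b)) w) = \<theta> ((f ^^ (1 * a)) w)"
    using finitely_many_iterates[where m = 1, OF W \<theta>] by metis
  have surj: "\<exists>u \<in> carrier F. (f ^^ k) u = w" if "w \<in> carrier F" for k w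
    using that
  proof (induction k arbitrary: w)
    case (Suc k)
    have "w \<in> f ` carrier F" using iso Suc.prems by (simp add: iso_def bij_betw_def)
    then obtain v where v: "v \<in> carrier F" "f v = w" by blast
    then show ?case using Suc.IH[OF v(1)] by auto
  qed simp
  have "\<theta> ((f ^^ (b - a)) w) = \<theta> w" if w: "w \<in> carrier F" for w
  proof -
    obtain u where u: "u \<in> carrier F" "(f ^^ a) u = w" using surj[OF w] by blast
    have "(f ^^ (b - a)) ((f ^^ a) u) = (f ^^ b) u"
      using ab(1) by (metis add.commute comp_apply funpow_add le_add_diff_inverse less_imp_le)
    then show ?thesis using ab(2)[OF u(1)] u(2) by simp
  qed
  moreover have "b - a > 0" using ab(1) by simp
  ultimately show ?thesis
    using periodic_hom_factors[OF W \<theta>, of "b - a"] that by metis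
qed

text \<open>The basis is the image of the free generators. A map on it evaluates to a homomorphism
  on F, which is determined modulo each open normal subgroup at some level and therefore extends to
  P; density makes the extension unique.\<close>

theorem iso_imp_free:
  assumes iso: "f \<in> iso F F"
  shows "free_profinite_of_rank (U :: 'h itself) n G\<^sub>P T\<^sub>P"
proof -
  define X where "X = (\<lambda>i. \<eta> (free_gen i)) ` {1..n}"
  \<comment> \<open>Needed for X to have exactly n elements. If two generators became equal in P,
    their quotient would die under every homomorphism from F to a finite group, against residual
    finiteness.\<close>
  have "inj_on (\<lambda>i. \<eta> (free_gen i)) {1..n}"
  proof (rule inj_onI, rule ccontr)
    fix i j assume i: "i \<in> {1..n}" and j: "j \<in> {1..n}" and eq: "\<eta> (free_gen i) = \<eta> (free_gen j)" and "i \<noteq> j"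
    define w where "w = free_gen i \<otimes>\<^bsub>F\<^esub> inv\<^bsub>F\<^esub> (free_gen j :: nat word)"
    have w: "w \<in> carrier F" using free_gen_F[OF i] free_gen_F[OF j] by (simp add: w_def)
    have "w \<noteq> \<one>\<^bsub>F\<^esub>"
    proof
      assume "w = \<one>\<^bsub>F\<^esub>"
      then have "(free_gen i :: nat word) = free_gen j"
        unfolding w_def using free_gen_F[OF i] free_gen_F[OF j]
        by (metis F.inv_equality F.inv_inv F.inv_closed)
      then show False using \<open>i \<noteq> j\<close> by (simp add: free_gen_def)
    qed
    then obtain W :: "nat monoid" and \<theta> where W: "group W" "finite (carrier W)" "\<theta> \<in> hom F W" "\<theta> w \<noteq> \<one>\<^bsub>W\<^esub>"
      using free_group_residually_finite[OF w _ infinite_UNIV_nat] by metis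
    obtain N where N: "N \<in> FIN" "\<And>w. \<lbrakk>w \<in> carrier F; \<iota> w \<in> N\<rbrakk> \<Longrightarrow> \<theta> w = \<one>\<^bsub>W\<^esub>"
      using finite_hom_factors_if_iso[OF iso W(1-3)] by metis
    have "N #>\<^bsub>\<Gamma>\<^esub> \<iota> (free_gen i) = N #>\<^bsub>\<Gamma>\<^esub> \<iota> (free_gen j)"
      using fun_cong[OF eq, of N] by (simp add: \<Gamma>.completion_map_level[OF N(1)])
    then have "\<iota> w \<in> N"
      using \<Gamma>.rcos_eq_iff_inv[OF \<Gamma>.FIN_subgroup[OF N(1)]] free_gen_F[OF i] free_gen_F[OF j] by (simp add: w_def)
    then show False using N(2)[OF w] W(4) by simp
  qed
  then have cardX: "finite X" "card X = n" by (simp_all add: X_def card_image)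
  have XP: "X \<subseteq> P" using base_map_in_closure free_gen_F by (auto simp: X_def)
  have "\<exists>!\<psi>. \<psi> \<in> extensional (carrier G\<^sub>P) \<and> \<psi> \<in> hom G\<^sub>P H \<and> continuous_map T\<^sub>P S \<psi> \<and> (\<forall>x \<in> X. \<psi> x = \<phi> x)"
    if H: "profinite_group H S" and \<phi>: "\<phi> \<in> X \<rightarrow> carrier H" for H :: "'h monoid" and S \<phi>
  proof -
    have haus: "Hausdorff_space S" and gH: "group H"
      using H by (auto simp: profinite_group_def topological_group_def)
    interpret H: group H by (rule gH)
    define s where "s i = \<phi> (\<eta> (free_gen i))" for i
    have s: "s \<in> {1..n} \<rightarrow> carrier H" using \<phi> by (auto simp: s_def X_def)
    define \<theta> where "\<theta> = word_eval H s"
    have \<theta>: "\<theta> \<in> hom F H" unfolding \<theta>_def by (rule word_eval_hom[OF gH s])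
    have \<theta>s: "\<theta> (free_gen i) = s i" if "i \<in> {1..n}" for i
      unfolding \<theta>_def by (rule word_eval_free_gen[OF gH s that])
    have lev: "\<exists>N \<in> FIN. \<forall>w \<in> carrier F. \<iota> w \<in> N \<longrightarrow> \<theta> w \<in> U" if U: "U \<lhd> H" "openin S U" for U
    proof -
      have gU: "group (H Mod U)" using U(1) by (rule normal.factorgroup_is_group)
      have hU: "(\<lambda>w. U #>\<^bsub>H\<^esub> \<theta> w) \<in> hom F (H Mod U)"
        using Group.hom_compose[OF \<theta> normal.r_coset_hom_Mod[OF U(1)]] by (simp add: comp_def)
      obtain N where N: "N \<in> FIN" "\<And>w. \<lbrakk>w \<in> carrier F; \<iota> w \<in> N\<rbrakk> \<Longrightarrow> U #>\<^bsub>H\<^esub> \<theta> w = \<one>\<^bsub>H Mod U\<^esub>"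
        using finite_hom_factors_if_iso[OF iso gU open_normal_finite_index[OF H U] hU] by metis
      have "\<theta> w \<in> U" if w: "w \<in> carrier F" "\<iota> w \<in> N" for w
        using N(2)[OF w] H.rcos_eq_self_iff[OF normal_imp_subgroup[OF U(1)] hom_in_carrier[OF \<theta> w(1)]]
        by (simp add: one_FactGroup)
      then show ?thesis using N(1) by blast
    qed
    obtain \<psi> where \<psi>: "\<psi> \<in> hom G\<^sub>P H" "continuous_map T\<^sub>P S \<psi>" "\<And>w. w \<in> carrier F \<Longrightarrow> \<psi> (\<eta> w) = \<theta> w"
      using base_closure_extend[OF H \<theta> lev] by metis
    define \<psi>' where "\<psi>' = restrict \<psi> P"
    have "\<psi>' \<in> hom G\<^sub>P H" using \<psi>(1) GP.m_closed by (auto simp: hom_def \<psi>'_def)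
    moreover have "continuous_map T\<^sub>P S \<psi>'"
      using \<psi>(2) by (rule continuous_map_eq) (simp only: topspace_base_closure \<psi>'_def restrict_apply')
    moreover have "\<psi>' x = \<phi> x" if "x \<in> X" for x
      using that XP \<psi>(3)[OF free_gen_F] \<theta>s by (auto simp: X_def \<psi>'_def s_def)
    moreover have "\<psi>' \<in> extensional (carrier G\<^sub>P)" by (simp add: \<psi>'_def)
    moreover have "\<xi> = \<psi>'"
      if \<xi>: "\<xi> \<in> extensional (carrier G\<^sub>P)" "\<xi> \<in> hom G\<^sub>P H" "continuous_map T\<^sub>P S \<xi>" "\<forall>x \<in> X. \<xi> x = \<phi> x" for \<xi>
    proof (rule extensionalityI[of _ P])
      fix p assume p: "p \<in> P"
      have "\<xi> p = \<psi> p"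
      proof (rule base_closure_hom_eq[OF haus \<xi>(3) \<psi>(2) _ p])
        fix w assume w: "w \<in> carrier F"
        have "\<xi> (\<eta> w) = \<theta> w"
        proof (rule free_group_hom_eq[OF gH _ \<theta> _ w, of "\<lambda>w. \<xi> (\<eta> w)"])
          show "(\<lambda>w. \<xi> (\<eta> w)) \<in> hom F H" using Group.hom_compose[OF eta_hom \<xi>(2)] by (simp add: comp_def)
          fix i assume i: "i \<in> {1..n}"
          then show "\<xi> (\<eta> (free_gen i)) = \<theta> (free_gen i)" using \<xi>(4) \<theta>s by (simp add: X_def s_def)
        qed
        then show "\<xi> (\<eta> w) = \<psi> (\<eta> w)" using \<psi>(3)[OF w] by simp
      qed
      then show "\<xi> p = \<psi>' p" using p by (simp add: \<psi>'_def)
    qed (use \<xi>(1) in \<open>simp_all add: \<psi>'_def\<close>)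
    ultimately show ?thesis by blast
  qed
  then have "free_profinite_on U G\<^sub>P T\<^sub>P X"
    unfolding free_profinite_on_def using profinite_group_base_closure XP by simp
  then show ?thesis unfolding free_profinite_of_rank_def using cardX by blast
qed

text \<open>If \<open>P\<close> is free of rank \<open>n\<close>, it has as many continuous homomorphisms to a finite group as \<open>F\<close> has
  homomorphisms; as \<open>F\<close> is dense in \<open>P\<close>, every homomorphism from \<open>F\<close> extends.\<close>

lemma finite_hom_factors_if_free:
  fixes U :: "'u itself" and W :: "'u monoid"
  assumes free: "free_profinite_of_rank U n G\<^sub>P T\<^sub>P" and W: "group W" "finite (carrier W)" and \<theta>: "\<theta> \<in> hom F W"
  obtains N where "N \<in> FIN" "\<And>w. \<lbrakk>w \<in> carrier F; \<iota> w \<in> N\<rbrakk> \<Longrightarrow> \<theta> w = \<one>\<^bsub>W\<^esub>"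
proof -
  obtain X where X: "finite X" "card X = n" "free_profinite_on U G\<^sub>P T\<^sub>P X"
    using free unfolding free_profinite_of_rank_def by blast
  have XP: "X \<subseteq> P" using X(3) by (simp add: free_profinite_on_def)
  define S where "S = discrete_topology (carrier W)"
  have WS: "profinite_group W S" unfolding S_def by (rule finite_profinite_group[OF W])
  define C where "C = {\<psi>. \<psi> \<in> extensional (carrier G\<^sub>P) \<and> \<psi> \<in> hom G\<^sub>P W \<and> continuous_map T\<^sub>P S \<psi>}"
  have ex1: "\<exists>!\<psi>. \<psi> \<in> C \<and> (\<forall>x \<in> X. \<psi> x = \<phi> x)" if "\<phi> \<in> X \<rightarrow> carrier W" for \<phi>
    using X(3) WS that unfolding free_profinite_on_def C_def by simp
  \<comment> \<open>The universal property for the finite target W: continuous homomorphisms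
    correspond to arbitrary maps on the basis X.\<close>
  have "bij_betw (\<lambda>\<psi>. restrict \<psi> X) C (X \<rightarrow>\<^sub>E carrier W)"
    unfolding bij_betw_def
  proof (intro conjI inj_onI equalityI subsetI)
    fix \<psi> \<xi> assume C: "\<psi> \<in> C" "\<xi> \<in> C" and eq: "restrict \<psi> X = restrict \<xi> X"
    have "\<psi> \<in> X \<rightarrow> carrier W" using C(1) XP by (auto simp: C_def hom_def)
    moreover have "\<forall>x \<in> X. \<xi> x = \<psi> x" using eq by (metis restrict_apply')
    ultimately show "\<psi> = \<xi>" using ex1[of \<psi>] C by blast
  next
    fix \<phi> assume "\<phi> \<in> (\<lambda>\<psi>. restrict \<psi> X) ` C"
    then show "\<phi> \<in> X \<rightarrow>\<^sub>E carrier W" using XP by (auto simp: C_def hom_def)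
  next
    fix \<phi> assume \<phi>: "\<phi> \<in> X \<rightarrow>\<^sub>E carrier W"
    then have "\<phi> \<in> X \<rightarrow> carrier W" by auto
    then obtain \<psi> where "\<psi> \<in> C" "\<forall>x \<in> X. \<psi> x = \<phi> x" using ex1 by blast
    then have "\<phi> = restrict \<psi> X" using \<phi> by (intro extensionalityI[of _ X]) (auto simp: PiE_iff)
    then show "\<phi> \<in> (\<lambda>\<psi>. restrict \<psi> X) ` C" using \<open>\<psi> \<in> C\<close> by blast
  qed
  then have C: "card C = card (X \<rightarrow>\<^sub>E carrier W)" "finite C"
    using X(1) W(2) by (auto simp: bij_betw_same_card bij_betw_finite intro!: finite_PiE)
  define \<rho> where "\<rho> \<psi> = (\<lambda>i \<in> {1..n}. \<psi> (\<eta> (free_gen i)))" for \<psi> :: "_ \<Rightarrow> 'u"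
  have haus: "Hausdorff_space S" unfolding S_def by (rule Hausdorff_space_discrete_topology)
  have \<psi>\<eta>: "(\<lambda>w. \<psi> (\<eta> w)) \<in> hom F W" if "\<psi> \<in> C" for \<psi>
    using Group.hom_compose[OF eta_hom, of \<psi> W] that by (simp add: C_def comp_def)
  have \<rho>_inj: "inj_on \<rho> C"
  proof (rule inj_onI)
    fix \<psi> \<xi> assume c: "\<psi> \<in> C" "\<xi> \<in> C" and eq: "\<rho> \<psi> = \<rho> \<xi>"
    show "\<psi> = \<xi>"
    proof (rule extensionalityI[of _ P])
      fix p assume p: "p \<in> P"
      show "\<psi> p = \<xi> p"
      proof (rule base_closure_hom_eq[OF haus _ _ _ p])
        fix w assume w: "w \<in> carrier F"
        show "\<psi> (\<eta> w) = \<xi> (\<eta> w)"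
        proof (rule free_group_hom_eq[OF W(1) \<psi>\<eta>[OF c(1)] \<psi>\<eta>[OF c(2)] _ w])
          fix i assume "i \<in> {1..n}"
          then show "\<psi> (\<eta> (free_gen i)) = \<xi> (\<eta> (free_gen i))"
            using fun_cong[OF eq, of i] by (simp add: \<rho>_def)
        qed
      qed (use c in \<open>simp_all add: C_def\<close>)
    qed (use c in \<open>simp_all add: C_def\<close>)
  qed
  moreover have "\<rho> ` C \<subseteq> {1..n} \<rightarrow>\<^sub>E carrier W"
    using hom_in_carrier[OF \<psi>\<eta>] free_gen_F by (auto simp: \<rho>_def)
  \<comment> \<open>Both function sets have |W|^n elements, so the injection \<rho> on the finite
    set C reaches every choice of images of the generators of F, including that of \<theta>.\<close>
  moreover have "card ({1..n} \<rightarrow>\<^sub>E carrier W) = card C"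
    unfolding C(1) using X(1,2) by (simp add: card_PiE)
  ultimately have "\<rho> ` C = {1..n} \<rightarrow>\<^sub>E carrier W"
    using W(2) by (intro card_subset_eq finite_PiE) (auto simp: card_image)
  moreover have "(\<lambda>i \<in> {1..n}. \<theta> (free_gen i)) \<in> {1..n} \<rightarrow>\<^sub>E carrier W"
    using hom_in_carrier[OF \<theta>] free_gen_F by auto
  ultimately have "(\<lambda>i \<in> {1..n}. \<theta> (free_gen i)) \<in> \<rho> ` C" by simp
  then obtain \<psi> where \<psi>: "(\<lambda>i \<in> {1..n}. \<theta> (free_gen i)) = \<rho> \<psi>" "\<psi> \<in> C" by (rule imageE)
  have \<psi>\<theta>: "\<psi> (\<eta> w) = \<theta> w" if "w \<in> carrier F" for w
  proof (rule free_group_hom_eq[OF W(1) \<psi>\<eta>[OF \<psi>(2)] \<theta> _ that])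
    fix i assume "i \<in> {1..n}"
    then show "\<psi> (\<eta> (free_gen i)) = \<theta> (free_gen i)"
      using fun_cong[OF \<psi>(1), of i] by (simp add: \<rho>_def)
  qed
  have "continuous_map T\<^sub>P (discrete_topology (carrier W)) \<psi>" using \<psi>(2) by (simp add: C_def S_def)
  from TP.discrete_factors_through_level[OF compact_base_closure this]
  obtain N where N: "N \<in> FIN" "\<And>p q. \<lbrakk>p \<in> P; q \<in> P; p N = q N\<rbrakk> \<Longrightarrow> \<psi> p = \<psi> q"
    unfolding topspace_base_closure by blast
  have "\<theta> w = \<one>\<^bsub>W\<^esub>" if w: "w \<in> carrier F" "\<iota> w \<in> N" for w
  proof -
    have "\<eta> w N = \<eta> \<one>\<^bsub>F\<^esub> N"
      using \<Gamma>.rcos_eq_self_iff[OF \<Gamma>.FIN_subgroup[OF N(1)], of "\<iota> w"]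
        \<Gamma>.rcos_eq_self_iff[OF \<Gamma>.FIN_subgroup[OF N(1)], of "\<iota> \<one>\<^bsub>F\<^esub>"]
        subgroup.one_closed[OF \<Gamma>.FIN_subgroup[OF N(1)]] w
      by (simp add: \<Gamma>.completion_map_level[OF N(1)])
    then have "\<psi> (\<eta> w) = \<psi> (\<eta> \<one>\<^bsub>F\<^esub>)"
      using w(1) by (intro N(2) base_map_in_closure) auto
    then show ?thesis using \<psi>\<theta>[OF w(1)] \<psi>\<theta>[OF F.one_closed] hom_one[OF \<theta> F.is_group W(1)] by simp
  qed
  then show ?thesis using that N(1) by blast
qed

text \<open>\<theta> is determined by the image of F modulo N, so it inherits the period of that
  finite quotient.\<close>

lemma finite_hom_periodic:
  assumes W: "group W" and \<theta>: "\<theta> \<in> hom F W"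
    and N: "N \<in> FIN" "\<And>w. \<lbrakk>w \<in> carrier F; \<iota> w \<in> N\<rbrakk> \<Longrightarrow> \<theta> w = \<one>\<^bsub>W\<^esub>"
  obtains m where "m > 0" "\<And>w. w \<in> carrier F \<Longrightarrow> \<theta> ((f ^^ m) w) = \<theta> w"
proof -
  interpret W: group W by (rule W)
  interpret \<theta>: group_hom F W \<theta> using \<theta> by unfold_locales
  obtain m where m: "m > 0" "\<And>w. w \<in> carrier F \<Longrightarrow> N #>\<^bsub>\<Gamma>\<^esub> \<iota> ((f ^^ m) w) = N #>\<^bsub>\<Gamma>\<^esub> \<iota> w"
    using finite_quotient_hom_periodic[OF \<Gamma>.group_FIN_quotient[OF N(1)] \<Gamma>.finite_FIN_quotient[OF N(1)] quotient_FIN_hom[OF N(1)]] by metis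
  have "\<theta> ((f ^^ m) w) = \<theta> w" if w: "w \<in> carrier F" for w
  proof -
    have fw: "(f ^^ m) w \<in> carrier F" by (rule funpow_closed[OF w])
    have "\<iota> ((f ^^ m) w \<otimes>\<^bsub>F\<^esub> inv\<^bsub>F\<^esub> w) \<in> N"
      using \<Gamma>.rcos_eq_iff_inv[OF \<Gamma>.FIN_subgroup[OF N(1)], of "\<iota> ((f ^^ m) w)" "\<iota> w"] m(2)[OF w] w fw by simp
    then have "\<theta> ((f ^^ m) w \<otimes>\<^bsub>F\<^esub> inv\<^bsub>F\<^esub> w) = \<one>\<^bsub>W\<^esub>" using N(2) w fw by simp
    then have "\<theta> ((f ^^ m) w) \<otimes>\<^bsub>W\<^esub> inv\<^bsub>W\<^esub> \<theta> w = \<one>\<^bsub>W\<^esub>" using w fw by simp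
    then show ?thesis using w fw by (metis W.inv_equality W.inv_inv W.inv_closed \<theta>.hom_closed)
  qed
  then show ?thesis using that m(1) by blast
qed

theorem free_imp_iso:
  fixes U :: "'u itself"
  assumes inf: "infinite (UNIV :: 'u set)" and free: "free_profinite_of_rank U n G\<^sub>P T\<^sub>P"
  shows "f \<in> iso F F"
proof -
  have "carrier F \<subseteq> f ` carrier F"
  proof (rule subsetI, rule ccontr)
    fix g assume g: "g \<in> carrier F" "g \<notin> f ` carrier F"
    define B where "B = f ` free_gen ` {1..n}"
    have B: "finite B" "B \<subseteq> carrier F" using free_gen_F by (auto simp: B_def)
    have gB: "subgroup (generate F B) F" by (rule F.generate_is_subgroup[OF B(2)])
    have "B \<subseteq> f ` carrier F" using free_gen_F by (auto simp: B_def)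
    \<comment> \<open>The subgroup f(F) is generated by the images of the n generators, so the
      separation theorem applies to it.\<close>
    then have "generate F B \<subseteq> f ` carrier F"
      using F.generate_subgroup_incl f.img_is_subgroup by blast
    then have "g \<notin> generate F B" using g(2) by blast
    then obtain W :: "'u monoid" and \<theta> where W: "group W" "finite (carrier W)" "\<theta> \<in> hom F W" "\<theta> g \<notin> \<theta> ` generate F B"
      using free_group_separate[OF B g(1) _ inf] by blast
    obtain N where N: "N \<in> FIN" "\<And>w. \<lbrakk>w \<in> carrier F; \<iota> w \<in> N\<rbrakk> \<Longrightarrow> \<theta> w = \<one>\<^bsub>W\<^esub>"
      using finite_hom_factors_if_free[OF free W(1-3)] by metis
    obtain m where m: "m > 0" "\<And>w. w \<in> carrier F \<Longrightarrow> \<theta> ((f ^^ m) w) = \<theta> w"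
      using finite_hom_periodic[OF W(1,3) N] by metis
    obtain k where k: "m = Suc k" using m(1) gr0_implies_Suc by blast
    have "subgroup {w \<in> carrier F. f w \<in> generate F B} F"
    proof (rule F.subgroupI)
      have "\<one>\<^bsub>F\<^esub> \<in> {w \<in> carrier F. f w \<in> generate F B}" using subgroup.one_closed[OF gB] by simp
      then show "{w \<in> carrier F. f w \<in> generate F B} \<noteq> {}" by blast
    qed (use subgroup.m_closed[OF gB] subgroup.m_inv_closed[OF gB] in auto)
    moreover have "free_gen ` {1..n} \<subseteq> {w \<in> carrier F. f w \<in> generate F B}"
      using free_gen_F by (auto simp: B_def intro: generate.incl)
    \<comment> \<open>As m = k + 1 is positive, f^m g is a value of f and lies in the separated
      subgroup, while \<theta> cannot distinguish it from g.\<close>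
    ultimately have "(f ^^ k) g \<in> {w \<in> carrier F. f w \<in> generate F B}"
      using free_group_subgroup_eq funpow_closed[OF g(1)] by blast
    then have "(f ^^ m) g \<in> generate F B" by (simp add: k)
    then show False using m(2)[OF g(1)] W(4) by (metis imageI)
  qed
  moreover have "inj_on f (carrier F)"
  proof (rule f.inj_on_one_iff[THEN iffD2], intro allI impI, rule ccontr)
    fix w assume w: "w \<in> carrier F" "f w = \<one>\<^bsub>F\<^esub>" "w \<noteq> \<one>\<^bsub>F\<^esub>"
    obtain W :: "'u monoid" and \<theta> where W: "group W" "finite (carrier W)" "\<theta> \<in> hom F W" "\<theta> w \<noteq> \<one>\<^bsub>W\<^esub>"
      by (rule free_group_residually_finite[OF w(1,3) inf])
    obtain N where N: "N \<in> FIN" "\<And>w. \<lbrakk>w \<in> carrier F; \<iota> w \<in> N\<rbrakk> \<Longrightarrow> \<theta> w = \<one>\<^bsub>W\<^esub>"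
      using finite_hom_factors_if_free[OF free W(1-3)] by metis
    obtain m where m: "m > 0" "\<And>w. w \<in> carrier F \<Longrightarrow> \<theta> ((f ^^ m) w) = \<theta> w"
      using finite_hom_periodic[OF W(1,3) N] by metis
    obtain k where k: "m = Suc k" using m(1) gr0_implies_Suc by blast
    \<comment> \<open>Since m > 0, an element of the kernel of f is killed by f^m, and periodicity
      makes \<theta> kill it as well.\<close>
    have "(f ^^ m) w = (f ^^ k) \<one>\<^bsub>F\<^esub>" by (simp add: k funpow_swap1 w(2))
    then have "\<theta> w = \<one>\<^bsub>W\<^esub>"
      using m(2)[OF w(1)] hom_one[OF funpow_hom F.is_group F.is_group] hom_one[OF W(3) F.is_group W(1)] by simp
    then show False using W(4) by simp
  qed
  ultimately show ?thesis using endo by (auto simp: iso_def bij_betw_def)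
qed

end

theorem theorem1p7:
  fixes n :: nat and f :: "nat word \<Rightarrow> nat word"
  assumes "f \<in> hom (free_group {1..n}) (free_group {1..n})"
  shows "let \<Gamma> = hnn_group n f;
             G = profinite_completion \<Gamma>;
             T = profinite_completion_topology \<Gamma>;
             P = hnn_base_closure n f;
             G\<^sub>P = G\<lparr>carrier := P\<rparr>;
             T\<^sub>P = subtopology T P
         in P \<lhd> G
          \<and> profinite_semidirect G T P
               (profinite_completion integer_group) (profinite_completion_topology integer_group)
          \<and> projective_profinite TYPE('m) G\<^sub>P T\<^sub>P
          \<and> (free_profinite_of_rank TYPE('h + nat set) n G\<^sub>P T\<^sub>P
               \<longleftrightarrow> f \<in> iso (free_group {1..n}) (free_group {1..n}))"
proof -
  interpret hnn n f by unfold_locales (rule assms)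
  \<comment> \<open>The finite groups that test freeness are copied into this type, which therefore
    has to be infinite; the singletons of naturals show that it is.\<close>
  have "infinite (range (\<lambda>k :: nat. Inr {k} :: 'h + nat set))"
    by (rule range_inj_infinite) (simp add: inj_def)
  then have inf: "infinite (UNIV :: ('h + nat set) set)" using finite_subset[OF subset_UNIV] by metis
  then show ?thesis
    unfolding Let_def
    by (intro conjI iffI base_closure_normal base_closure_semidirect base_closure_projective)
       (rule free_imp_iso[OF inf], assumption, rule iso_imp_free, assumption)
qed

end
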